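(* Let $n\geq 1$ and let $\mathbb F$ be a field of prime characteristic $p$ with $p\geq n+1$. Let $\mathfrak g=\mathfrak g(n+2)$ be the standard filiform Lie algebra over $\mathbb F$, let $Z(\mathfrak g)$ be the center of $U(\mathfrak g)$, let $Z_p(\mathfrak g)=\mathbb F[x^p,y_0,y_1^p,\ldots,y_n^p]$ be the $p$-center, and let $z_2,\ldots,z_n$ be the elements defined in the context. Then $Z(\mathfrak g)$ is the integral closure of $Z_p(\mathfrak g)[z_2,\ldots,z_n]$ in its field of fractions, and it also coincides with the integral closure of $Z_p(\mathfrak g)[z_2,\ldots,z_n]$ in the localization $Z_p(\mathfrak g)[y_0^{-1},z_2,\ldots,z_n]$. In particular, $Z(\mathfrak g)\subseteq Z_p(\mathfrak g)[y_0^{-1},z_2,\ldots,z_n]$.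
   Context: The standard filiform Lie algebra $\mathfrak g(n+2)$ has basis $x,y_0,y_1,\ldots,y_n$ and nonzero brackets $[x,y_i]=y_{i-1}$ for $1\leq i\leq n$. Since the $y_i$ commute, $\mathbb F[y_0,\ldots,y_n]$ is a subalgebra of $U(\mathfrak g)$ by the Poincaré–Birkhoff–Witt Theorem. Since $p\geq n+1$, $x^p$ is central, and $Z_p(\mathfrak g)=\mathbb F[x^p,y_0,y_1^p,\ldots,y_n^p]$ is a polynomial algebra contained in $Z(\mathfrak g)$. All rings are considered inside the fraction field of $Z(\mathfrak g)$. Definition of $z_i$. First work over $\mathbb Q$. Let $x$ be the derivation $x(f)=\sum_{i=0}^{n-1}y_i\,\partial f/\partial y_{i+1}$ of $\mathbb Q[y_0,\ldots,y_n]$, let $\hat f_n$ be the derivation with $\hat f_n(y_i)=(i+1)(n-i)y_{i+1}$ for $0\leq i\leq n$ (so $\hat f_n(y_n)=0$), and let $\hat h=[x,\hat f_n]$, the derivation with $\hat h(y_i)=(n-2i)y_i$. If $u_1,u_2\in\mathbb Q[y_0,\ldots,y_n]$ are homogeneous elements of $\ker x$ that are $\hat h$-eigenvectors with eigenvalues (weights) $a_1,a_2$ and $0\leq d\leq\min\{a_1,a_2\}$, put $u_{i,0}=u_i$ and $u_{i,k}=\frac{1}{k(a_i-k+1)}\hat f_n(u_{i,k-1})$ for $1\leq k\leq d$, $i\in\{1,2\}$, and define $u_1\circ_d u_2=\sum_{i=0}^d(-1)^iu_{1,i}u_{2,d-i}$, which is again in $\ker x$, of weight $a_1+a_2-2d$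 when nonzero. The element $y_0$ has weight $n$. Set $z_1=y_0$ and, for $2\leq i\leq n$, $z_i=y_0\circ_iy_0$ if $i$ is even, and $z_i=y_0\circ_1(y_0\circ_{i-1}y_0)$ if $i$ is odd. The polynomials $z_i$ have integer coefficients, and in characteristic $p$ the same symbols $z_i$ denote their images in $\mathbb F[y_0,\ldots,y_n]\subseteq U(\mathfrak g)$; these are central in $U(\mathfrak g)$. *)

theory Defs
  imports
    "HOL-Library.Poly_Mapping"
    "HOL-Computational_Algebra.Computational_Algebra"
    "HOL-Algebra.Algebra"
begin

section \<open>Lie algebras and universal enveloping algebras\<close>

text \<open>A Lie algebra is a subspace \<open>L\<close> of an ambient vector space, with a bracket on \<open>L\<close>.\<close>

locale lie_algebra = vector_space scale
  for scale :: "'k::field \<Rightarrow> 'v::ab_group_add \<Rightarrow> 'v" (infixr \<open>*s\<close> 75) +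
  fixes L :: "'v set" and br :: "'v \<Rightarrow> 'v \<Rightarrow> 'v"
  assumes subspace_L: "subspace L"
    and br_closed: "a \<in> L \<Longrightarrow> b \<in> L \<Longrightarrow> br a b \<in> L"
    and br_add_left: "a \<in> L \<Longrightarrow> b \<in> L \<Longrightarrow> c \<in> L \<Longrightarrow> br (a + b) c = br a c + br b c"
    and br_add_right: "a \<in> L \<Longrightarrow> b \<in> L \<Longrightarrow> c \<in> L \<Longrightarrow> br a (b + c) = br a b + br a c"
    and br_scale_left: "a \<in> L \<Longrightarrow> b \<in> L \<Longrightarrow> br (r *s a) b = r *s br a b"
    and br_scale_right: "a \<in> L \<Longrightarrow> b \<in> L \<Longrightarrow> br a (r *s b) = r *s br a b"
    and br_self: "a \<in> L \<Longrightarrow> br a a = 0"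
    and jacobi: "a \<in> L \<Longrightarrow> b \<in> L \<Longrightarrow> c \<in> L \<Longrightarrow>
      br a (br b c) + br b (br c a) + br c (br a b) = 0"

datatype 'v free_word = Word (letters: "'v list")

instantiation free_word :: (type) monoid_add
begin
definition zero_free_word :: "'a free_word" where "0 = Word []"
definition plus_free_word :: "'a free_word \<Rightarrow> 'a free_word \<Rightarrow> 'a free_word"
  where "v + w = Word (letters v @ letters w)"
instance
  by standard (auto simp: zero_free_word_def plus_free_word_def)
end

text \<open>Since \<^typ>\<open>'v free_word\<close> is the free monoid, its monoid algebra
  \<^typ>\<open>'v free_word \<Rightarrow>\<^sub>0 'k\<close> is the free associative algebra on the set of all elements of \<^typ>\<open>'v\<close>.\<close>

type_synonym ('k, 'v) free_alg = "'v free_word \<Rightarrow>\<^sub>0 'k"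

definition fa_const :: "'k \<Rightarrow> ('k::field, 'v) free_alg"
  where "fa_const c = Poly_Mapping.single 0 c"

definition fa_gen :: "'v \<Rightarrow> ('k::field, 'v) free_alg"
  where "fa_gen v = Poly_Mapping.single (Word [v]) 1"

definition free_algebra :: "'v set \<Rightarrow> ('k::field, 'v) free_alg ring"
  where "free_algebra L =
    \<lparr>carrier = {f. \<forall>w\<in>Poly_Mapping.keys f. set (letters w) \<subseteq> L},
     mult = (*), one = 1, ring.zero = 0, add = (+)\<rparr>"

text \<open>The first two families of relations turn the free algebra on the \<^emph>\<open>set\<close> \<open>L\<close> into the
  tensor algebra of the \<^emph>\<open>vector space\<close> \<open>L\<close>; the third one is \<open>a \<otimes> b - b \<otimes> a - [a, b]\<close>.\<close>

definition uea_relations ::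
  "('k::field \<Rightarrow> 'v::ab_group_add \<Rightarrow> 'v) \<Rightarrow> 'v set \<Rightarrow> ('v \<Rightarrow> 'v \<Rightarrow> 'v) \<Rightarrow> ('k, 'v) free_alg set"
  where "uea_relations scale L br =
     {fa_gen (a + b) - fa_gen a - fa_gen b | a b. a \<in> L \<and> b \<in> L}
   \<union> {fa_gen (scale r a) - fa_const r * fa_gen a | r a. a \<in> L}
   \<union> {fa_gen a * fa_gen b - fa_gen b * fa_gen a - fa_gen (br a b) | a b. a \<in> L \<and> b \<in> L}"

definition uea_ideal ::
  "('k::field \<Rightarrow> 'v::ab_group_add \<Rightarrow> 'v) \<Rightarrow> 'v set \<Rightarrow> ('v \<Rightarrow> 'v \<Rightarrow> 'v) \<Rightarrow> ('k, 'v) free_alg set"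
  where "uea_ideal scale L br = genideal (free_algebra L) (uea_relations scale L br)"

definition uea ::
  "('k::field \<Rightarrow> 'v::ab_group_add \<Rightarrow> 'v) \<Rightarrow> 'v set \<Rightarrow> ('v \<Rightarrow> 'v \<Rightarrow> 'v) \<Rightarrow> ('k, 'v) free_alg set ring"
  where "uea scale L br = free_algebra L Quot uea_ideal scale L br"

lemma free_algebra_ring: "ring (free_algebra L :: ('k::field, 'v) free_alg ring)"
proof -
  define C :: "('k, 'v) free_alg set"
    where "C = {f. \<forall>w\<in>Poly_Mapping.keys f. set (letters w) \<subseteq> L}"
  have R: "free_algebra L = \<lparr>carrier = C, mult = (*), one = 1, ring.zero = 0, add = (+)\<rparr>"
    by (simp add: free_algebra_def C_def)
  have add: "f + g \<in> C" if "f \<in> C" "g \<in> C" for f g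
  proof -
    have "w \<in> Poly_Mapping.keys f \<union> Poly_Mapping.keys g" if "w \<in> Poly_Mapping.keys (f + g)" for w
      using keys_add[of f g] that by (rule subsetD)
    with \<open>f \<in> C\<close> \<open>g \<in> C\<close> show ?thesis unfolding C_def by blast
  qed
  have mult: "f * g \<in> C" if fg: "f \<in> C" "g \<in> C" for f g
    unfolding C_def
  proof (intro CollectI ballI)
    fix w assume "w \<in> Poly_Mapping.keys (f * g)"
    with keys_mult[of f g] have "w \<in> {a + b | a b. a \<in> Poly_Mapping.keys f \<and> b \<in> Poly_Mapping.keys g}"
      by (rule subsetD)
    then obtain a b where ab: "a \<in> Poly_Mapping.keys f" "b \<in> Poly_Mapping.keys g" "w = a + b"
      by blast
    have "set (letters a) \<subseteq> L" "set (letters b) \<subseteq> L"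
      using fg ab(1,2) unfolding C_def by blast+
    thus "set (letters w) \<subseteq> L"
      by (simp add: ab(3) plus_free_word_def)
  qed
  have one: "1 \<in> C"
    by (simp add: C_def zero_free_word_def)
  have zero: "0 \<in> C"
    by (simp add: C_def)
  have minus: "- f \<in> C" if "f \<in> C" for f
    using that by (simp add: C_def)
  show ?thesis
    unfolding R
  proof (rule ringI)
    show "abelian_group \<lparr>carrier = C, mult = (*), one = 1, ring.zero = 0, add = (+)\<rparr>"
    proof (rule abelian_groupI, goal_cases)
      case (6 f)
      thus ?case using minus[of f] by (intro bexI[of _ "- f"]) simp_all
    qed (simp_all add: add zero add.assoc add.commute)
    show "Group.monoid \<lparr>carrier = C, mult = (*), one = 1, ring.zero = 0, add = (+)\<rparr>"
      by (rule monoidI) (simp_all add: mult one mult.assoc)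
  qed (simp_all add: distrib_left distrib_right)
qed

definition ring_center :: "('a, 'b) ring_scheme \<Rightarrow> 'a set"
  where "ring_center R = {z \<in> carrier R. \<forall>u\<in>carrier R. z \<otimes>\<^bsub>R\<^esub> u = u \<otimes>\<^bsub>R\<^esub> z}"


section \<open>Fraction fields and integral closures\<close>

definition frac_rel :: "('a, 'b) ring_scheme \<Rightarrow> (('a \<times> 'a) \<times> ('a \<times> 'a)) set"
  where "frac_rel R = {((a, b), (c, d)).
     a \<in> carrier R \<and> b \<in> carrier R - {\<zero>\<^bsub>R\<^esub>} \<and> c \<in> carrier R \<and> d \<in> carrier R - {\<zero>\<^bsub>R\<^esub>} \<and>
     a \<otimes>\<^bsub>R\<^esub> d = c \<otimes>\<^bsub>R\<^esub> b}"

definition frac_of :: "('a, 'b) ring_scheme \<Rightarrow> 'a \<Rightarrow> 'a \<Rightarrow> ('a \<times> 'a) set"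
  where "frac_of R a b = frac_rel R `` {(a, b)}"

definition frac_field :: "('a, 'b) ring_scheme \<Rightarrow> ('a \<times> 'a) set ring"
  where "frac_field R =
    \<lparr>carrier = (carrier R \<times> (carrier R - {\<zero>\<^bsub>R\<^esub>})) // frac_rel R,
     mult = (\<lambda>S T. \<Union>(a, b)\<in>S. \<Union>(c, d)\<in>T. frac_of R (a \<otimes>\<^bsub>R\<^esub> c) (b \<otimes>\<^bsub>R\<^esub> d)),
     one = frac_of R \<one>\<^bsub>R\<^esub> \<one>\<^bsub>R\<^esub>,
     ring.zero = frac_of R \<zero>\<^bsub>R\<^esub> \<one>\<^bsub>R\<^esub>,
     add = (\<lambda>S T. \<Union>(a, b)\<in>S. \<Union>(c, d)\<in>T. frac_of R (a \<otimes>\<^bsub>R\<^esub> d \<oplus>\<^bsub>R\<^esub> c \<otimes>\<^bsub>R\<^esub> b) (b \<otimes>\<^bsub>R\<^esub> d))\<rparr>"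

definition frac_emb :: "('a, 'b) ring_scheme \<Rightarrow> 'a \<Rightarrow> ('a \<times> 'a) set"
  where "frac_emb R a = frac_of R a \<one>\<^bsub>R\<^esub>"

lemma UN_pairs_const:
  assumes "S \<noteq> {}" "T \<noteq> {}" "\<And>a b c d. (a, b) \<in> S \<Longrightarrow> (c, d) \<in> T \<Longrightarrow> G a b c d = K"
  shows "(\<Union>(a, b)\<in>S. \<Union>(c, d)\<in>T. G a b c d) = K"
proof -
  have inner: "(\<Union>(c, d)\<in>T. G a b c d) = K" if "(a, b) \<in> S" for a b
  proof (rule SUP_eq_const[OF assms(2)])
    fix q assume "q \<in> T"
    with that assms(3) show "(case q of (c, d) \<Rightarrow> G a b c d) = K" by (cases q) simp
  qed
  show ?thesis
  proof (rule SUP_eq_const[OF assms(1)])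
    fix q assume "q \<in> S"
    with inner show "(case q of (a, b) \<Rightarrow> \<Union>(c, d)\<in>T. G a b c d) = K" by (cases q) simp
  qed
qed

context domain
begin

lemma frac_eq_iff:
  assumes "a \<in> carrier R" "b \<in> carrier R - {\<zero>}" "c \<in> carrier R" "d \<in> carrier R - {\<zero>}"
  shows "frac_of R a b = frac_of R c d \<longleftrightarrow> a \<otimes> d = c \<otimes> b"
proof
  assume "frac_of R a b = frac_of R c d"
  moreover have "(c, d) \<in> frac_of R c d" using assms by (auto simp: frac_of_def frac_rel_def)
  ultimately show "a \<otimes> d = c \<otimes> b" by (auto simp: frac_of_def frac_rel_def)
next
  have trans: "a1 \<otimes> d1 = e1 \<otimes> b1"
    if eqs: "a1 \<otimes> c2 = c1 \<otimes> b1" "c1 \<otimes> d1 = e1 \<otimes> c2"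
      and mem: "a1 \<in> carrier R" "b1 \<in> carrier R - {\<zero>}" "c1 \<in> carrier R" "c2 \<in> carrier R - {\<zero>}"
      "e1 \<in> carrier R" "d1 \<in> carrier R - {\<zero>}" for a1 b1 c1 c2 d1 e1
  proof -
    have "c2 \<otimes> (a1 \<otimes> d1) = (a1 \<otimes> c2) \<otimes> d1" using mem by (simp add: m_ac)
    also have "\<dots> = (c1 \<otimes> d1) \<otimes> b1" unfolding eqs(1) using mem by (simp add: m_ac)
    also have "\<dots> = c2 \<otimes> (e1 \<otimes> b1)" unfolding eqs(2) using mem by (simp add: m_ac)
    finally show ?thesis using mem by (simp add: m_lcancel)
  qed
  assume eq: "a \<otimes> d = c \<otimes> b"
  show "frac_of R a b = frac_of R c d"
  proof (rule Set.set_eqI, clarify)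
    fix e f
    show "(e, f) \<in> frac_of R a b \<longleftrightarrow> (e, f) \<in> frac_of R c d"
      using assms trans[of c b a d f e] trans[of a d c b f e] eq
      by (auto simp: frac_of_def frac_rel_def)
  qed
qed

lemma frac_refl: "a \<in> carrier R \<Longrightarrow> b \<in> carrier R - {\<zero>} \<Longrightarrow> (a, b) \<in> frac_of R a b"
  by (auto simp: frac_of_def frac_rel_def)

lemma frac_memD:
  assumes "(c, d) \<in> frac_of R a b"
  shows "c \<in> carrier R" "d \<in> carrier R - {\<zero>}" "a \<otimes> d = c \<otimes> b"
  using assms by (auto simp: frac_of_def frac_rel_def)

lemma carrier_frac_field:
  "carrier (frac_field R) = {frac_of R a b | a b. a \<in> carrier R \<and> b \<in> carrier R - {\<zero>}}"
  by (auto simp: frac_field_def frac_of_def quotient_def)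

lemma frac_nonzero_mult:
  "b \<in> carrier R - {\<zero>} \<Longrightarrow> d \<in> carrier R - {\<zero>} \<Longrightarrow> b \<otimes> d \<in> carrier R - {\<zero>}"
  using integral by auto

lemma frac_mult:
  assumes "a \<in> carrier R" "b \<in> carrier R - {\<zero>}" "c \<in> carrier R" "d \<in> carrier R - {\<zero>}"
  shows "frac_of R a b \<otimes>\<^bsub>frac_field R\<^esub> frac_of R c d = frac_of R (a \<otimes> c) (b \<otimes> d)"
proof -
  have "frac_of R (a' \<otimes> c') (b' \<otimes> d') = frac_of R (a \<otimes> c) (b \<otimes> d)"
    if "(a', b') \<in> frac_of R a b" "(c', d') \<in> frac_of R c d" for a' b' c' d'
  proof -
    note A = frac_memD[OF that(1)] and C = frac_memD[OF that(2)]
    have "(a' \<otimes> c') \<otimes> (b \<otimes> d) = (a' \<otimes> b) \<otimes> (c' \<otimes> d)" using A(1,2) C(1,2) assms by (simp add: m_ac)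
    also have "\<dots> = (a \<otimes> b') \<otimes> (c \<otimes> d')" unfolding A(3) C(3) ..
    also have "\<dots> = (a \<otimes> c) \<otimes> (b' \<otimes> d')" using A(1,2) C(1,2) assms by (simp add: m_ac)
    finally show ?thesis
      using A(1,2) C(1,2) assms frac_nonzero_mult[OF A(2) C(2)] frac_nonzero_mult[OF assms(2,4)]
      by (subst frac_eq_iff) simp_all
  qed
  hence "(\<Union>(a', b')\<in>frac_of R a b. \<Union>(c', d')\<in>frac_of R c d. frac_of R (a' \<otimes> c') (b' \<otimes> d'))
      = frac_of R (a \<otimes> c) (b \<otimes> d)"
    using frac_refl[OF assms(1,2)] frac_refl[OF assms(3,4)] by (intro UN_pairs_const) blast+
  thus ?thesis by (simp add: frac_field_def)
qed

lemma frac_add: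
  assumes "a \<in> carrier R" "b \<in> carrier R - {\<zero>}" "c \<in> carrier R" "d \<in> carrier R - {\<zero>}"
  shows "frac_of R a b \<oplus>\<^bsub>frac_field R\<^esub> frac_of R c d = frac_of R (a \<otimes> d \<oplus> c \<otimes> b) (b \<otimes> d)"
proof -
  have "frac_of R (a' \<otimes> d' \<oplus> c' \<otimes> b') (b' \<otimes> d') = frac_of R (a \<otimes> d \<oplus> c \<otimes> b) (b \<otimes> d)"
    if "(a', b') \<in> frac_of R a b" "(c', d') \<in> frac_of R c d" for a' b' c' d'
  proof -
    note A = frac_memD[OF that(1)] and C = frac_memD[OF that(2)]
    have "(a' \<otimes> d' \<oplus> c' \<otimes> b') \<otimes> (b \<otimes> d)
        = (a' \<otimes> b) \<otimes> (d' \<otimes> d) \<oplus> (c' \<otimes> d) \<otimes> (b' \<otimes> b)"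
      using A(1,2) C(1,2) assms by (simp add: m_ac l_distr r_distr)
    also have "\<dots> = (a \<otimes> b') \<otimes> (d' \<otimes> d) \<oplus> (c \<otimes> d') \<otimes> (b' \<otimes> b)" unfolding A(3) C(3) ..
    also have "\<dots> = (a \<otimes> d \<oplus> c \<otimes> b) \<otimes> (b' \<otimes> d')"
      using A(1,2) C(1,2) assms by (simp add: m_ac l_distr r_distr)
    finally show ?thesis
      using A(1,2) C(1,2) assms frac_nonzero_mult[OF A(2) C(2)] frac_nonzero_mult[OF assms(2,4)]
      by (subst frac_eq_iff) simp_all
  qed
  hence "(\<Union>(a', b')\<in>frac_of R a b. \<Union>(c', d')\<in>frac_of R c d. frac_of R (a' \<otimes> d' \<oplus> c' \<otimes> b') (b' \<otimes> d'))
      = frac_of R (a \<otimes> d \<oplus> c \<otimes> b) (b \<otimes> d)"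
    using frac_refl[OF assms(1,2)] frac_refl[OF assms(3,4)] by (intro UN_pairs_const) blast+
  thus ?thesis by (simp add: frac_field_def)
qed

lemma frac_one: "\<one>\<^bsub>frac_field R\<^esub> = frac_of R \<one> \<one>"
  and frac_zero: "\<zero>\<^bsub>frac_field R\<^esub> = frac_of R \<zero> \<one>"
  by (simp_all add: frac_field_def)

lemma frac_field_cases:
  assumes "x \<in> carrier (frac_field R)"
  obtains a b where "x = frac_of R a b" "a \<in> carrier R" "b \<in> carrier R" "b \<noteq> \<zero>"
  using assms unfolding carrier_frac_field by blast

lemma frac_in_carrier:
  "a \<in> carrier R \<Longrightarrow> b \<in> carrier R \<Longrightarrow> b \<noteq> \<zero> \<Longrightarrow> frac_of R a b \<in> carrier (frac_field R)"
  unfolding carrier_frac_field by blast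

lemma frac_field_field: "field (frac_field R)"
proof (rule cring.cring_fieldI2)
  have add_closed: "x \<oplus>\<^bsub>frac_field R\<^esub> y \<in> carrier (frac_field R)"
    if "x \<in> carrier (frac_field R)" "y \<in> carrier (frac_field R)" for x y
    by (rule frac_field_cases[OF that(1)], rule frac_field_cases[OF that(2)])
       (simp add: frac_add frac_in_carrier integral_iff)
  have mult_closed: "x \<otimes>\<^bsub>frac_field R\<^esub> y \<in> carrier (frac_field R)"
    if "x \<in> carrier (frac_field R)" "y \<in> carrier (frac_field R)" for x y
    by (rule frac_field_cases[OF that(1)], rule frac_field_cases[OF that(2)])
       (simp add: frac_mult frac_in_carrier integral_iff)
  have zero_closed: "\<zero>\<^bsub>frac_field R\<^esub> \<in> carrier (frac_field R)"
    and one_closed: "\<one>\<^bsub>frac_field R\<^esub> \<in> carrier (frac_field R)"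
    by (simp_all add: frac_zero frac_one frac_in_carrier)
  have add_comm: "x \<oplus>\<^bsub>frac_field R\<^esub> y = y \<oplus>\<^bsub>frac_field R\<^esub> x"
    if "x \<in> carrier (frac_field R)" "y \<in> carrier (frac_field R)" for x y
    by (rule frac_field_cases[OF that(1)], rule frac_field_cases[OF that(2)])
       (simp add: frac_add a_comm m_comm)
  have mult_comm: "x \<otimes>\<^bsub>frac_field R\<^esub> y = y \<otimes>\<^bsub>frac_field R\<^esub> x"
    if "x \<in> carrier (frac_field R)" "y \<in> carrier (frac_field R)" for x y
    by (rule frac_field_cases[OF that(1)], rule frac_field_cases[OF that(2)])
       (simp add: frac_mult m_comm)
  have add_assoc: "x \<oplus>\<^bsub>frac_field R\<^esub> y \<oplus>\<^bsub>frac_field R\<^esub> z = x \<oplus>\<^bsub>frac_field R\<^esub> (y \<oplus>\<^bsub>frac_field R\<^esub> z)"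
    if "x \<in> carrier (frac_field R)" "y \<in> carrier (frac_field R)" "z \<in> carrier (frac_field R)" for x y z
    by (rule frac_field_cases[OF that(1)], rule frac_field_cases[OF that(2)],
        rule frac_field_cases[OF that(3)])
       (simp add: frac_add integral_iff l_distr r_distr m_ac a_ac)
  have mult_assoc: "x \<otimes>\<^bsub>frac_field R\<^esub> y \<otimes>\<^bsub>frac_field R\<^esub> z = x \<otimes>\<^bsub>frac_field R\<^esub> (y \<otimes>\<^bsub>frac_field R\<^esub> z)"
    if "x \<in> carrier (frac_field R)" "y \<in> carrier (frac_field R)" "z \<in> carrier (frac_field R)" for x y z
    by (rule frac_field_cases[OF that(1)], rule frac_field_cases[OF that(2)],
        rule frac_field_cases[OF that(3)])
       (simp add: frac_mult integral_iff m_assoc)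
  have distr: "(x \<oplus>\<^bsub>frac_field R\<^esub> y) \<otimes>\<^bsub>frac_field R\<^esub> z
      = x \<otimes>\<^bsub>frac_field R\<^esub> z \<oplus>\<^bsub>frac_field R\<^esub> y \<otimes>\<^bsub>frac_field R\<^esub> z"
    if "x \<in> carrier (frac_field R)" "y \<in> carrier (frac_field R)" "z \<in> carrier (frac_field R)" for x y z
    by (rule frac_field_cases[OF that(1)], rule frac_field_cases[OF that(2)],
        rule frac_field_cases[OF that(3)])
       (simp add: frac_add frac_mult frac_eq_iff integral_iff l_distr r_distr m_ac)
  have zero_left: "\<zero>\<^bsub>frac_field R\<^esub> \<oplus>\<^bsub>frac_field R\<^esub> x = x"
    and one_left: "\<one>\<^bsub>frac_field R\<^esub> \<otimes>\<^bsub>frac_field R\<^esub> x = x"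
    if "x \<in> carrier (frac_field R)" for x
    by (rule frac_field_cases[OF that], simp add: frac_zero frac_one frac_add frac_mult)+
  have minus: "\<exists>y\<in>carrier (frac_field R). y \<oplus>\<^bsub>frac_field R\<^esub> x = \<zero>\<^bsub>frac_field R\<^esub>"
    if x: "x \<in> carrier (frac_field R)" for x
  proof -
    from x obtain a b where ab: "x = frac_of R a b" "a \<in> carrier R" "b \<in> carrier R" "b \<noteq> \<zero>"
      by (rule frac_field_cases)
    have "frac_of R (\<ominus> a) b \<oplus>\<^bsub>frac_field R\<^esub> x = \<zero>\<^bsub>frac_field R\<^esub>"
      using ab(2-4) unfolding ab(1) frac_zero
      by (simp add: frac_add frac_eq_iff integral_iff l_minus l_neg)
    thus ?thesis using frac_in_carrier[of "\<ominus> a" b] ab by blast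
  qed
  show "cring (frac_field R)"
    by (intro cringI abelian_groupI comm_monoidI add_closed mult_closed zero_closed one_closed
        add_comm mult_comm add_assoc mult_assoc distr zero_left one_left minus)
  show "\<zero>\<^bsub>frac_field R\<^esub> \<noteq> \<one>\<^bsub>frac_field R\<^esub>"
    by (simp add: frac_zero frac_one frac_eq_iff)
  fix x assume x: "x \<in> carrier (frac_field R)" "x \<noteq> \<zero>\<^bsub>frac_field R\<^esub>"
  from x(1) obtain a b where ab: "x = frac_of R a b" "a \<in> carrier R" "b \<in> carrier R" "b \<noteq> \<zero>"
    by (rule frac_field_cases)
  have a: "a \<noteq> \<zero>"
    using x(2) ab(2-4) unfolding ab(1) frac_zero by (auto simp: frac_eq_iff)
  have "x \<otimes>\<^bsub>frac_field R\<^esub> frac_of R b a = \<one>\<^bsub>frac_field R\<^esub>"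
    using ab(2-4) a unfolding ab(1) frac_one
    by (simp add: frac_mult frac_eq_iff integral_iff m_comm)
  thus "\<exists>y\<in>carrier (frac_field R). x \<otimes>\<^bsub>frac_field R\<^esub> y = \<one>\<^bsub>frac_field R\<^esub>"
    using frac_in_carrier[of b a] ab a by blast
qed

end

text \<open>The integral closure of the subring \<open>A\<close> in the subring \<open>B\<close> of \<open>R\<close>.
  Polynomials are coefficient lists with the leading coefficient in front.\<close>

definition integral_closure :: "('a, 'b) ring_scheme \<Rightarrow> 'a set \<Rightarrow> 'a set \<Rightarrow> 'a set"
  where "integral_closure R A B =
    {b \<in> B. \<exists>f. polynomial\<^bsub>R\<^esub> A f \<and> f \<noteq> [] \<and> lead_coeff f = \<one>\<^bsub>R\<^esub> \<and> ring.eval R f b = \<zero>\<^bsub>R\<^esub>}"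


section \<open>The standard filiform Lie algebra\<close>

datatype fil_basis = Bx | By nat

type_synonym 'k fil = "fil_basis \<Rightarrow>\<^sub>0 'k"

definition fil_scale :: "'k::field \<Rightarrow> 'k fil \<Rightarrow> 'k fil"
  where "fil_scale c = Poly_Mapping.map ((*) c)"

definition fil_vec :: "fil_basis \<Rightarrow> 'k::field fil"
  where "fil_vec b = Poly_Mapping.single b 1"

definition fil_space :: "nat \<Rightarrow> 'k::field fil set"
  where "fil_space n = {v. Poly_Mapping.keys v \<subseteq> insert Bx (By ` {..n})}"

text \<open>The bilinear alternating extension of \<open>[x, y\<^sub>i] = y\<^sub>i\<^sub>-\<^sub>1\<close> for \<open>1 \<le> i \<le> n\<close>, all other
  brackets \<open>[x, y\<^sub>0]\<close> and \<open>[y\<^sub>i, y\<^sub>j]\<close> being zero.\<close>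

definition fil_bracket :: "nat \<Rightarrow> 'k::field fil \<Rightarrow> 'k fil \<Rightarrow> 'k fil"
  where "fil_bracket n v w = (\<Sum>i=1..n. Poly_Mapping.single (By (i - 1))
    (Poly_Mapping.lookup v Bx * Poly_Mapping.lookup w (By i)
     - Poly_Mapping.lookup v (By i) * Poly_Mapping.lookup w Bx))"

lemma lookup_fil_scale [simp]:
  "Poly_Mapping.lookup (fil_scale c v) b = c * Poly_Mapping.lookup v b"
  by (simp add: fil_scale_def Poly_Mapping.map.rep_eq when_def)

lemma lookup_fil_bracket:
  "Poly_Mapping.lookup (fil_bracket n v w) b =
    (case b of Bx \<Rightarrow> 0 | By j \<Rightarrow> if j < n then
       Poly_Mapping.lookup v Bx * Poly_Mapping.lookup w (By (Suc j))
       - Poly_Mapping.lookup v (By (Suc j)) * Poly_Mapping.lookup w Bx else 0)"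
proof (cases b)
  case Bx
  thus ?thesis by (simp add: fil_bracket_def lookup_sum lookup_single)
next
  case (By j)
  let ?g = "\<lambda>i. Poly_Mapping.lookup v Bx * Poly_Mapping.lookup w (By i)
     - Poly_Mapping.lookup v (By i) * Poly_Mapping.lookup w Bx"
  have "Poly_Mapping.lookup (fil_bracket n v w) b = (\<Sum>i=1..n. if i = Suc j then ?g i else 0)"
    unfolding fil_bracket_def By lookup_sum
    by (intro sum.cong) (auto simp: lookup_single when_def)
  thus ?thesis using By by (simp add: sum.delta)
qed

lemma fil_bracket_basis:
  assumes "1 \<le> i" "i \<le> n"
  shows "fil_bracket n (fil_vec Bx) (fil_vec (By i)) = (fil_vec (By (i - 1)) :: 'k::field fil)"
  by (rule poly_mapping_eqI)
     (use assms in \<open>auto simp: lookup_fil_bracket fil_vec_def lookup_single when_def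
       split: fil_basis.splits\<close>)

lemma filiform_lie_algebra:
  "lie_algebra fil_scale (fil_space n :: 'k::field fil set) (fil_bracket n)"
proof -
  interpret V: vector_space "fil_scale :: 'k \<Rightarrow> 'k fil \<Rightarrow> 'k fil"
    by standard (auto intro!: poly_mapping_eqI simp: lookup_add algebra_simps)
  have mem: "v \<in> fil_space n \<longleftrightarrow> (\<forall>j>n. Poly_Mapping.lookup v (By j) = 0)" for v :: "'k fil"
  proof
    show "v \<in> fil_space n \<Longrightarrow> \<forall>j>n. Poly_Mapping.lookup v (By j) = 0"
      by (auto simp: fil_space_def in_keys_iff subset_iff)
  next
    assume *: "\<forall>j>n. Poly_Mapping.lookup v (By j) = 0"
    have "b \<in> insert Bx (By ` {..n})" if "Poly_Mapping.lookup v b \<noteq> 0" for b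
    proof (cases b)
      case (By j)
      with * that have "\<not> j > n" by blast
      with By show ?thesis by simp
    qed simp
    thus "v \<in> fil_space n" by (auto simp: fil_space_def in_keys_iff)
  qed
  show ?thesis
  proof (unfold_locales, goal_cases)
    case 1
    show ?case by (simp add: V.subspace_def mem lookup_add)
  qed (simp_all add: mem poly_mapping_eq_iff fun_eq_iff lookup_fil_bracket lookup_add
         algebra_simps split: fil_basis.split)
qed

definition fil_uea :: "nat \<Rightarrow> ('k::field, 'k fil) free_alg set ring"
  where "fil_uea n = uea fil_scale (fil_space n) (fil_bracket n)"

definition fil_class :: "nat \<Rightarrow> ('k::field, 'k fil) free_alg \<Rightarrow> ('k, 'k fil) free_alg set"
  where "fil_class n f =
    uea_ideal fil_scale (fil_space n) (fil_bracket n) +>\<^bsub>free_algebra (fil_space n)\<^esub> f"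

definition fil_const :: "nat \<Rightarrow> 'k::field \<Rightarrow> ('k, 'k fil) free_alg set"
  where "fil_const n c = fil_class n (fa_const c)"

definition fil_x :: "nat \<Rightarrow> ('k::field, 'k fil) free_alg set"
  where "fil_x n = fil_class n (fa_gen (fil_vec Bx))"

definition fil_y :: "nat \<Rightarrow> nat \<Rightarrow> ('k::field, 'k fil) free_alg set"
  where "fil_y n i = fil_class n (fa_gen (fil_vec (By i)))"

definition fil_center :: "nat \<Rightarrow> ('k::field, 'k fil) free_alg set set"
  where "fil_center n = ring_center (fil_uea n)"

definition fil_p_center :: "nat \<Rightarrow> nat \<Rightarrow> ('k::field, 'k fil) free_alg set set"
  where "fil_p_center p n = generate_ring (fil_uea n)
    (range (fil_const n) \<union> {fil_x n [^]\<^bsub>fil_uea n\<^esub> p, fil_y n 0}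
      \<union> {fil_y n i [^]\<^bsub>fil_uea n\<^esub> p | i. 1 \<le> i \<and> i \<le> n})"


section \<open>The central elements \<open>z\<^sub>i\<close>\<close>

text \<open>Polynomials in the variables \<open>y\<^sub>0, y\<^sub>1, \<dots>\<close>; a monomial is its exponent vector.\<close>

type_synonym 'r ypoly = "(nat \<Rightarrow>\<^sub>0 nat) \<Rightarrow>\<^sub>0 'r"

definition yvar :: "nat \<Rightarrow> 'r::comm_ring_1 ypoly"
  where "yvar i = Poly_Mapping.single (Poly_Mapping.single i 1) 1"

definition yconst :: "'r \<Rightarrow> 'r::comm_ring_1 ypoly"
  where "yconst c = Poly_Mapping.single 0 c"

definition ypderiv :: "nat \<Rightarrow> 'r::comm_ring_1 ypoly \<Rightarrow> 'r ypoly"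
  where "ypderiv i f = (\<Sum>m\<in>Poly_Mapping.keys f.
    Poly_Mapping.single (m - Poly_Mapping.single i 1)
      (of_nat (Poly_Mapping.lookup m i) * Poly_Mapping.lookup f m))"

definition x_der :: "nat \<Rightarrow> rat ypoly \<Rightarrow> rat ypoly"
  where "x_der n f = (\<Sum>i<n. yvar i * ypderiv (Suc i) f)"

text \<open>The summand \<open>i = n\<close> vanishes because of the factor \<open>n - i\<close>.\<close>

definition f_der :: "nat \<Rightarrow> rat ypoly \<Rightarrow> rat ypoly"
  where "f_der n f = (\<Sum>i\<le>n. of_nat ((i + 1) * (n - i)) * yvar (i + 1) * ypderiv i f)"

definition h_der :: "nat \<Rightarrow> rat ypoly \<Rightarrow> rat ypoly"
  where "h_der n f = x_der n (f_der n f) - f_der n (x_der n f)"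

text \<open>Unique if \<open>u\<close> is a nonzero eigenvector of \<open>h_der n\<close>; for \<open>u = 0\<close> the value is irrelevant
  below, because then all \<open>u\<^sub>k\<close> vanish.\<close>

definition weight :: "nat \<Rightarrow> rat ypoly \<Rightarrow> rat"
  where "weight n u = (THE a. h_der n u = yconst a * u)"

text \<open>\<open>ladder n a u k\<close> is \<open>u\<^sub>k\<close>, for \<open>u\<close> of weight \<open>a\<close>.\<close>

fun ladder :: "nat \<Rightarrow> rat \<Rightarrow> rat ypoly \<Rightarrow> nat \<Rightarrow> rat ypoly" where
  "ladder n a u 0 = u"
| "ladder n a u (Suc k) =
     yconst (1 / (of_nat (Suc k) * (a - of_nat (Suc k) + 1))) * f_der n (ladder n a u k)"

definition circ :: "nat \<Rightarrow> nat \<Rightarrow> rat ypoly \<Rightarrow> rat ypoly \<Rightarrow> rat ypoly"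
  where "circ n d u v =
    (\<Sum>i\<le>d. (-1) ^ i * ladder n (weight n u) u i * ladder n (weight n v) v (d - i))"

definition z_rat :: "nat \<Rightarrow> nat \<Rightarrow> rat ypoly"
  where "z_rat n i =
    (if i = 1 then yvar 0
     else if even i then circ n i (yvar 0) (yvar 0)
     else circ n 1 (yvar 0) (circ n (i - 1) (yvar 0) (yvar 0)))"

text \<open>The coefficients of \<open>z\<^sub>i\<close> are integers, so that the floor only changes their type.\<close>

definition z_poly :: "nat \<Rightarrow> nat \<Rightarrow> 'k::field ypoly"
  where "z_poly n i = Poly_Mapping.map (\<lambda>c. of_int \<lfloor>c\<rfloor>) (z_rat n i)"

text \<open>The map \<open>F[y\<^sub>0, \<dots>, y\<^sub>n] \<rightarrow> U(g)\<close>. The \<open>y\<^sub>i\<close> commute in \<open>U(g)\<close>, so the order of the factors is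
  immaterial.\<close>

definition fil_of_ypoly :: "nat \<Rightarrow> 'k::field ypoly \<Rightarrow> ('k, 'k fil) free_alg set"
  where "fil_of_ypoly n f = fil_class n (\<Sum>m\<in>Poly_Mapping.keys f.
    fa_const (Poly_Mapping.lookup f m) *
    prod_list (map (\<lambda>i. fa_gen (fil_vec (By i)) ^ Poly_Mapping.lookup m i) [0..<Suc n]))"

definition fil_z :: "nat \<Rightarrow> nat \<Rightarrow> ('k::field, 'k fil) free_alg set"
  where "fil_z n i = fil_of_ypoly n (z_poly n i)"


section \<open>Subrings of the fraction field of the center\<close>

definition fil_center_ring :: "nat \<Rightarrow> ('k::field, 'k fil) free_alg set ring"
  where "fil_center_ring n = (fil_uea n)\<lparr>carrier := fil_center n\<rparr>"

type_synonym 'k fil_frac = "(('k, 'k fil) free_alg set \<times> ('k, 'k fil) free_alg set) set"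

definition fil_Q :: "nat \<Rightarrow> 'k::field fil_frac ring"
  where "fil_Q n = frac_field (fil_center_ring n)"

definition fil_emb :: "nat \<Rightarrow> ('k::field, 'k fil) free_alg set \<Rightarrow> 'k fil_frac"
  where "fil_emb n = frac_emb (fil_center_ring n)"

text \<open>\<open>Z\<^sub>p(g)[z\<^sub>2, \<dots>, z\<^sub>n]\<close> and \<open>Z\<^sub>p(g)[y\<^sub>0\<^sup>-\<^sup>1, z\<^sub>2, \<dots>, z\<^sub>n]\<close>.\<close>

definition fil_Zpz :: "nat \<Rightarrow> nat \<Rightarrow> 'k::field fil_frac set"
  where "fil_Zpz p n = generate_ring (fil_Q n)
    (fil_emb n ` (fil_p_center p n \<union> {fil_z n i | i. 2 \<le> i \<and> i \<le> n}))"

definition fil_Zpz_loc :: "nat \<Rightarrow> nat \<Rightarrow> 'k::field fil_frac set"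
  where "fil_Zpz_loc p n = generate_ring (fil_Q n)
    (fil_emb n ` (fil_p_center p n \<union> {fil_z n i | i. 2 \<le> i \<and> i \<le> n})
      \<union> {inv\<^bsub>fil_Q n\<^esub> (fil_emb n (fil_y n 0))})"

end

theory Submission
  imports Defs
begin

text \<open>
  \<open>U(g)\<close> acts faithfully on \<open>F[y\<^sub>0, \<dots>, y\<^sub>n, t]\<close>, with \<open>y\<^sub>i\<close> acting by multiplication and \<open>x\<close> by \<open>D + t\<close>, where \<open>D\<close>
  is the derivation \<open>y\<^sub>i \<mapsto> y\<^sub>i\<^sub>-\<^sub>1\<close>; evaluation at \<open>1\<close> is a linear bijection onto the polynomial ring.
  Commuting with \<open>x\<close> and \<open>y\<^sub>1\<close> forces the symbol \<open>c\<close> of a central element to satisfy \<open>D c = 0\<close> and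
  \<open>\<partial>c/\<partial>t = 0\<close>, and conversely such an element acts by multiplication with \<open>c\<close>, since \<open>(D + t)\<^sup>p = t\<^sup>p\<close>. So the
  center is the kernel of two derivations of a polynomial ring, and is integrally closed because the
  polynomial ring is (by a leading-monomial argument). It is integral over the \<open>p\<close>-center because
  \<open>c\<^sup>p\<close> lies there. Finally \<open>z\<^sub>i\<close> is a unit times a power of \<open>y\<^sub>0\<close> times \<open>y\<^sub>i\<close> plus terms in
  \<open>y\<^sub>0, \<dots>, y\<^sub>i\<^sub>-\<^sub>1\<close>, so after inverting \<open>y\<^sub>0\<close> every polynomial is a combination of \<open>1, y\<^sub>1, \<dots>, y\<^sub>1\<^bsup>p-1\<^esup>\<close> with
  coefficients in \<open>Z\<^sub>p(g)[z\<^sub>2, \<dots>, z\<^sub>n]\<close>; as \<open>D y\<^sub>1 = y\<^sub>0\<close>, one that is killed by \<open>D\<close> is its constant coefficient.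
\<close>

text \<open>The variable t makes the passage from U(g) to polynomials lossless. The derivation D
  alone kills 1 and satisfies D^p = 0, whereas (D + t)^k sends 1 to t^k; hence ordered monomials
  stay independent and equality in U(g) can be tested at the single polynomial 1. The element y_1 is
  the second test because D y_1 = y_0 and D y_0 = 0, so that x^k acts on it with exactly one extra
  term, k t^(k-1) y_0, which exposes the t-derivative.

  Integral closedness is used in a strong form: b divides a as soon as b^k divides s a^k for all k,
  with one fixed nonzero s. Comparing leading monomials suffices for this, without factorization
  theory. It descends to the center because a quotient of constants of a derivation is again a
  constant.

  The bound p >= n + 1 enters through D^p = 0 and through the invertibility of 2 and of i for 2 <= i
  <= n, the leading coefficients of the z_i. To speak of these in characteristic p, the z_i, defined
  over the rationals by weights and ladders, are replaced by explicit integral formulas.\<close>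

lemma poly_mapping_sum_singles:
  fixes f :: "'a \<Rightarrow>\<^sub>0 'b::comm_monoid_add"
  shows "(\<Sum>m\<in>Poly_Mapping.keys f. Poly_Mapping.single m (Poly_Mapping.lookup f m)) = f"
proof (rule poly_mapping_eqI)
  fix k
  show "Poly_Mapping.lookup (\<Sum>m\<in>Poly_Mapping.keys f. Poly_Mapping.single m (Poly_Mapping.lookup f m)) k
      = Poly_Mapping.lookup f k"
    by (simp add: lookup_sum lookup_single when_def sum.delta in_keys_iff)
qed

text \<open>Reduces an identity that is additive in a polynomial to single terms; nested once, it
  settles bilinear identities such as the Leibniz rule.\<close>

lemma poly_mapping_additive_induct [case_names single add]:
  fixes f :: "'a \<Rightarrow>\<^sub>0 'b::comm_monoid_add"
  assumes single: "\<And>m c. P (Poly_Mapping.single m c)"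
    and add: "\<And>f g. P f \<Longrightarrow> P g \<Longrightarrow> P (f + g)"
  shows "P f"
proof -
  have "P (\<Sum>m\<in>A. Poly_Mapping.single m (Poly_Mapping.lookup f m))" if "finite A" for A
    using that
  proof induction
    case empty
    show ?case using single[of undefined 0] by simp
  qed (simp add: single add)
  from this[OF finite_keys, of f] show ?thesis by (simp add: poly_mapping_sum_singles)
qed

section \<open>Derivations of polynomial rings\<close>

lemma ypderiv_superset:
  assumes "finite A" "Poly_Mapping.keys f \<subseteq> A"
  shows "ypderiv i f = (\<Sum>m\<in>A. Poly_Mapping.single (m - Poly_Mapping.single i 1)
    (of_nat (Poly_Mapping.lookup m i) * Poly_Mapping.lookup f m))"
  unfolding ypderiv_def
  by (rule sum.mono_neutral_left) (use assms in \<open>auto simp: in_keys_iff\<close>)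

lemma ypderiv_single:
  "ypderiv i (Poly_Mapping.single m c) = Poly_Mapping.single (m - Poly_Mapping.single i 1)
    (of_nat (Poly_Mapping.lookup m i) * c)"
  by (subst ypderiv_superset[of "{m}"]) auto

lemma ypderiv_add: "ypderiv i (f + g) = ypderiv i f + ypderiv i g"
proof -
  let ?A = "Poly_Mapping.keys f \<union> Poly_Mapping.keys g"
  have "Poly_Mapping.keys (f + g) \<subseteq> ?A" by (rule keys_add)
  then show ?thesis
    by (simp add: ypderiv_superset[of ?A] lookup_add distrib_left single_add sum.distrib)
qed

lemma ypderiv_mult:
  fixes f g :: "'r::comm_ring_1 ypoly"
  shows "ypderiv i (f * g) = ypderiv i f * g + f * ypderiv i g"
proof (induction f rule: poly_mapping_additive_induct)
  case (single m a)
  show ?case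
  proof (induction g rule: poly_mapping_additive_induct)
    case (single m' b)
    let ?e = "Poly_Mapping.single i 1 :: nat \<Rightarrow>\<^sub>0 nat"
    \<comment> \<open>Subtraction of exponents is truncated, so the shift is valid only if
      \<open>i\<close> occurs in \<open>k\<close>. Otherwise the coefficient is 0, which is the
      other case of the two facts below.\<close>
    have shift: "k - ?e + k' = k + k' - ?e" if "Poly_Mapping.lookup k i > 0" for k k'
      by (rule poly_mapping_eqI)
         (use that in \<open>auto simp: lookup_add lookup_minus lookup_single when_def\<close>)
    have 1: "Poly_Mapping.single (m - ?e + m') (of_nat (Poly_Mapping.lookup m i) * a * b)
        = Poly_Mapping.single (m + m' - ?e) (of_nat (Poly_Mapping.lookup m i) * a * b)"
      proof (cases "Poly_Mapping.lookup m i = 0")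
      case False
      then show ?thesis using shift[of m m'] by simp
    qed simp
    have 2: "Poly_Mapping.single (m + (m' - ?e)) (a * (of_nat (Poly_Mapping.lookup m' i) * b))
        = Poly_Mapping.single (m + m' - ?e) (a * (of_nat (Poly_Mapping.lookup m' i) * b))"
    proof (cases "Poly_Mapping.lookup m' i = 0")
      case False
      then show ?thesis using shift[of m' m] by (simp add: add.commute)
    qed simp
    show ?case
      unfolding mult_single ypderiv_single 1 2 single_add[symmetric] lookup_add
      by (simp add: algebra_simps)
  next
    case (add g h)
    then show ?case by (simp add: distrib_left ypderiv_add algebra_simps)
  qed
next
  case (add f h)
  then show ?case by (simp add: distrib_right ypderiv_add algebra_simps)
qed

lemma ypderiv_yvar [simp]: "ypderiv i (yvar j) = (if i = j then 1 else 0)"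
  by (simp add: yvar_def ypderiv_single lookup_single when_def)

lemma ypderiv_yconst [simp]: "ypderiv i (yconst c) = 0"
  by (simp add: yconst_def ypderiv_single)

definition derivation :: "('a::comm_ring_1 \<Rightarrow> 'a) \<Rightarrow> bool"
  where "derivation D \<longleftrightarrow> (\<forall>f g. D (f + g) = D f + D g) \<and> (\<forall>f g. D (f * g) = D f * g + f * D g)"

lemma derivation_ypderiv: "derivation (ypderiv i)"
  by (simp add: derivation_def ypderiv_add ypderiv_mult)

lemma derivation_sum_mult:
  assumes "\<And>i. i \<in> A \<Longrightarrow> derivation (D i)"
  shows "derivation (\<lambda>f. \<Sum>i\<in>A. c i * D i f)"
proof -
  have *: "D i (f + g) = D i f + D i g" "D i (f * g) = D i f * g + f * D i g" if "i \<in> A" for i f g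
    using assms[OF that] by (auto simp: derivation_def)
  show ?thesis
    by (simp add: derivation_def * distrib_left sum.distrib sum_distrib_left sum_distrib_right
        algebra_simps)
qed

context
  fixes D :: "'a::comm_ring_1 \<Rightarrow> 'a"
  assumes D: "derivation D"
begin

lemma derivation_add: "D (f + g) = D f + D g"
  and derivation_mult: "D (f * g) = D f * g + f * D g"
  using D by (auto simp: derivation_def)

lemma derivation_0: "D 0 = 0"
  using derivation_add[of 0 0] by simp

lemma derivation_1: "D 1 = 0"
  using derivation_mult[of 1 1] by simp

lemma derivation_minus: "D (- f) = - D f"
  using derivation_add[of f "- f"] by (simp add: derivation_0 eq_neg_iff_add_eq_0 add.commute)

lemma derivation_diff: "D (f - g) = D f - D g"
  using derivation_add[of f "- g"] by (simp add: derivation_minus)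

lemma derivation_sum: "D (\<Sum>i\<in>A. f i) = (\<Sum>i\<in>A. D (f i))"
  by (induction A rule: infinite_finite_induct) (simp_all add: derivation_0 derivation_add)

lemma derivation_of_nat: "D (of_nat k) = 0"
  by (induction k) (simp_all add: derivation_0 derivation_add derivation_1)

lemma derivation_minus_one_power: "D ((-1) ^ k) = 0"
  by (induction k) (simp_all add: derivation_1 derivation_mult derivation_minus)

lemma derivation_power: "D (f ^ k) = of_nat k * f ^ (k - 1) * D f"
proof (induction k)
  case (Suc k)
  then show ?case by (cases k) (simp_all add: derivation_mult algebra_simps)
qed (simp add: derivation_1)

end

text \<open>With \<open>E = D\<close> this says that the \<open>p\<close>-th power of a derivation is a derivation; with
  \<open>E = D + t\<close> it computes the \<open>p\<close>-th power of the operator by which \<open>x\<close> acts below.\<close>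

lemma twisted_leibniz_funpow:
  fixes D E :: "'a::comm_ring_1 \<Rightarrow> 'a"
  assumes D: "derivation D"
    and E: "\<And>f g. E (f + g) = E f + E g" "\<And>f g. E (f * g) = D f * g + f * E g"
  shows "(E ^^ k) (f * g) = (\<Sum>j\<le>k. of_nat (k choose j) * ((D ^^ j) f * (E ^^ (k - j)) g))"
proof (induction k)
  case (Suc k)
  have E0: "E 0 = 0" using E(1)[of 0 0] by simp
  have Esum: "E (\<Sum>i\<in>A. h i) = (\<Sum>i\<in>A. E (h i))" for h :: "nat \<Rightarrow> 'a" and A
    by (induction A rule: infinite_finite_induct) (simp_all add: E0 E(1))
  let ?T = "\<lambda>j. (D ^^ j) f * (E ^^ (Suc k - j)) g"
  have "(E ^^ Suc k) (f * g) = (\<Sum>j\<le>k. E (of_nat (k choose j) * ((D ^^ j) f * (E ^^ (k - j)) g)))"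
    by (simp add: Suc Esum)
  also have "\<dots> = (\<Sum>j\<le>k. of_nat (k choose j) * ?T (Suc j) + of_nat (k choose j) * ?T j)"
    by (rule sum.cong) (simp_all add: E(2) derivation_of_nat[OF D] Suc_diff_le algebra_simps)
  also have "\<dots> = (\<Sum>j\<le>k. of_nat (k choose j) * ?T (Suc j)) + (\<Sum>j\<le>k. of_nat (k choose j) * ?T j)"
    by (rule sum.distrib)
  also have "(\<Sum>j\<le>k. of_nat (k choose j) * ?T j)
      = (\<Sum>j\<le>Suc k. of_nat (k choose j) * ?T j)" by (simp add: binomial_eq_0)
  also have "\<dots> = ?T 0 + (\<Sum>j\<le>k. of_nat (k choose Suc j) * ?T (Suc j))"
    by (subst sum.atMost_Suc_shift) simp
  also have "(\<Sum>j\<le>k. of_nat (k choose j) * ?T (Suc j)) + (?T 0 + (\<Sum>j\<le>k. of_nat (k choose Suc j) * ?T (Suc j)))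
     = ?T 0 + (\<Sum>j\<le>k. of_nat (Suc k choose Suc j) * ?T (Suc j))"
    by (simp add: sum.distrib[symmetric] algebra_simps)
  also have "\<dots> = (\<Sum>j\<le>Suc k. of_nat (Suc k choose j) * ?T j)"
    by (subst sum.atMost_Suc_shift) simp
  finally show ?case .
qed simp

lemma twisted_leibniz_funpow_CHAR:
  fixes D E :: "'a::comm_ring_1 \<Rightarrow> 'a"
  assumes D: "derivation D"
    and E: "\<And>f g. E (f + g) = E f + E g" "\<And>f g. E (f * g) = D f * g + f * E g"
    and p: "Factorial_Ring.prime p" "CHAR('a) = p"
  shows "(E ^^ p) (f * g) = (D ^^ p) f * g + f * (E ^^ p) g"
proof -
  have p0: "p > 0" using p(1) by (simp add: prime_gt_0_nat)
  have "(E ^^ p) (f * g) = (\<Sum>j\<le>p. of_nat (p choose j) * ((D ^^ j) f * (E ^^ (p - j)) g))"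
    by (rule twisted_leibniz_funpow[OF D E])
  also have "\<dots> = (\<Sum>j\<in>{0, p}. of_nat (p choose j) * ((D ^^ j) f * (E ^^ (p - j)) g))"
  proof (rule sum.mono_neutral_right)
    have "of_nat (p choose j) = (0 :: 'a)" if "j \<le> p" "j \<noteq> 0" "j \<noteq> p" for j
      using that p by (auto simp: of_nat_eq_0_iff_char_dvd intro!: dvd_choose_prime)
    then show "\<forall>j\<in>{..p} - {0, p}. of_nat (p choose j) * ((D ^^ j) f * (E ^^ (p - j)) g) = 0"
      by auto
  qed auto
  also have "\<dots> = (D ^^ p) f * g + f * (E ^^ p) g"
    using p0 by simp
  finally show ?thesis .
qed

section \<open>Polynomials in finitely many variables\<close>

text \<open>The number of variables is expressed by a subring of one fixed polynomial type, since a
  type cannot depend on \<open>n\<close>. The variable t of the overview is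
  \<open>yvar (Suc n)\<close>, so the module on which U(g) acts is represented by
  \<open>yvars (Suc n)\<close>.\<close>

definition yvars :: "nat \<Rightarrow> 'r::comm_ring_1 ypoly set"
  where "yvars n = {f. \<forall>m\<in>Poly_Mapping.keys f. Poly_Mapping.keys m \<subseteq> {..n}}"

lemma yvars_add: "f \<in> yvars n \<Longrightarrow> g \<in> yvars n \<Longrightarrow> f + g \<in> yvars n"
  using keys_add[of f g] by (fastforce simp: yvars_def)

lemma yvars_uminus: "f \<in> yvars n \<Longrightarrow> - f \<in> yvars n"
  by (simp add: yvars_def)

lemma yvars_diff: "f \<in> yvars n \<Longrightarrow> g \<in> yvars n \<Longrightarrow> f - g \<in> yvars n"
  using yvars_add[of f n "- g"] by (simp add: yvars_uminus)

lemma yvars_mult: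
  assumes "f \<in> yvars n" "g \<in> yvars n"
  shows "f * g \<in> yvars n"
  unfolding yvars_def
proof (intro CollectI ballI)
  fix m assume "m \<in> Poly_Mapping.keys (f * g)"
  with keys_mult[of f g] obtain a b where ab: "m = a + b" "a \<in> Poly_Mapping.keys f" "b \<in> Poly_Mapping.keys g"
    by blast
  with assms show "Poly_Mapping.keys m \<subseteq> {..n}"
    using keys_add[of a b] unfolding yvars_def by fastforce
qed

lemma yvars_yconst: "yconst c \<in> yvars n"
  by (simp add: yvars_def yconst_def)

lemma yvars_0: "0 \<in> yvars n" and yvars_1: "1 \<in> yvars n"
  by (simp_all add: yvars_def)

lemma yvars_yvar: "i \<le> n \<Longrightarrow> yvar i \<in> yvars n"
  by (simp add: yvars_def yvar_def)

lemma yvars_sum: "(\<And>i. i \<in> A \<Longrightarrow> f i \<in> yvars n) \<Longrightarrow> (\<Sum>i\<in>A. f i) \<in> yvars n"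
  by (induction A rule: infinite_finite_induct) (simp_all add: yvars_0 yvars_add)

lemma yvars_power: "f \<in> yvars n \<Longrightarrow> f ^ k \<in> yvars n"
  by (induction k) (simp_all add: yvars_1 yvars_mult)

lemma yvars_of_nat: "of_nat k \<in> yvars n"
  by (induction k) (simp_all add: yvars_0 yvars_1 yvars_add)

lemma yvars_mono: "f \<in> yvars m \<Longrightarrow> m \<le> n \<Longrightarrow> f \<in> yvars n"
  by (fastforce simp: yvars_def)

lemma yconst_add: "yconst (a + b) = yconst a + yconst b"
  and yconst_mult: "yconst (a * b) = yconst a * yconst b"
  and yconst_0 [simp]: "yconst 0 = 0"
  and yconst_1 [simp]: "yconst 1 = 1"
  by (simp_all add: yconst_def single_add mult_single)

lemma yconst_of_nat: "yconst (of_nat k) = of_nat k"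
  by (simp add: yconst_def)

lemma yconst_eq_0_iff [simp]: "yconst c = 0 \<longleftrightarrow> c = 0"
  by (metis yconst_def lookup_single_eq lookup_zero single_zero)

lemma yvar_power: "yvar i ^ k = Poly_Mapping.single (Poly_Mapping.single i k) 1"
  by (induction k) (simp_all add: yvar_def mult_single single_add[symmetric])

lemma prod_yvar_power:
  assumes "finite A"
  shows "(\<Prod>i\<in>A. yvar i ^ e i)
    = (Poly_Mapping.single (\<Sum>i\<in>A. Poly_Mapping.single i (e i)) 1 :: 'r::comm_ring_1 ypoly)"
  using assms by induction (simp_all add: yvar_power mult_single)

lemma single_eq_prod_yvar:
  assumes "Poly_Mapping.keys m \<subseteq> {..n}"
  shows "Poly_Mapping.single m c = yconst c * (\<Prod>i\<le>n. yvar i ^ Poly_Mapping.lookup m i)"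
proof -
  have "m = (\<Sum>i\<in>Poly_Mapping.keys m. Poly_Mapping.single i (Poly_Mapping.lookup m i))"
    by (simp add: poly_mapping_sum_singles)
  also have "\<dots> = (\<Sum>i\<le>n. Poly_Mapping.single i (Poly_Mapping.lookup m i))"
    by (rule sum.mono_neutral_left) (use assms in \<open>auto simp: in_keys_iff\<close>)
  finally show ?thesis
    by (simp add: prod_yvar_power yconst_def mult_single)
qed

lemma ypoly_eq_sum_prod:
  assumes "f \<in> yvars n"
  shows "f = (\<Sum>m\<in>Poly_Mapping.keys f. yconst (Poly_Mapping.lookup f m)
    * (\<Prod>i\<le>n. yvar i ^ Poly_Mapping.lookup m i))" (is "_ = ?S")
proof -
  have "f = (\<Sum>m\<in>Poly_Mapping.keys f. Poly_Mapping.single m (Poly_Mapping.lookup f m))"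
    by (simp add: poly_mapping_sum_singles)
  also have "\<dots> = ?S"
    by (rule sum.cong) (use assms in \<open>auto simp: yvars_def intro!: single_eq_prod_yvar\<close>)
  finally show ?thesis .
qed

lemma yvars_induct [consumes 1, case_names yconst yvar add mult]:
  assumes f: "f \<in> yvars n"
    and yconst: "\<And>c. P (yconst c)" and yvar: "\<And>i. i \<le> n \<Longrightarrow> P (yvar i)"
    and add: "\<And>f g. P f \<Longrightarrow> P g \<Longrightarrow> P (f + g)" and mult: "\<And>f g. P f \<Longrightarrow> P g \<Longrightarrow> P (f * g)"
  shows "P f"
proof -
  have pow: "P (g ^ k)" if "P g" for g k
    by (induction k) (use yconst[of 1] that mult in auto)
  have prod: "P (\<Prod>i\<in>A. yvar i ^ e i)" if "A \<subseteq> {..n}" for A and e :: "nat \<Rightarrow> nat"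
    using that by (induction A rule: infinite_finite_induct) (use yconst[of 1] in \<open>auto intro!: mult pow yvar\<close>)
  have sum: "P (\<Sum>i\<in>A. h i)" if "\<And>i. i \<in> A \<Longrightarrow> P (h i)" for A and h :: "(nat \<Rightarrow>\<^sub>0 nat) \<Rightarrow> _"
    using that by (induction A rule: infinite_finite_induct) (use yconst[of 0] in \<open>auto intro!: add\<close>)
  show ?thesis
    by (subst ypoly_eq_sum_prod[OF f]) (intro sum mult yconst prod order_refl)
qed

lemma CHAR_ypoly: "CHAR('r::comm_ring_1 ypoly) = CHAR('r)"
proof (rule CHAR_eqI)
  have *: "of_nat k = (0 :: 'r ypoly) \<longleftrightarrow> of_nat k = (0 :: 'r)" for k
    by (simp flip: yconst_of_nat)
  show "of_nat CHAR('r) = (0 :: 'r ypoly)" by (simp add: *)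
  show "CHAR('r) dvd k" if "of_nat k = (0 :: 'r ypoly)" for k
    using that by (simp add: * of_nat_eq_0_iff_char_dvd)
qed

section \<open>Polynomial rings are integrally closed\<close>

text \<open>Exponent vectors are ordered lexicographically, the smallest index at which they differ
  being decisive. This order is linear and compatible with addition, so it is a monomial
  order.\<close>

definition lmon :: "'k::idom ypoly \<Rightarrow> nat \<Rightarrow>\<^sub>0 nat"
  where "lmon f = Max (Poly_Mapping.keys f)"

lemma lmon_in_keys: "f \<noteq> 0 \<Longrightarrow> lmon f \<in> Poly_Mapping.keys f"
  unfolding lmon_def by (rule Max_in) auto

lemma le_lmon: "m \<in> Poly_Mapping.keys f \<Longrightarrow> m \<le> lmon f"
  unfolding lmon_def by (rule Max_ge) auto

text \<open>Addition is strictly monotone, so the two leading monomials are the only pair that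
  multiplies to this exponent, and nothing can cancel.\<close>

lemma lookup_lmon_mult:
  assumes "f \<noteq> 0" "g \<noteq> 0"
  shows "Poly_Mapping.lookup (f * g) (lmon f + lmon g)
    = Poly_Mapping.lookup f (lmon f) * Poly_Mapping.lookup g (lmon g)"
proof -
  let ?F = "Poly_Mapping.lookup f" and ?G = "Poly_Mapping.lookup g"
  let ?A = "Poly_Mapping.keys f" and ?B = "Poly_Mapping.keys g"
  have "f * g = (\<Sum>a\<in>?A. Poly_Mapping.single a (?F a)) * (\<Sum>b\<in>?B. Poly_Mapping.single b (?G b))"
    by (simp add: poly_mapping_sum_singles)
  also have "\<dots> = (\<Sum>a\<in>?A. \<Sum>b\<in>?B. Poly_Mapping.single (a + b) (?F a * ?G b))"
    by (simp add: sum_product mult_single)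
  finally have "Poly_Mapping.lookup (f * g) (lmon f + lmon g)
      = (\<Sum>a\<in>?A. \<Sum>b\<in>?B. ?F a * ?G b when a + b = lmon f + lmon g)"
    by (simp add: lookup_sum lookup_single)
  also have "\<dots> = (\<Sum>a\<in>?A. \<Sum>b\<in>?B. if b = lmon g then (if a = lmon f then ?F a * ?G b else 0) else 0)"
  proof (intro sum.cong refl)
    fix a b assume "a \<in> ?A" "b \<in> ?B"
    then have "a \<le> lmon f" "b \<le> lmon g" by (simp_all add: le_lmon)
    then have "a + b = lmon f + lmon g \<longleftrightarrow> a = lmon f \<and> b = lmon g"
      by (metis add_le_cancel_left add_le_cancel_right antisym add_left_mono add_right_mono order_refl)
    then show "(?F a * ?G b when a + b = lmon f + lmon g)
        = (if b = lmon g then (if a = lmon f then ?F a * ?G b else 0) else 0)"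
      by simp
  qed
  also have "\<dots> = ?F (lmon f) * ?G (lmon g)"
    using lmon_in_keys[OF assms(1)] lmon_in_keys[OF assms(2)] by (simp add: sum.delta)
  finally show ?thesis .
qed

lemma lmon_mult:
  assumes "f \<noteq> 0" "g \<noteq> 0"
  shows "lmon (f * g) = lmon f + lmon g"
  unfolding lmon_def[of "f * g"]
proof (rule Max_eqI)
  fix m assume "m \<in> Poly_Mapping.keys (f * g)"
  with keys_mult[of f g] obtain a b where "m = a + b" "a \<in> Poly_Mapping.keys f" "b \<in> Poly_Mapping.keys g"
    by blast
  then show "m \<le> lmon f + lmon g" by (simp add: le_lmon add_mono)
next
  show "lmon f + lmon g \<in> Poly_Mapping.keys (f * g)"
    using lmon_in_keys[OF assms(1)] lmon_in_keys[OF assms(2)]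
    by (simp add: in_keys_iff lookup_lmon_mult[OF assms])
qed simp

lemma lookup_lmon_power:
  "f \<noteq> 0 \<Longrightarrow> Poly_Mapping.lookup (lmon (f ^ k)) i = k * Poly_Mapping.lookup (lmon f) i"
proof (induction k)
  case 0
  then show ?case by (simp add: lmon_def)
next
  case (Suc k)
  then show ?case by (simp add: lmon_mult lookup_add)
qed

text \<open>The bound on the variables is essential: y_0 > y_1 > y_2 > ... is an infinite descent.
  With finitely many variables, exponent vectors become lists of a fixed length under the
  lexicographic order.\<close>

lemma wf_monomials:
  "wf {(m, m' :: nat \<Rightarrow>\<^sub>0 nat). m < m' \<and> Poly_Mapping.keys m \<subseteq> {..n} \<and> Poly_Mapping.keys m' \<subseteq> {..n}}"
proof (rule wf_subset[OF wf_inv_image[OF wf_lex[OF wf_less_than]]], clarify)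
  let ?l = "\<lambda>m :: nat \<Rightarrow>\<^sub>0 nat. map (Poly_Mapping.lookup m) [0..<Suc n]"
  fix m m' :: "nat \<Rightarrow>\<^sub>0 nat"
  assume mm: "m < m'" "Poly_Mapping.keys m \<subseteq> {..n}" "Poly_Mapping.keys m' \<subseteq> {..n}"
  from mm(1) obtain k where k: "Poly_Mapping.lookup m k < Poly_Mapping.lookup m' k"
    "\<And>j. j < k \<Longrightarrow> Poly_Mapping.lookup m j = Poly_Mapping.lookup m' j"
    by (auto simp: less_poly_mapping.rep_eq less_fun_def)
  then have "k \<in> Poly_Mapping.keys m'" by (auto simp: in_keys_iff)
  with mm(3) have "k \<le> n" by auto
  then have upt: "[0..<Suc n] = [0..<k] @ k # [Suc k..<Suc n]"
    by (metis le_imp_less_Suc upt_add_eq_append upt_conv_Cons less_imp_le_nat le_add_diff_inverse zero_le)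
  have "map (Poly_Mapping.lookup m) [0..<k] = map (Poly_Mapping.lookup m') [0..<k]"
    using k(2) by simp
  with k(1) show "(m, m') \<in> inv_image (lex less_than) ?l"
    unfolding in_inv_image lex_conv upt by force
qed

text \<open>Division by leading terms. Comparing leading exponents in b^k | s a^k for large k forces
  the leading monomial of b to divide that of a; subtracting the matching multiple b q lowers the
  leading monomial of a and preserves the hypothesis, so well-founded induction applies.\<close>

lemma ypoly_completely_integrally_closed:
  fixes a b s :: "'k::field ypoly"
  assumes "a \<in> yvars n" "b \<in> yvars n" "b \<noteq> 0" "s \<noteq> 0"
    and "\<And>k. b ^ k dvd s * a ^ k"
  shows "\<exists>c\<in>yvars n. a = b * c"
  using assms(1,5)
proof (induction a rule: wf_induct_rule[OF wf_inv_image[OF wf_monomials[of n], of lmon]])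
  case (1 a)
  show ?case
  proof (cases "a = 0")
    case True
    then show ?thesis by (auto intro!: bexI[of _ 0] yvars_0)
  next
    case False
    have "Poly_Mapping.lookup (lmon b) i \<le> Poly_Mapping.lookup (lmon a) i" for i
    proof (rule ccontr)
      assume less: "\<not> ?thesis"
      \<comment> \<open>Each factor b exceeds a by at least one in the exponent of y_i, so k factors
        exceed by at least k. This k is larger than what s can compensate.\<close>
      define k where "k = Suc (Poly_Mapping.lookup (lmon s) i)"
      obtain c where c: "s * a ^ k = b ^ k * c" using 1(3)[of k] by (rule dvdE)
      with False assms(4) have "c \<noteq> 0" by auto
      have "lmon s + lmon (a ^ k) = lmon (b ^ k) + lmon c"
        using c False assms(3,4) \<open>c \<noteq> 0\<close> by (metis lmon_mult power_not_zero)
      then have "Poly_Mapping.lookup (lmon s) i + k * Poly_Mapping.lookup (lmon a) i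
          = k * Poly_Mapping.lookup (lmon b) i + Poly_Mapping.lookup (lmon c) i"
        using False assms(3) by (metis lookup_add lookup_lmon_power)
      moreover have "k * Poly_Mapping.lookup (lmon a) i + k \<le> k * Poly_Mapping.lookup (lmon b) i"
        using less by (metis Suc_leI linorder_not_le mult_Suc_right mult_le_mono2 add.commute)
      ultimately show False by (simp add: k_def)
    qed
    define m where "m = lmon a - lmon b"
    have m: "lmon a = lmon b + m"
      using \<open>\<And>i. Poly_Mapping.lookup (lmon b) i \<le> Poly_Mapping.lookup (lmon a) i\<close>
      by (intro poly_mapping_eqI) (simp add: m_def lookup_add lookup_minus)
    define q where "q = Poly_Mapping.single m (Poly_Mapping.lookup a (lmon a) / Poly_Mapping.lookup b (lmon b))"
    have lc: "Poly_Mapping.lookup a (lmon a) \<noteq> 0" "Poly_Mapping.lookup b (lmon b) \<noteq> 0"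
      using lmon_in_keys False assms(3) by (auto simp: in_keys_iff)
    have "q \<noteq> 0" using lc by (auto simp: q_def dest: arg_cong[where f = "\<lambda>f. Poly_Mapping.lookup f m"])
    have lq: "lmon q = m" using lc by (simp add: q_def lmon_def)
    have "Poly_Mapping.keys m \<subseteq> Poly_Mapping.keys (lmon a)"
      by (auto simp: m_def in_keys_iff lookup_minus)
    then have q: "q \<in> yvars n"
      using lmon_in_keys[OF False] 1(2) by (auto simp: q_def yvars_def)
    define a' where "a' = a - b * q"
    have a': "a' \<in> yvars n" unfolding a'_def by (intro yvars_diff yvars_mult 1(2) assms(2) q)
    show ?thesis
    proof (cases "a' = 0")
      case True
      with q show ?thesis by (auto simp: a'_def)
    next
      case nz: False
      have lbq: "lmon (b * q) = lmon a" using assms(3) \<open>q \<noteq> 0\<close> by (simp add: lmon_mult lq m)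
      have "Poly_Mapping.lookup (b * q) (lmon a) = Poly_Mapping.lookup a (lmon a)"
        using lookup_lmon_mult[OF assms(3) \<open>q \<noteq> 0\<close>] lc unfolding lq m[symmetric] by (simp add: q_def)
      then have "lmon a \<notin> Poly_Mapping.keys a'"
        by (simp add: a'_def in_keys_iff lookup_minus)
      moreover have "lmon a' \<le> lmon a"
        using lmon_in_keys[OF nz] le_lmon[of "lmon a'" a] le_lmon[of "lmon a'" "b * q"]
        by (fastforce simp: a'_def in_keys_iff lookup_minus lbq)
      ultimately have less: "lmon a' < lmon a" using lmon_in_keys[OF nz] by (metis order_le_less)
      \<comment> \<open>In the binomial expansion of (a - b q)^k, the term with a^j contributes b^j
        through the hypothesis on a and b^(k-j) through the power of b q.\<close>
      have "b ^ k dvd s * a' ^ k" for k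
      proof -
        have "s * a' ^ k = (\<Sum>j\<le>k. s * (of_nat (k choose j) * a ^ j * (- (b * q)) ^ (k - j)))"
          unfolding a'_def diff_conv_add_uminus binomial_ring by (rule sum_distrib_left)
        moreover have "b ^ k dvd s * (of_nat (k choose j) * a ^ j * (- (b * q)) ^ (k - j))" if "j \<le> k" for j
        proof -
          have "b ^ j * b ^ (k - j) dvd (s * a ^ j) * (- (b * q)) ^ (k - j)"
            by (intro mult_dvd_mono 1(3) dvd_power_same) simp
          then have "b ^ k dvd (s * a ^ j) * (- (b * q)) ^ (k - j)"
            using that by (simp flip: power_add)
          then have "b ^ k dvd of_nat (k choose j) * ((s * a ^ j) * (- (b * q)) ^ (k - j))"
            by (rule dvd_mult)
          then show ?thesis by (simp only: mult_ac)
        qed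
        ultimately show ?thesis by (auto intro!: dvd_sum)
      qed
      moreover have "(a', a) \<in> inv_image {(m, m'). m < m' \<and> Poly_Mapping.keys m \<subseteq> {..n} \<and> Poly_Mapping.keys m' \<subseteq> {..n}} lmon"
        using less lmon_in_keys[OF nz] lmon_in_keys[OF False] a' 1(2) by (auto simp: yvars_def)
      ultimately obtain c where "c \<in> yvars n" "a' = b * c" using 1(1) a' by blast
      then have "a = b * (q + c)" by (simp add: a'_def algebra_simps)
      then show ?thesis using \<open>c \<in> yvars n\<close> q by (blast intro: yvars_add)
    qed
  qed
qed

section \<open>The polynomials \<open>z\<^sub>i\<close>\<close>

text \<open>The formula of \<open>x_der\<close> over an arbitrary coefficient ring: it is needed
  over the rationals for the definition of the z_i and over the field for the center. The variable t
  = \<open>yvar (Suc n)\<close> is a constant of it.\<close>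

definition fil_der :: "nat \<Rightarrow> 'r::comm_ring_1 ypoly \<Rightarrow> 'r ypoly"
  where "fil_der n f = (\<Sum>i<n. yvar i * ypderiv (Suc i) f)"

lemma derivation_fil_der: "derivation (fil_der n)"
  unfolding fil_der_def[abs_def] by (rule derivation_sum_mult) (rule derivation_ypderiv)

lemma fil_der_yvar: "fil_der n (yvar j) = (if 1 \<le> j \<and> j \<le> n then yvar (j - 1) else 0)"
proof -
  have "fil_der n (yvar j) = (\<Sum>i<n. if i = j - 1 then (if 1 \<le> j then yvar i else 0) else 0)"
    unfolding fil_der_def by (rule sum.cong) auto
  then show ?thesis by (cases j) (auto simp: sum.delta)
qed

lemma fil_der_yvar_mult: "fil_der n (yvar i * f) = fil_der n (yvar i) * f + yvar i * fil_der n f"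
  by (rule derivation_mult[OF derivation_fil_der])

lemma fil_der_yconst: "fil_der n (yconst c) = 0"
  by (simp add: fil_der_def)

lemma x_der_eq_fil_der: "x_der n = fil_der n"
  by (simp add: fun_eq_iff x_der_def fil_der_def)

lemma derivation_f_der: "derivation (f_der n)"
  unfolding f_der_def[abs_def] by (rule derivation_sum_mult) (rule derivation_ypderiv)

lemma f_der_yvar:
  assumes "j \<le> n"
  shows "f_der n (yvar j) = of_nat ((j + 1) * (n - j)) * yvar (j + 1)"
proof -
  have "f_der n (yvar j) = (\<Sum>i\<le>n. if i = j then of_nat ((i + 1) * (n - i)) * yvar (i + 1) else 0)"
    unfolding f_der_def by (rule sum.cong) auto
  with assms show ?thesis by (simp add: sum.delta)
qed

text \<open>For even \<open>i\<close> this is the closed form of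
  \<open>circ n i (yvar 0) (yvar 0)\<close>. For odd \<open>i\<close> the terms \<open>k\<close> and
  \<open>i - k\<close> cancel.\<close>

definition even_z :: "nat \<Rightarrow> 'r::comm_ring_1 ypoly"
  where "even_z i = (\<Sum>k\<le>i. (-1) ^ k * (yvar k * yvar (i - k)))"

text \<open>For odd \<open>i\<close> this is the normalized ladder successor of
  \<open>even_z (i - 1)\<close>, and also a preimage of it under the derivation when 2 is nonzero.
  The two roles make it the second ingredient of the odd z_i.\<close>

definition odd_w :: "nat \<Rightarrow> 'r::comm_ring_1 ypoly"
  where "odd_w i = (\<Sum>j\<le>i div 2. (-1) ^ j * of_nat (i - 2 * j) * (yvar j * yvar (i - j)))"

text \<open>For odd \<open>i\<close> this symmetric sum is \<open>2 * odd_w i\<close>; it is used where signs have to cancel, while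
  \<^const>\<open>odd_w\<close> is the form that makes sense in every characteristic.\<close>

definition odd_w_twice :: "nat \<Rightarrow> 'r::comm_ring_1 ypoly"
  where "odd_w_twice i = (\<Sum>j\<le>i. (-1) ^ j * (of_nat i - 2 * of_nat j) * (yvar j * yvar (i - j)))"

text \<open>Integral closed form of the z_i, meaningful over every ring. It is meant for
  \<open>i\<close> at least 2; at \<open>i = 1\<close> it gives 0 instead of y_0.\<close>

definition z_int :: "nat \<Rightarrow> 'r::comm_ring_1 ypoly"
  where "z_int i = (if even i then even_z i else yvar 0 * odd_w i - yvar 1 * even_z (i - 1))"

lemma odd_w_twice:
  assumes "odd i"
  shows "odd_w_twice i = (2 * odd_w i :: 'r::comm_ring_1 ypoly)"
proof -
  from assms obtain h where h: "i = 2 * h + 1" by (rule oddE)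
  let ?g = "\<lambda>j. (-1) ^ j * (of_nat i - 2 * of_nat j) * (yvar j * yvar (i - j)) :: 'r ypoly"
  have split: "{..i} = {..h} \<union> {h<..i}" by (auto simp: h)
  have "odd_w_twice i = (\<Sum>j\<in>{..h}. ?g j) + (\<Sum>j\<in>{h<..i}. ?g j)"
    unfolding odd_w_twice_def split by (rule sum.union_disjoint) auto
  \<comment> \<open>The reflection of \<open>j\<close> to \<open>i - j\<close> reverses the sign,
    \<open>i\<close> being odd, and also the factor \<open>i - 2 * j\<close>, so the two halves
    agree.\<close>
  also have "(\<Sum>j\<in>{h<..i}. ?g j) = (\<Sum>j\<in>{..h}. ?g j)"
  proof (rule sum.reindex_bij_witness[of _ "\<lambda>j. i - j" "\<lambda>j. i - j"])
    fix j assume j: "j \<in> {h<..i}"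
    then have "even (i - j) \<longleftrightarrow> odd j" using assms by auto
    then have "(-1 :: 'r ypoly) ^ (i - j) = - ((-1) ^ j)" by (simp add: minus_one_power_iff)
    with j show "?g (i - j) = ?g j" by (simp add: of_nat_diff algebra_simps)
  qed (auto simp: h)
  also have "(\<Sum>j\<in>{..h}. ?g j) = odd_w i"
    unfolding odd_w_def by (rule sum.cong) (simp_all add: h of_nat_diff algebra_simps)
  finally show ?thesis by simp
qed

lemma fil_der_sign_mult:
  "fil_der n ((-1) ^ k * f) = (-1) ^ k * fil_der n (f :: 'r::comm_ring_1 ypoly)"
  by (simp add: derivation_mult[OF derivation_fil_der] derivation_minus_one_power[OF derivation_fil_der])

text \<open>Differentiating the first factor and shifting the index by one gives the negative of
  what differentiating the second factor gives.\<close>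

lemma fil_der_even_z:
  assumes "i \<le> n"
  shows "fil_der n (even_z i :: 'r::comm_ring_1 ypoly) = 0"
proof (cases i)
  case 0
  then show ?thesis
    by (simp add: even_z_def derivation_mult[OF derivation_fil_der] fil_der_yvar)
next
  case (Suc i')
  let ?D = "fil_der n :: 'r ypoly \<Rightarrow> 'r ypoly"
  have "?D (even_z i) = (\<Sum>k\<le>Suc i'. (-1) ^ k * (?D (yvar k) * yvar (i - k)))
      + (\<Sum>k\<le>Suc i'. (-1) ^ k * (yvar k * ?D (yvar (i - k))))"
    unfolding even_z_def derivation_sum[OF derivation_fil_der] fil_der_sign_mult fil_der_yvar_mult
      distrib_left sum.distrib Suc ..
  also have "(\<Sum>k\<le>Suc i'. (-1) ^ k * (?D (yvar k) * yvar (i - k)))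
      = (\<Sum>k\<le>i'. - ((-1) ^ k * (yvar k * yvar (i' - k))))"
    using assms Suc by (subst sum.atMost_Suc_shift) (auto simp: fil_der_yvar intro!: sum.cong)
  also have "(\<Sum>k\<le>Suc i'. (-1) ^ k * (yvar k * ?D (yvar (i - k))))
      = (\<Sum>k\<le>i'. (-1) ^ k * (yvar k * yvar (i' - k)))"
    using assms Suc by (auto simp: fil_der_yvar Suc_diff_le intro!: sum.cong)
  finally show ?thesis by (simp add: sum_negf)
qed

text \<open>As for \<open>even_z\<close>, but the index shift now changes the coefficient by 2, and
  this difference is all that survives.\<close>

lemma fil_der_odd_w_twice:
  assumes "Suc i \<le> n"
  shows "fil_der n (odd_w_twice (Suc i) :: 'r::comm_ring_1 ypoly) = 2 * even_z i"
proof -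
  let ?D = "fil_der n :: 'r ypoly \<Rightarrow> 'r ypoly"
  let ?c = "\<lambda>j. of_nat (Suc i) - 2 * of_nat j :: 'r ypoly"
  have Dc: "?D (?c j * f) = ?c j * ?D f" for j f
  proof -
    have "?c j = of_nat (Suc i) - of_nat (2 * j)" by simp
    then have "?D (?c j) = 0"
      by (simp only: derivation_diff[OF derivation_fil_der] derivation_of_nat[OF derivation_fil_der] diff_self)
    then show ?thesis by (simp only: derivation_mult[OF derivation_fil_der, of n "?c j"] mult_zero_left add_0_left)
  qed
  have "?D (odd_w_twice (Suc i)) = (\<Sum>j\<le>Suc i. (-1) ^ j * (?c j * (?D (yvar j) * yvar (Suc i - j))))
      + (\<Sum>j\<le>Suc i. (-1) ^ j * (?c j * (yvar j * ?D (yvar (Suc i - j)))))"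
    unfolding odd_w_twice_def derivation_sum[OF derivation_fil_der] mult.assoc fil_der_sign_mult Dc
      fil_der_yvar_mult distrib_left sum.distrib ..
  also have "(\<Sum>j\<le>Suc i. (-1) ^ j * (?c j * (?D (yvar j) * yvar (Suc i - j))))
      = (\<Sum>j\<le>i. - ((-1) ^ j * (?c (Suc j) * (yvar j * yvar (i - j)))))"
    using assms by (subst sum.atMost_Suc_shift) (auto simp: fil_der_yvar intro!: sum.cong)
  also have "(\<Sum>j\<le>Suc i. (-1) ^ j * (?c j * (yvar j * ?D (yvar (Suc i - j)))))
      = (\<Sum>j\<le>i. (-1) ^ j * (?c j * (yvar j * yvar (i - j))))"
    using assms by (auto simp: fil_der_yvar Suc_diff_le intro!: sum.cong)
  also have "(\<Sum>j\<le>i. - ((-1) ^ j * (?c (Suc j) * (yvar j * yvar (i - j))))) + \<dots>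
      = (\<Sum>j\<le>i. 2 * ((-1) ^ j * (yvar j * yvar (i - j))))"
    by (subst sum.distrib[symmetric], rule sum.cong) (simp_all add: algebra_simps)
  finally show ?thesis by (simp add: even_z_def sum_distrib_left)
qed

lemma two_ypoly_neq_0:
  assumes "(2 :: 'r::comm_ring_1) \<noteq> 0"
  shows "(2 :: 'r ypoly) \<noteq> 0"
proof -
  have "(2 :: 'r ypoly) = yconst 2" using yconst_of_nat[of 2] by simp
  with assms show ?thesis by (simp only: yconst_eq_0_iff) simp
qed

text \<open>Obtained by cancelling 2 in the identity for the symmetric sum, whence the assumption on
  the coefficients. In the application z_2, ..., z_n exist only for n >= 2, so p >= 3.\<close>

lemma fil_der_odd_w:
  assumes "odd i" "i \<le> n" "(2 :: 'r::idom) \<noteq> 0"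
  shows "fil_der n (odd_w i :: 'r ypoly) = even_z (i - 1)"
proof -
  from assms(1) obtain i' where i': "i = Suc i'" by (cases i) auto
  have "2 * fil_der n (odd_w i :: 'r ypoly) = fil_der n (odd_w_twice i)"
    unfolding odd_w_twice[OF assms(1)] mult_2 derivation_add[OF derivation_fil_der] ..
  also have "\<dots> = 2 * even_z (i - 1)"
    using fil_der_odd_w_twice[of i' n] assms(2) by (simp add: i')
  finally show ?thesis
    using two_ypoly_neq_0[OF assms(3)] by (simp only: mult_cancel_left) simp
qed

text \<open>For odd \<open>i\<close>, differentiating \<open>odd_w i\<close> and differentiating
  \<open>yvar 1\<close> both yield \<open>yvar 0 * even_z (i - 1)\<close>, with opposite
  signs.\<close>

lemma fil_der_z_int:
  assumes "i \<le> n" "(2 :: 'r::idom) \<noteq> 0"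
  shows "fil_der n (z_int i :: 'r ypoly) = 0"
proof (cases "even i")
  case True
  then show ?thesis using assms by (simp add: z_int_def fil_der_even_z)
next
  case False
  then have "1 \<le> i" by (cases i) auto
  then show ?thesis using assms False
    by (simp add: z_int_def derivation_mult[OF derivation_fil_der] derivation_diff[OF derivation_fil_der]
        fil_der_yvar fil_der_odd_w fil_der_even_z)
qed

lemma even_z_leading:
  assumes "even i" "0 < i"
  shows "even_z i - 2 * (yvar 0 * yvar i) \<in> (yvars (i - 1) :: 'r::comm_ring_1 ypoly set)"
proof -
  let ?g = "\<lambda>k. (-1) ^ k * (yvar k * yvar (i - k)) :: 'r ypoly"
  have "even_z i = ?g 0 + ?g i + (\<Sum>k\<in>{..i} - {0} - {i}. ?g k)"
    unfolding even_z_def using assms by (simp add: sum.remove[of "{..i}" 0] sum.remove[of "{..i} - {0}" i])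
  also have "?g 0 + ?g i = 2 * (yvar 0 * yvar i)"
    using assms by simp
  finally have "even_z i - 2 * (yvar 0 * yvar i) = (\<Sum>k\<in>{..i} - {0} - {i}. ?g k)" by simp
  moreover have "\<dots> \<in> yvars (i - 1)"
    by (intro yvars_sum yvars_mult yvars_power yvars_uminus yvars_1 yvars_yvar) auto
  ultimately show ?thesis by simp
qed

lemma odd_w_leading:
  assumes "3 \<le> i"
  shows "odd_w i - of_nat i * (yvar 0 * yvar i) \<in> (yvars (i - 1) :: 'r::comm_ring_1 ypoly set)"
proof -
  let ?g = "\<lambda>j. (-1) ^ j * of_nat (i - 2 * j) * (yvar j * yvar (i - j)) :: 'r ypoly"
  define S where "S = (\<Sum>j\<in>{..i div 2} - {0}. ?g j)"
  have "odd_w i = ?g 0 + S"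
    unfolding odd_w_def S_def by (rule sum.remove) auto
  then have "odd_w i - of_nat i * (yvar 0 * yvar i) = S" by simp
  moreover have "S \<in> yvars (i - 1)"
    unfolding S_def using assms
    by (intro yvars_sum yvars_mult yvars_power yvars_uminus yvars_1 yvars_yvar yvars_of_nat) auto
  ultimately show ?thesis by simp
qed

lemma even_z_in_yvars: "even_z i \<in> yvars i"
  unfolding even_z_def
  by (intro yvars_sum yvars_mult yvars_power yvars_uminus yvars_1 yvars_yvar) auto

lemma odd_w_in_yvars: "odd_w i \<in> yvars i"
  unfolding odd_w_def
  by (intro yvars_sum yvars_mult yvars_power yvars_uminus yvars_1 yvars_yvar yvars_of_nat) auto

lemma z_int_in_yvars: "z_int i \<in> yvars i"
  using yvars_mono[OF even_z_in_yvars, of "i - 1" i]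
  by (cases i) (auto simp: z_int_def intro!: yvars_diff yvars_mult yvars_yvar even_z_in_yvars odd_w_in_yvars)

text \<open>The pair (c, e) is (2, 1) for even and (i, 2) for odd \<open>i\<close>. Since 2 <= i <=
  n < p in the application, c is invertible there, and once y_0 is inverted y_i can be solved for in
  terms of z_i and lower variables.\<close>

lemma z_int_leading:
  assumes "2 \<le> i"
  shows "\<exists>c e. c \<in> {2, i} \<and>
    z_int i - of_nat c * yvar 0 ^ e * yvar i \<in> (yvars (i - 1) :: 'r::comm_ring_1 ypoly set)"
proof (cases "even i")
  case True
  then show ?thesis using even_z_leading[of i] assms
    by (intro exI[of _ 2] exI[of _ 1]) (simp add: z_int_def mult.assoc)
next
  case False
  with assms have i: "3 \<le> i" by presburger
  have "yvar 0 * (odd_w i - of_nat i * (yvar 0 * yvar i)) - yvar 1 * even_z (i - 1)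
      \<in> (yvars (i - 1) :: 'r ypoly set)"
    using i by (intro yvars_diff yvars_mult odd_w_leading even_z_in_yvars yvars_yvar) auto
  then show ?thesis using False
    by (intro exI[of _ i] exI[of _ 2]) (simp add: z_int_def power2_eq_square algebra_simps)
qed

section \<open>Weights, ladders and the closed form of the z_i over the rationals\<close>

lemma weight_eqI:
  assumes "u \<noteq> 0" "h_der n u = yconst a * u"
  shows "weight n u = a"
  unfolding weight_def
proof (rule the_equality)
  show "h_der n u = yconst a * u" by (rule assms(2))
next
  fix b assume "h_der n u = yconst b * u"
  with assms have "yconst b = (yconst a :: rat ypoly)" by simp
  then show "b = a" by (metis yconst_def lookup_single_eq)
qed

lemma yvar_neq_0 [simp]: "(yvar i :: 'r::comm_ring_1 ypoly) \<noteq> 0"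
  by (metis lookup_single_eq lookup_zero yvar_def zero_neq_one)

lemma weight_yvar_0:
  assumes "1 \<le> n"
  shows "weight n (yvar 0) = of_nat n"
proof (rule weight_eqI)
  show "h_der n (yvar 0) = yconst (of_nat n) * yvar 0"
    using assms
    by (simp add: h_der_def x_der_eq_fil_der f_der_yvar fil_der_yvar derivation_mult[OF derivation_fil_der]
        derivation_of_nat[OF derivation_fil_der] derivation_0[OF derivation_f_der] yconst_of_nat)
qed simp

text \<open>The normalizing factor of \<open>ladder\<close> is exactly the inverse of the
  coefficient (k + 1)(n - k) with which \<open>f_der\<close> raises \<open>yvar k\<close>.\<close>

lemma ladder_yvar_0: "k \<le> n \<Longrightarrow> ladder n (of_nat n) (yvar 0) k = yvar k"
proof (induction k)
  case (Suc k)
  let ?c = "of_nat (Suc k) * (of_nat n - of_nat (Suc k) + 1) :: rat"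
  have c: "?c = of_nat ((k + 1) * (n - k))" using Suc.prems unfolding of_nat_mult
    by (simp add: of_nat_diff algebra_simps)
  have "?c \<noteq> 0" unfolding c using Suc.prems by (subst of_nat_eq_0_iff) auto
  have "ladder n (of_nat n) (yvar 0) (Suc k) = yconst (1 / ?c) * (of_nat ((k + 1) * (n - k)) * yvar (k + 1))"
    using Suc by (simp only: ladder.simps f_der_yvar)
  also have "\<dots> = yconst (1 / ?c * ?c) * yvar (Suc k)"
    unfolding yconst_mult c yconst_of_nat by simp
  also have "\<dots> = yvar (Suc k)" using \<open>?c \<noteq> 0\<close> by simp
  finally show ?case .
qed simp

lemma circ_yvar_0:
  assumes "1 \<le> n" "i \<le> n"
  shows "circ n i (yvar 0) (yvar 0) = even_z i"
  unfolding circ_def even_z_def weight_yvar_0[OF assms(1)]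
  by (rule sum.cong) (use assms in \<open>simp_all add: ladder_yvar_0 mult.assoc\<close>)

lemma f_der_even_z:
  assumes "Suc i \<le> n"
  shows "f_der n (even_z i) = of_nat (n - i) * odd_w_twice (Suc i)"
proof -
  let ?m = "of_nat :: nat \<Rightarrow> rat ypoly"
  let ?y = "\<lambda>j. yvar j * yvar (Suc i - j) :: rat ypoly"
  have sgn: "f_der n ((-1) ^ k * f) = (-1) ^ k * f_der n f" for k f
    by (simp add: derivation_mult[OF derivation_f_der] derivation_minus_one_power[OF derivation_f_der])
  have f: "f_der n (yvar k) = (?m k + 1) * (?m n - ?m k) * yvar (k + 1)" if "k \<le> n" for k
    unfolding f_der_yvar[OF that] of_nat_mult of_nat_diff[OF that] of_nat_add by simp
  have "f_der n (even_z i) = (\<Sum>k\<le>i. (-1) ^ k * (f_der n (yvar k) * yvar (i - k)))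
      + (\<Sum>k\<le>i. (-1) ^ k * (yvar k * f_der n (yvar (i - k))))"
    unfolding even_z_def derivation_sum[OF derivation_f_der] sgn
      derivation_mult[OF derivation_f_der, of n "yvar i" for i] distrib_left sum.distrib ..
  also have "(\<Sum>k\<le>i. (-1) ^ k * (f_der n (yvar k) * yvar (i - k)))
      = (\<Sum>j\<le>Suc i. - ((-1) ^ j * (?m j * (?m n + 1 - ?m j)) * ?y j))"
    using assms by (subst sum.atMost_Suc_shift) (auto simp: f algebra_simps intro!: sum.cong)
  \<comment> \<open>The range is extended by \<open>j = Suc i\<close>, where the coefficient
    \<open>?m (Suc i) - ?m j\<close> vanishes, so that it matches the range of the shifted first
    sum.\<close>
  also have "(\<Sum>k\<le>i. (-1) ^ k * (yvar k * f_der n (yvar (i - k))))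
      = (\<Sum>j\<le>Suc i. (-1) ^ j * ((?m (Suc i) - ?m j) * (?m n - ?m i + ?m j)) * ?y j)"
    using assms by (auto simp: f of_nat_diff Suc_diff_le algebra_simps intro!: sum.cong)
  also have "(\<Sum>j\<le>Suc i. - ((-1) ^ j * (?m j * (?m n + 1 - ?m j)) * ?y j)) + \<dots>
      = (\<Sum>j\<le>Suc i. ?m (n - i) * ((-1) ^ j * (?m (Suc i) - 2 * ?m j) * ?y j))"
  \<comment> \<open>Termwise this is (i + 1 - j)(n - i + j) - j (n + 1 - j) = (n - i)(i + 1 - 2
    j).\<close>
  proof (subst sum.distrib[symmetric], rule sum.cong[OF refl])
    fix j
    have diff: "?m (n - i) = ?m n - ?m i" using assms by (simp add: of_nat_diff)
    show "- ((-1) ^ j * (?m j * (?m n + 1 - ?m j)) * ?y j)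
        + (-1) ^ j * ((?m (Suc i) - ?m j) * (?m n - ?m i + ?m j)) * ?y j
        = ?m (n - i) * ((-1) ^ j * (?m (Suc i) - 2 * ?m j) * ?y j)"
      unfolding diff by (simp add: algebra_simps)
  qed
  finally show ?thesis by (simp only: odd_w_twice_def sum_distrib_left)
qed

text \<open>\<open>weight\<close> is a definite description and is determined only for a nonzero
  eigenvector.\<close>

lemma even_z_neq_0:
  assumes "even i"
  shows "(even_z i :: rat ypoly) \<noteq> 0"
proof
  assume 0: "even_z i = (0 :: rat ypoly)"
  show False
  proof (cases "i = 0")
    case True
    with 0 show False by (simp add: even_z_def)
  next
    case False
    with even_z_leading[OF assms, where ?'r = rat] 0
    have "- (2 * (yvar 0 * yvar i)) \<in> (yvars (i - 1) :: rat ypoly set)" by simp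
    moreover have "- (2 * (yvar 0 * yvar i)) = (Poly_Mapping.single (Poly_Mapping.single 0 1 + Poly_Mapping.single i 1) (-2) :: rat ypoly)"
      by (simp add: yvar_def mult_single single_uminus flip: single_numeral)
    moreover have "i \<in> Poly_Mapping.keys (Poly_Mapping.single 0 1 + Poly_Mapping.single i 1 :: nat \<Rightarrow>\<^sub>0 nat)"
      by (simp add: in_keys_iff lookup_add)
    ultimately show False using False
      by (auto simp: yvars_def)
  qed
qed

lemma z_rat_eq:
  assumes "2 \<le> i" "i \<le> n"
  shows "z_rat n i = z_int i"
proof (cases "even i")
  case True
  then show ?thesis using assms by (auto simp: z_rat_def z_int_def circ_yvar_0)
next
  case False
  with assms obtain j where j: "i = Suc j" "even j" "0 < j" "Suc j \<le> n" by (cases i) auto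
  let ?v = "even_z j :: rat ypoly" and ?c = "of_nat (2 * (n - j)) :: rat"
  have "?c \<noteq> 0" using j by (subst of_nat_eq_0_iff) auto
  have f: "f_der n ?v = yconst ?c * odd_w i"
    using f_der_even_z[OF j(4)] odd_w_twice[OF False, where ?'r = rat]
    unfolding yconst_of_nat j(1)[symmetric] by (simp add: mult_ac)
  \<comment> \<open>The derivation kills \<open>?v\<close>, so the commutator reduces to the
    derivative of \<open>f_der n ?v\<close>, and \<open>odd_w i\<close> is sent back to
    \<open>?v\<close>. The eigenvalue is the expected weight n + n - 2 j.\<close>
  have "h_der n ?v = yconst ?c * ?v"
    using j fil_der_odd_w[OF False assms(2), where ?'r = rat]
    by (simp add: h_der_def f x_der_eq_fil_der fil_der_even_z derivation_0[OF derivation_f_der]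
        derivation_mult[OF derivation_fil_der] fil_der_yconst)
  then have w: "weight n ?v = ?c"
    by (rule weight_eqI[OF even_z_neq_0[OF j(2)]])
  have l0: "ladder n (of_nat n) (yvar 0) (Suc 0) = yvar 1"
    using j ladder_yvar_0[of 1 n] by simp
  have l1: "ladder n ?c ?v (Suc 0) = odd_w i"
    using \<open>?c \<noteq> 0\<close> by (simp add: f flip: mult.assoc yconst_mult)
  have "circ n 1 (yvar 0) ?v = yvar 0 * odd_w i - yvar 1 * ?v"
    using weight_yvar_0[of n] j l0 l1 by (simp add: circ_def w)
  then show ?thesis using False j assms circ_yvar_0[of n j]
    by (simp add: z_rat_def z_int_def)
qed

section \<open>Change of coefficients from the integers\<close>

context
  fixes h :: "int ypoly \<Rightarrow> 'r::comm_ring_1 ypoly"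
  defines "h \<equiv> Poly_Mapping.map of_int"
begin

lemma lookup_map_of_int: "Poly_Mapping.lookup (h f) m = of_int (Poly_Mapping.lookup f m)"
  by (simp add: h_def Poly_Mapping.map.rep_eq when_def)

lemma map_of_int_single: "h (Poly_Mapping.single m c) = Poly_Mapping.single m (of_int c)"
  by (rule poly_mapping_eqI) (simp add: lookup_map_of_int lookup_single when_def)

lemma map_of_int_add: "h (f + g) = h f + h g"
  by (rule poly_mapping_eqI) (simp add: lookup_map_of_int lookup_add)

lemma map_of_int_uminus: "h (- f) = - h f"
  by (rule poly_mapping_eqI) (simp add: lookup_map_of_int)

lemma map_of_int_diff: "h (f - g) = h f - h g"
  by (rule poly_mapping_eqI) (simp add: lookup_map_of_int lookup_minus)

lemma map_of_int_mult: "h (f * g) = h f * h g"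
proof (induction f rule: poly_mapping_additive_induct)
  case (single m c)
  show ?case
    by (induction g rule: poly_mapping_additive_induct)
       (simp_all add: mult_single map_of_int_single map_of_int_add distrib_left)
qed (simp add: distrib_right map_of_int_add)

lemma map_of_int_0: "h 0 = 0" and map_of_int_1: "h 1 = 1"
  using map_of_int_single[of 0 0] map_of_int_single[of 0 1] by simp_all

lemma map_of_int_power: "h (f ^ k) = h f ^ k"
  by (induction k) (simp_all add: map_of_int_mult map_of_int_1)

lemma map_of_int_of_nat: "h (of_nat k) = of_nat k"
  by (induction k) (simp_all add: map_of_int_0 map_of_int_add map_of_int_1)

lemma map_of_int_sum: "h (\<Sum>i\<in>A. f i) = (\<Sum>i\<in>A. h (f i))"
  by (induction A rule: infinite_finite_induct) (simp_all add: map_of_int_0 map_of_int_add)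

lemma map_of_int_yvar: "h (yvar i) = yvar i"
  by (simp add: yvar_def map_of_int_single)

lemma map_of_int_z_int: "h (z_int i) = z_int i"
  unfolding z_int_def even_z_def odd_w_def
  by (simp only: if_distrib[of h] map_of_int_sum map_of_int_mult map_of_int_power
      map_of_int_uminus map_of_int_diff map_of_int_1 map_of_int_of_nat map_of_int_yvar)

end

text \<open>The rational z_i and its reduction both come from the same integral polynomial, on whose
  coefficients the floor merely undoes \<open>of_int\<close>.\<close>

lemma z_poly_eq:
  assumes "2 \<le> i" "i \<le> n"
  shows "z_poly n i = (z_int i :: 'k::field ypoly)"
proof (rule poly_mapping_eqI)
  fix m
  let ?z = "z_int i :: int ypoly"
  have "Poly_Mapping.lookup (z_poly n i) m = (of_int \<lfloor>Poly_Mapping.lookup (z_rat n i) m\<rfloor> :: 'k)"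
    by (simp add: z_poly_def Poly_Mapping.map.rep_eq when_def)
  also have "z_rat n i = Poly_Mapping.map of_int ?z"
    by (simp add: z_rat_eq[OF assms] map_of_int_z_int)
  also have "of_int \<lfloor>Poly_Mapping.lookup (Poly_Mapping.map of_int ?z :: rat ypoly) m\<rfloor>
      = Poly_Mapping.lookup (Poly_Mapping.map of_int ?z :: 'k ypoly) m"
    by (simp add: lookup_map_of_int)
  finally show "Poly_Mapping.lookup (z_poly n i) m = Poly_Mapping.lookup (z_int i :: 'k ypoly) m"
    by (simp add: map_of_int_z_int)
qed

section \<open>The enveloping algebra acting on polynomials\<close>

text \<open>The action of x. The added multiplication by t keeps the powers of x apart, which the
  derivation by itself would not.\<close>

definition xop :: "nat \<Rightarrow> 'k::field ypoly \<Rightarrow> 'k ypoly"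
  where "xop n g = fil_der n g + yvar (Suc n) * g"

definition fil_act :: "nat \<Rightarrow> 'k::field fil \<Rightarrow> 'k ypoly \<Rightarrow> 'k ypoly"
  where "fil_act n v g = yconst (Poly_Mapping.lookup v Bx) * xop n g
    + (\<Sum>i\<le>n. yconst (Poly_Mapping.lookup v (By i)) * yvar i) * g"

definition word_act :: "nat \<Rightarrow> 'k::field fil free_word \<Rightarrow> 'k ypoly \<Rightarrow> 'k ypoly"
  where "word_act n w = foldr (fil_act n) (letters w)"

definition fa_act :: "nat \<Rightarrow> ('k::field, 'k fil) free_alg \<Rightarrow> 'k ypoly \<Rightarrow> 'k ypoly"
  where "fa_act n u g = (\<Sum>w\<in>Poly_Mapping.keys u. yconst (Poly_Mapping.lookup u w) * word_act n w g)"

lemma xop_add: "xop n (g + h) = xop n g + xop n h"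
  by (simp add: xop_def derivation_add[OF derivation_fil_der] distrib_left)

lemma xop_mult: "xop n (f * g) = fil_der n f * g + f * xop n g"
  by (simp add: xop_def derivation_mult[OF derivation_fil_der] algebra_simps)

lemma fil_act_add: "fil_act n v (g + h) = fil_act n v g + fil_act n v h"
  by (simp add: fil_act_def xop_add algebra_simps)

text \<open>Multiplication by a constant of the derivation commutes with x and all y_i. The whole
  action is therefore linear over the ring of constants, which is the source of central
  elements.\<close>

lemma fil_act_mult_kernel: "fil_der n c = 0 \<Longrightarrow> fil_act n v (c * g) = c * fil_act n v g"
  by (simp add: fil_act_def xop_mult algebra_simps)

lemma word_act_simps [simp]:
  "word_act n 0 g = g"
  "word_act n (Word [v]) g = fil_act n v g"
  "word_act n (w + w') g = word_act n w (word_act n w' g)"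
  by (simp_all add: word_act_def zero_free_word_def plus_free_word_def)

lemma word_act_add: "word_act n w (g + h) = word_act n w g + word_act n w h"
proof -
  have "foldr (fil_act n) vs (g + h) = foldr (fil_act n) vs g + foldr (fil_act n) vs h" for vs
    by (induction vs) (simp_all add: fil_act_add)
  then show ?thesis by (simp add: word_act_def)
qed

lemma word_act_mult_kernel: "fil_der n c = 0 \<Longrightarrow> word_act n w (c * g) = c * word_act n w g"
proof -
  assume "fil_der n c = 0"
  then have "foldr (fil_act n) vs (c * g) = c * foldr (fil_act n) vs g" for vs
    by (induction vs) (simp_all add: fil_act_mult_kernel)
  then show ?thesis by (simp add: word_act_def)
qed

lemma fa_act_superset:
  assumes "finite A" "Poly_Mapping.keys u \<subseteq> A"
  shows "fa_act n u g = (\<Sum>w\<in>A. yconst (Poly_Mapping.lookup u w) * word_act n w g)"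
  unfolding fa_act_def
  by (rule sum.mono_neutral_left) (use assms in \<open>auto simp: in_keys_iff\<close>)

lemma fa_act_single: "fa_act n (Poly_Mapping.single w c) g = yconst c * word_act n w g"
  by (subst fa_act_superset[of "{w}"]) auto

lemma fa_act_add_left: "fa_act n (u + v) g = fa_act n u g + fa_act n v g"
proof -
  let ?A = "Poly_Mapping.keys u \<union> Poly_Mapping.keys v"
  have "Poly_Mapping.keys (u + v) \<subseteq> ?A" by (rule keys_add)
  then show ?thesis
    by (simp add: fa_act_superset[of ?A] lookup_add yconst_add distrib_right sum.distrib)
qed

lemma fa_act_0_left: "fa_act n 0 g = 0"
  by (simp add: fa_act_def)

lemma fa_act_uminus_left: "fa_act n (- u) g = - fa_act n u g"
  using fa_act_add_left[of n u "- u" g] by (simp add: fa_act_0_left eq_neg_iff_add_eq_0 add.commute)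

lemma fa_act_diff_left: "fa_act n (u - v) g = fa_act n u g - fa_act n v g"
  using fa_act_add_left[of n u "- v" g] by (simp add: fa_act_uminus_left)

lemma fa_act_sum_left: "fa_act n (\<Sum>i\<in>A. u i) g = (\<Sum>i\<in>A. fa_act n (u i) g)"
  by (induction A rule: infinite_finite_induct) (simp_all add: fa_act_0_left fa_act_add_left)

lemma fa_act_add: "fa_act n u (g + h) = fa_act n u g + fa_act n u h"
  by (simp add: fa_act_def word_act_add distrib_left sum.distrib)

lemma fa_act_mult_kernel: "fil_der n c = 0 \<Longrightarrow> fa_act n u (c * g) = c * fa_act n u g"
  by (simp add: fa_act_def word_act_mult_kernel sum_distrib_left mult.left_commute)

lemma fa_act_mult: "fa_act n (u * v) g = fa_act n u (fa_act n v g)"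
proof (induction u rule: poly_mapping_additive_induct)
  case (single w c)
  show ?case
  proof (induction v rule: poly_mapping_additive_induct)
    case (single w' c')
    then show ?case
      by (simp add: mult_single fa_act_single word_act_mult_kernel[OF fil_der_yconst] yconst_mult mult_ac)
  qed (simp add: distrib_left fa_act_add_left fa_act_add)
qed (simp add: distrib_right fa_act_add_left)

lemma fa_act_0: "fa_act n u 0 = 0"
  using fa_act_mult_kernel[of n 0 u 0] by (simp add: derivation_0[OF derivation_fil_der])

lemma fa_act_const: "fa_act n (fa_const c) g = yconst c * g"
  by (simp add: fa_const_def fa_act_single)

lemma fa_act_gen: "fa_act n (fa_gen v) g = fil_act n v g"
  by (simp add: fa_gen_def fa_act_single)

lemma fa_act_1: "fa_act n 1 g = g"
  using fa_act_single[of n 0 1 g] by simp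

lemma sum_atMost_eq_single:
  assumes "j \<le> n" "\<And>i. i \<le> n \<Longrightarrow> i \<noteq> j \<Longrightarrow> f i = 0"
  shows "(\<Sum>i\<le>n. f i) = (f (j::nat) :: 'a::comm_monoid_add)"
proof -
  have "(\<Sum>i\<le>n. f i) = (\<Sum>i\<le>n. if i = j then f i else 0)"
    by (rule sum.cong) (use assms in auto)
  with assms(1) show ?thesis by (simp add: sum.delta)
qed

lemma fil_act_x: "fil_act n (fil_vec Bx) g = xop n g"
  by (simp add: fil_act_def fil_vec_def lookup_single)

lemma fil_act_y:
  assumes "i \<le> n"
  shows "fil_act n (fil_vec (By i)) g = yvar i * g"
  unfolding fil_act_def fil_vec_def
  by (subst sum_atMost_eq_single[OF assms]) (auto simp: lookup_single when_def)

lemma fil_der_linear: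
  "fil_der n (\<Sum>i\<le>n. yconst (c i) * yvar i) = (\<Sum>i<n. yconst (c (Suc i)) * yvar i)"
proof -
  have "fil_der n (\<Sum>i\<le>n. yconst (c i) * yvar i) = (\<Sum>i\<le>n. yconst (c i) * fil_der n (yvar i))"
    by (simp add: derivation_sum[OF derivation_fil_der] derivation_mult[OF derivation_fil_der] fil_der_yconst)
  also have "\<dots> = (\<Sum>i<n. yconst (c (Suc i)) * yvar i)"
    by (simp add: sum.atMost_shift fil_der_yvar)
  finally show ?thesis .
qed

text \<open>The commutator of D + t with multiplication by y_i is multiplication by D y_i = y_(i-1),
  and multiplications commute with each other.\<close>

lemma fil_act_bracket:
  "fil_act n a (fil_act n b g) - fil_act n b (fil_act n a g) = fil_act n (fil_bracket n a b) g"
proof -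
  let ?f = "\<lambda>v. \<Sum>i\<le>n. yconst (Poly_Mapping.lookup v (By i)) * yvar i :: 'a ypoly"
  let ?x = "\<lambda>v. yconst (Poly_Mapping.lookup v Bx) :: 'a ypoly"
  let ?d = "\<lambda>v. \<Sum>i<n. yconst (Poly_Mapping.lookup v (By (Suc i))) * yvar i :: 'a ypoly"
  have "?f (fil_bracket n a b) = (\<Sum>i<n. yconst (Poly_Mapping.lookup (fil_bracket n a b) (By i)) * yvar i)"
    by (rule sum.mono_neutral_right) (auto simp: lookup_fil_bracket)
  also have "\<dots> = (\<Sum>i<n. ?x a * (yconst (Poly_Mapping.lookup b (By (Suc i))) * yvar i)
      - ?x b * (yconst (Poly_Mapping.lookup a (By (Suc i))) * yvar i))"
  proof (rule sum.cong[OF refl])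
    fix i assume "i \<in> {..<n}"
    have diff: "yconst (s - t) = yconst s - yconst t" for s t :: 'a
      by (metis diff_add_cancel eq_diff_eq yconst_add)
    from \<open>i \<in> {..<n}\<close> show "yconst (Poly_Mapping.lookup (fil_bracket n a b) (By i)) * yvar i
        = ?x a * (yconst (Poly_Mapping.lookup b (By (Suc i))) * yvar i)
          - ?x b * (yconst (Poly_Mapping.lookup a (By (Suc i))) * yvar i)"
      by (simp add: lookup_fil_bracket diff yconst_mult algebra_simps)
  qed
  also have "\<dots> = ?x a * ?d b - ?x b * ?d a"
    by (simp add: sum_subtractf sum_distrib_left)
  finally have br: "?f (fil_bracket n a b) = ?x a * ?d b - ?x b * ?d a" .
  have x0: "Poly_Mapping.lookup (fil_bracket n a b) Bx = 0"
    by (simp add: lookup_fil_bracket)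
  have X: "xop n (?x u * h) = ?x u * xop n h" "xop n (?f u * h) = ?d u * h + ?f u * xop n h" for u h
    by (simp_all only: xop_mult fil_der_linear fil_der_yconst) simp
  show ?thesis
    unfolding fil_act_def[of n "fil_bracket n a b"] br x0
    unfolding fil_act_def xop_add X by (simp add: algebra_simps)
qed

section \<open>Constants and p-th powers of the operators in characteristic p\<close>

lemma derivation_prod_eq_0:
  assumes "derivation D" "\<And>i. i \<in> B \<Longrightarrow> D (f i) = 0"
  shows "D (\<Prod>i\<in>B. f i) = 0"
  using assms(2)
  by (induction B rule: infinite_finite_induct)
     (simp_all add: derivation_1[OF assms(1)] derivation_mult[OF assms(1)])

lemma lookup_ypderiv:
  "Poly_Mapping.lookup (ypderiv i f) k
    = of_nat (Suc (Poly_Mapping.lookup k i)) * Poly_Mapping.lookup f (k + Poly_Mapping.single i 1)"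
proof (induction f rule: poly_mapping_additive_induct)
  case (single m c)
  show ?case
  proof (cases "m = k + Poly_Mapping.single i 1")
    case True
    then show ?thesis by (simp add: ypderiv_single lookup_add)
  next
    case False
    have "m - Poly_Mapping.single i 1 \<noteq> k" if "Poly_Mapping.lookup m i \<noteq> 0"
    proof
      assume "m - Poly_Mapping.single i 1 = k"
      then have "k + Poly_Mapping.single i 1 = m"
        using that by (intro poly_mapping_eqI)
          (auto simp: lookup_add lookup_minus lookup_single when_def)
      with False show False by simp
    qed
    with False show ?thesis
      by (cases "Poly_Mapping.lookup m i = 0") (simp_all add: ypderiv_single lookup_single)
  qed
qed (simp add: ypderiv_add lookup_add distrib_left)

text \<open>Each coefficient of the derivative stems from exactly one monomial of f, so every
  monomial must be killed on its own.\<close>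

lemma CHAR_dvd_exponent:
  assumes "ypderiv i f = 0" "m \<in> Poly_Mapping.keys (f :: 'r::idom ypoly)"
  shows "CHAR('r) dvd Poly_Mapping.lookup m i"
proof (cases "Poly_Mapping.lookup m i = 0")
  case False
  define k where "k = m - Poly_Mapping.single i 1"
  have m: "m = k + Poly_Mapping.single i 1"
    using False by (intro poly_mapping_eqI)
      (auto simp: k_def lookup_add lookup_minus lookup_single when_def)
  have "of_nat (Suc (Poly_Mapping.lookup k i)) * Poly_Mapping.lookup f m = 0"
    using lookup_ypderiv[of i f k] assms(1) by (simp add: m)
  with assms(2) have "of_nat (Poly_Mapping.lookup m i) = (0 :: 'r)"
    by (auto simp: in_keys_iff m lookup_add simp del: of_nat_Suc)
  then show ?thesis by (simp add: of_nat_eq_0_iff_char_dvd)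
qed simp

lemma ypoly_in_yvars: "\<exists>N. f \<in> yvars N"
proof -
  have "finite (\<Union>(Poly_Mapping.keys ` Poly_Mapping.keys f))" by auto
  then obtain N where "\<forall>i\<in>\<Union>(Poly_Mapping.keys ` Poly_Mapping.keys f). i \<le> N"
    using finite_nat_set_iff_bounded_le by blast
  then show ?thesis by (auto simp: yvars_def)
qed

lemma fil_der_funpow_yvar:
  "(fil_der n ^^ k) (yvar i) = (if k = 0 then yvar i else if k \<le> i \<and> i \<le> n then yvar (i - k) else 0)"
proof (induction k)
  case (Suc k)
  then show ?case by (auto simp: fil_der_yvar derivation_0[OF derivation_fil_der])
qed simp

text \<open>The p-th power of a derivation is again a derivation in characteristic p, so only
  generators matter; p >= n + 1 index drops take every y_i to 0.\<close>

lemma fil_der_funpow_CHAR: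
  assumes "Factorial_Ring.prime p" "CHAR('r::comm_ring_1) = p" "n + 1 \<le> p"
  shows "(fil_der n ^^ p) (f :: 'r ypoly) = 0"
proof -
  have D: "derivation (fil_der n :: 'r ypoly \<Rightarrow> 'r ypoly)" by (rule derivation_fil_der)
  obtain N where "f \<in> yvars N" using ypoly_in_yvars by blast
  then show ?thesis
  proof (induction rule: yvars_induct)
    case (yconst c)
    have "(fil_der n ^^ Suc k) (yconst c) = 0" for k
      by (induction k) (simp_all add: fil_der_yconst derivation_0[OF D])
    moreover have "p = Suc (p - 1)" using assms by simp
    ultimately show ?case by metis
  next
    case (yvar i)
    then show ?case using assms(3) by (simp add: fil_der_funpow_yvar)
  next
    case (add f g)
    have "(fil_der n ^^ k) (f + g) = (fil_der n ^^ k) f + (fil_der n ^^ k) g" for k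
      by (induction k) (simp_all add: derivation_add[OF D])
    with add show ?case by simp
  next
    case (mult f g)
    then show ?case
      using twisted_leibniz_funpow_CHAR[OF D derivation_add[OF D] derivation_mult[OF D] assms(1)]
      by (simp add: CHAR_ypoly assms(2))
  qed
qed

lemma xop_funpow_1: "(xop n ^^ k) 1 = yvar (Suc n) ^ k"
proof (induction k)
  case (Suc k)
  then show ?case
    by (simp add: xop_def derivation_power[OF derivation_fil_der] fil_der_yvar)
qed simp

text \<open>The second derivative of y_1 vanishes, so the expansion of (D + t)^k stops after its
  first-order term. That term is y_0 times the t-derivative of t^k.\<close>

lemma xop_funpow_yvar_1:
  assumes "1 \<le> n"
  shows "(xop n ^^ k) (yvar 1 :: 'k::field ypoly) = yvar 1 * yvar (Suc n) ^ k + yvar 0 * (of_nat k * yvar (Suc n) ^ (k - 1))"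
proof (induction k)
  case (Suc k)
  have D: "fil_der n (yvar (Suc n) ^ j :: 'k ypoly) = 0" for j
    by (simp add: derivation_power[OF derivation_fil_der] fil_der_yvar)
  have "(xop n ^^ Suc k) (yvar 1 :: 'k ypoly) = xop n (yvar 1 * yvar (Suc n) ^ k + yvar 0 * (of_nat k * yvar (Suc n) ^ (k - 1)))"
    by (simp only: funpow.simps o_apply Suc)
  also have "\<dots> = yvar 1 * yvar (Suc n) ^ Suc k + yvar 0 * (of_nat (Suc k) * yvar (Suc n) ^ (Suc k - 1))"
    using assms
    by (cases k) (simp_all add: xop_def D derivation_add[OF derivation_fil_der]
        derivation_mult[OF derivation_fil_der] derivation_of_nat[OF derivation_fil_der]
        derivation_1[OF derivation_fil_der] fil_der_yvar algebra_simps)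
  finally show ?case .
qed simp

lemma xop_funpow_CHAR:
  assumes "Factorial_Ring.prime p" "CHAR('k::field) = p" "n + 1 \<le> p"
  shows "(xop n ^^ (p * j)) g = yvar (Suc n) ^ (p * j) * (g :: 'k ypoly)"
proof (induction j)
  case (Suc j)
  \<comment> \<open>Writing h as h * 1 puts h in the differentiated slot of the twisted Leibniz
    rule: D^p h vanishes and (D + t)^p 1 is t^p.\<close>
  have "(xop n ^^ p) (h * 1) = (fil_der n ^^ p) h * 1 + h * (xop n ^^ p) 1" for h :: "'k ypoly"
    by (rule twisted_leibniz_funpow_CHAR[OF derivation_fil_der xop_add xop_mult assms(1)])
       (simp add: CHAR_ypoly assms(2))
  then have step: "(xop n ^^ p) h = h * yvar (Suc n) ^ p" for h :: "'k ypoly"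
    by (simp add: fil_der_funpow_CHAR[OF assms] xop_funpow_1)
  have "(xop n ^^ (p * Suc j)) g = (xop n ^^ p) ((xop n ^^ (p * j)) g)"
    by (simp add: funpow_add)
  also have "\<dots> = yvar (Suc n) ^ (p * Suc j) * g"
    unfolding step Suc mult_Suc_right power_add by (simp only: mult_ac)
  finally show ?case .
qed simp

definition fil_kernel :: "nat \<Rightarrow> 'k::field ypoly set"
  where "fil_kernel n = {c \<in> yvars (Suc n). fil_der n c = 0 \<and> ypderiv (Suc n) c = 0}"

section \<open>Normal forms in the enveloping algebra\<close>

abbreviation fil_free :: "nat \<Rightarrow> ('k::field, 'k fil) free_alg ring"
  where "fil_free n \<equiv> free_algebra (fil_space n)"

abbreviation fil_ideal :: "nat \<Rightarrow> ('k::field, 'k fil) free_alg set"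
  where "fil_ideal n \<equiv> uea_ideal fil_scale (fil_space n) (fil_bracket n)"

lemma free_algebra_simps [simp]:
  "a \<otimes>\<^bsub>free_algebra L\<^esub> b = a * b" "a \<oplus>\<^bsub>free_algebra L\<^esub> b = a + b"
  "\<one>\<^bsub>free_algebra L\<^esub> = 1" "\<zero>\<^bsub>free_algebra L\<^esub> = 0"
  by (simp_all add: free_algebra_def)

lemma free_algebra_closed:
  fixes a b :: "('k::field, 'v) free_alg"
  shows "a \<in> carrier (free_algebra L) \<Longrightarrow> b \<in> carrier (free_algebra L) \<Longrightarrow> a + b \<in> carrier (free_algebra L)"
    and "a \<in> carrier (free_algebra L) \<Longrightarrow> b \<in> carrier (free_algebra L) \<Longrightarrow> a * b \<in> carrier (free_algebra L)"
    and "a \<in> carrier (free_algebra L) \<Longrightarrow> - a \<in> carrier (free_algebra L)"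
    and "(0 :: ('k, 'v) free_alg) \<in> carrier (free_algebra L)"
    and "(1 :: ('k, 'v) free_alg) \<in> carrier (free_algebra L)"
proof -
  interpret ring "free_algebra L :: ('k, 'v) free_alg ring" by (rule free_algebra_ring)
  show "a \<in> carrier (free_algebra L) \<Longrightarrow> b \<in> carrier (free_algebra L) \<Longrightarrow> a + b \<in> carrier (free_algebra L)"
    using a_closed[of a b] by simp
  show "a \<in> carrier (free_algebra L) \<Longrightarrow> b \<in> carrier (free_algebra L) \<Longrightarrow> a * b \<in> carrier (free_algebra L)"
    using m_closed[of a b] by simp
  show "(0 :: ('k, 'v) free_alg) \<in> carrier (free_algebra L)" using zero_closed by simp
  show "(1 :: ('k, 'v) free_alg) \<in> carrier (free_algebra L)" using one_closed by simp
  show "a \<in> carrier (free_algebra L) \<Longrightarrow> - a \<in> carrier (free_algebra L)"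
    by (simp add: free_algebra_def)
qed

lemma free_algebra_a_inv:
  fixes a :: "('k::field, 'v) free_alg"
  assumes "a \<in> carrier (free_algebra L)"
  shows "\<ominus>\<^bsub>free_algebra L\<^esub> a = - a"
proof -
  interpret ring "free_algebra L :: ('k, 'v) free_alg ring" by (rule free_algebra_ring)
  show ?thesis by (rule minus_equality) (use assms in \<open>simp_all add: free_algebra_closed\<close>)
qed

lemma free_algebra_diff_closed:
  "a \<in> carrier (free_algebra L) \<Longrightarrow> b \<in> carrier (free_algebra L) \<Longrightarrow>
    a - b \<in> carrier (free_algebra L :: ('k::field, 'v) free_alg ring)"
  using free_algebra_closed(1)[of a L "- b"] by (simp add: free_algebra_closed)

lemma free_algebra_sum_closed:
  "(\<And>i. i \<in> A \<Longrightarrow> f i \<in> carrier (free_algebra L)) \<Longrightarrow>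
    (\<Sum>i\<in>A. f i) \<in> carrier (free_algebra L :: ('k::field, 'v) free_alg ring)"
  by (induction A rule: infinite_finite_induct) (simp_all add: free_algebra_closed)

lemma free_algebra_power_closed:
  "a \<in> carrier (free_algebra L) \<Longrightarrow> a ^ k \<in> carrier (free_algebra L :: ('k::field, 'v) free_alg ring)"
  by (induction k) (simp_all add: free_algebra_closed)

lemma free_algebra_prod_list_closed:
  "set us \<subseteq> carrier (free_algebra L) \<Longrightarrow> prod_list us \<in> carrier (free_algebra L :: ('k::field, 'v) free_alg ring)"
  by (induction us) (simp_all add: free_algebra_closed)

lemma fa_const_closed: "fa_const c \<in> carrier (free_algebra L)"
  by (simp add: free_algebra_def fa_const_def zero_free_word_def)

lemma fa_gen_closed: "v \<in> L \<Longrightarrow> fa_gen v \<in> carrier (free_algebra L)"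
  by (simp add: free_algebra_def fa_gen_def)

lemma fa_const_commute: "fa_const c * u = u * fa_const c"
proof (induction u rule: poly_mapping_additive_induct)
  case (single w d)
  then show ?case by (simp add: fa_const_def mult_single mult.commute)
qed (simp add: distrib_left distrib_right)

lemma fa_const_simps:
  "fa_const 0 = 0" "fa_const 1 = 1" "fa_const (a + b) = fa_const a + fa_const b"
  "fa_const (a * b) = fa_const a * fa_const b"
  by (simp_all add: fa_const_def single_add mult_single)

interpretation fil: lie_algebra fil_scale "fil_space n :: 'k::field fil set" "fil_bracket n"
  by (rule filiform_lie_algebra)

lemma fil_vec_in_space:
  "fil_vec Bx \<in> fil_space n" "i \<le> n \<Longrightarrow> fil_vec (By i) \<in> fil_space n"
  by (auto simp: fil_space_def fil_vec_def)

lemma fil_space_closed: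
  fixes v w :: "'k::field fil"
  shows "v \<in> fil_space n \<Longrightarrow> w \<in> fil_space n \<Longrightarrow> v + w \<in> fil_space n"
    and "v \<in> fil_space n \<Longrightarrow> fil_scale c v \<in> fil_space n"
    and "(0 :: 'k fil) \<in> fil_space n"
proof -
  have "fil.subspace (fil_space n :: 'k fil set)" by (rule fil.subspace_L)
  then show "v \<in> fil_space n \<Longrightarrow> w \<in> fil_space n \<Longrightarrow> v + w \<in> fil_space n"
    and "v \<in> fil_space n \<Longrightarrow> fil_scale c v \<in> fil_space n" and "(0 :: 'k fil) \<in> fil_space n"
    by (simp_all add: fil.subspace_def)
qed

lemma fil_relations_closed:
  "uea_relations fil_scale (fil_space n) (fil_bracket n) \<subseteq> carrier (fil_free n)"
  by (auto simp: uea_relations_def fil.br_closed fil_space_closed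
      intro!: free_algebra_diff_closed free_algebra_closed fa_gen_closed fa_const_closed)

lemma fil_ideal_ideal: "ideal (fil_ideal n) (fil_free n)"
  unfolding uea_ideal_def
  by (rule ring.genideal_ideal[OF free_algebra_ring fil_relations_closed])

lemma fil_relations_in_ideal:
  "uea_relations fil_scale (fil_space n) (fil_bracket n) \<subseteq> fil_ideal n"
  unfolding uea_ideal_def
  by (rule ring.genideal_self[OF free_algebra_ring fil_relations_closed])

lemma fil_act_linear:
  "fil_act n (a + b) g = fil_act n a g + fil_act n b g"
  "fil_act n (fil_scale r a) g = yconst r * fil_act n a g"
proof -
  show "fil_act n (a + b) g = fil_act n a g + fil_act n b g"
    by (simp add: fil_act_def lookup_add yconst_add sum.distrib distrib_right)
  have "(\<Sum>i\<le>n. yconst (r * Poly_Mapping.lookup a (By i)) * yvar i)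
      = yconst r * (\<Sum>i\<le>n. yconst (Poly_Mapping.lookup a (By i)) * yvar i)"
    unfolding sum_distrib_left by (simp only: yconst_mult mult.assoc)
  then show "fil_act n (fil_scale r a) g = yconst r * fil_act n a g"
    by (simp add: fil_act_def yconst_mult distrib_left mult.assoc)
qed

text \<open>The elements acting as zero form a two-sided ideal containing the relations, hence also
  the ideal that these generate.\<close>

lemma fa_act_fil_ideal:
  fixes u :: "('k::field, 'k fil) free_alg"
  assumes "u \<in> fil_ideal n"
  shows "fa_act n u g = 0"
proof -
  let ?K = "{u :: ('k, 'k fil) free_alg. u \<in> carrier (fil_free n) \<and> (\<forall>g. fa_act n u g = 0)}"
  interpret ring "fil_free n :: ('k, 'k fil) free_alg ring" by (rule free_algebra_ring)
  have "ideal ?K (fil_free n)"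
  proof (rule idealI)
    show "ring (fil_free n)" by (rule free_algebra_ring)
    show "subgroup ?K (add_monoid (fil_free n))"
    proof (rule group.subgroupI)
      show "Group.group (add_monoid (fil_free n :: ('k, 'k fil) free_alg ring))" by (rule a_group)
      show "?K \<noteq> {}" using fa_act_0_left free_algebra_closed(4) by blast
      show "inv\<^bsub>add_monoid (fil_free n)\<^esub> a \<in> ?K" if "a \<in> ?K" for a
      proof -
        have "inv\<^bsub>add_monoid (fil_free n)\<^esub> a = - a"
          unfolding a_inv_def[symmetric] by (rule free_algebra_a_inv) (use that in blast)
        then show ?thesis using that by (simp only: fa_act_uminus_left free_algebra_closed mem_Collect_eq) simp
      qed
    qed (auto simp: fa_act_add_left free_algebra_closed)
  qed (auto simp: fa_act_mult fa_act_0 free_algebra_closed)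
  moreover have "uea_relations fil_scale (fil_space n) (fil_bracket n) \<subseteq> ?K"
  proof
    fix r :: "('k, 'k fil) free_alg"
    assume r: "r \<in> uea_relations fil_scale (fil_space n) (fil_bracket n)"
    then have "fa_act n r g = 0" for g
      by (auto simp: uea_relations_def fa_act_diff_left fa_act_mult fa_act_gen fa_act_const
          fil_act_linear fil_act_bracket)
    with r fil_relations_closed show "r \<in> ?K" by blast
  qed
  ultimately have "fil_ideal n \<subseteq> ?K"
    unfolding uea_ideal_def by (rule genideal_minimal)
  with assms show ?thesis by blast
qed

text \<open>Equality in U(g), phrased for representatives, so that computations stay with the
  ordinary ring operations of the free algebra instead of cosets.\<close>

definition fil_cong :: "nat \<Rightarrow> ('k::field, 'k fil) free_alg \<Rightarrow> ('k, 'k fil) free_alg \<Rightarrow> bool"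
  where "fil_cong n u v \<longleftrightarrow> u \<in> carrier (fil_free n) \<and> v \<in> carrier (fil_free n) \<and> u - v \<in> fil_ideal n"

lemma fil_ideal_closed:
  fixes u v a :: "('k::field, 'k fil) free_alg"
  shows "u \<in> fil_ideal n \<Longrightarrow> v \<in> fil_ideal n \<Longrightarrow> u + v \<in> fil_ideal n"
    and "u \<in> fil_ideal n \<Longrightarrow> - u \<in> fil_ideal n"
    and "(0 :: ('k, 'k fil) free_alg) \<in> fil_ideal n"
    and "u \<in> fil_ideal n \<Longrightarrow> a \<in> carrier (fil_free n) \<Longrightarrow> a * u \<in> fil_ideal n"
    and "u \<in> fil_ideal n \<Longrightarrow> a \<in> carrier (fil_free n) \<Longrightarrow> u * a \<in> fil_ideal n"
proof -
  have ideal: "ideal (fil_ideal n :: ('k, 'k fil) free_alg set) (fil_free n)" by (rule fil_ideal_ideal)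
  note sub = ideal.axioms(1)[OF ideal]
  show "(0 :: ('k, 'k fil) free_alg) \<in> fil_ideal n"
    using additive_subgroup.zero_closed[OF sub] by simp
  show "u \<in> fil_ideal n \<Longrightarrow> v \<in> fil_ideal n \<Longrightarrow> u + v \<in> fil_ideal n"
    using additive_subgroup.a_closed[OF sub, of u v] by simp
  show "u \<in> fil_ideal n \<Longrightarrow> - u \<in> fil_ideal n"
    using ideal.I_l_closed[OF ideal, of u "- 1"] by (simp add: free_algebra_closed)
  show "u \<in> fil_ideal n \<Longrightarrow> a \<in> carrier (fil_free n) \<Longrightarrow> a * u \<in> fil_ideal n"
    using ideal.I_l_closed[OF ideal, of u a] by simp
  show "u \<in> fil_ideal n \<Longrightarrow> a \<in> carrier (fil_free n) \<Longrightarrow> u * a \<in> fil_ideal n"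
    using ideal.I_r_closed[OF ideal, of u a] by simp
qed

context
  fixes n :: nat and ty :: "'k::field itself"
begin

private abbreviation (input) A :: "('k, 'k fil) free_alg set" where "A \<equiv> carrier (fil_free n)"
private abbreviation (input) cong :: "('k, 'k fil) free_alg \<Rightarrow> ('k, 'k fil) free_alg \<Rightarrow> bool" (infix "\<doteq>" 50)
  where "u \<doteq> v \<equiv> fil_cong n u v"

lemma fil_cong_refl: "u \<in> A \<Longrightarrow> u \<doteq> u"
  by (simp add: fil_cong_def fil_ideal_closed)

lemma fil_cong_sym: "u \<doteq> v \<Longrightarrow> v \<doteq> u"
  using fil_ideal_closed(2)[of "u - v" n] by (simp add: fil_cong_def)

lemma fil_cong_trans [trans]: "u \<doteq> v \<Longrightarrow> v \<doteq> w \<Longrightarrow> u \<doteq> w"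
  using fil_ideal_closed(1)[of "u - v" n "v - w"] by (simp add: fil_cong_def)

lemma fil_cong_add: "u \<doteq> u' \<Longrightarrow> v \<doteq> v' \<Longrightarrow> u + v \<doteq> u' + v'"
  using fil_ideal_closed(1)[of "u - u'" n "v - v'"]
  by (simp add: fil_cong_def free_algebra_closed add_diff_add)

lemma fil_cong_mult_left: "a \<in> A \<Longrightarrow> v \<doteq> v' \<Longrightarrow> a * v \<doteq> a * v'"
  using fil_ideal_closed(4)[of "v - v'" n a]
  by (simp add: fil_cong_def free_algebra_closed right_diff_distrib)

lemma fil_cong_mult_right: "u \<doteq> u' \<Longrightarrow> a \<in> A \<Longrightarrow> u * a \<doteq> u' * a"
  using fil_ideal_closed(5)[of "u - u'" n a]
  by (simp add: fil_cong_def free_algebra_closed left_diff_distrib)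

lemma fa_act_cong: "u \<doteq> v \<Longrightarrow> fa_act n u g = fa_act n v g"
  using fa_act_fil_ideal[of "u - v" n g] by (simp add: fil_cong_def fa_act_diff_left)

lemma fil_cong_relations:
  assumes "a \<in> fil_space n" "b \<in> fil_space n"
  shows "fa_gen (a + b) \<doteq> fa_gen a + fa_gen b"
    and "fa_gen (fil_scale r a) \<doteq> fa_const r * fa_gen a"
    and "fa_gen a * fa_gen b \<doteq> fa_gen b * fa_gen a + fa_gen (fil_bracket n a b)"
proof -
  note closed = free_algebra_closed fa_gen_closed fa_const_closed
  have space: "a + b \<in> fil_space n" "fil_scale r a \<in> fil_space n" "fil_bracket n a b \<in> fil_space n"
    using assms by (auto simp: fil_space_closed fil.br_closed)
  have "fa_gen (a + b) - fa_gen a - fa_gen b \<in> fil_ideal n"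
    "fa_gen (fil_scale r a) - fa_const r * fa_gen a \<in> fil_ideal n"
    "fa_gen a * fa_gen b - fa_gen b * fa_gen a - fa_gen (fil_bracket n a b) \<in> fil_ideal n"
    by (rule subsetD[OF fil_relations_in_ideal], use assms in \<open>unfold uea_relations_def, blast\<close>)+
  with assms space show "fa_gen (a + b) \<doteq> fa_gen a + fa_gen b"
    "fa_gen (fil_scale r a) \<doteq> fa_const r * fa_gen a"
    "fa_gen a * fa_gen b \<doteq> fa_gen b * fa_gen a + fa_gen (fil_bracket n a b)"
    by (simp_all add: fil_cong_def closed diff_diff_eq)
qed

lemma fil_cong_gen_0: "fa_gen 0 \<doteq> 0"
proof -
  have "fil_scale 0 (fil_vec Bx) = 0"
    by (rule poly_mapping_eqI) simp
  then show ?thesis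
    using fil_cong_relations(2)[OF fil_vec_in_space(1) fil_vec_in_space(1), of 0]
    by (simp add: fa_const_simps)
qed

private abbreviation (input) xg :: "('k, 'k fil) free_alg" where "xg \<equiv> fa_gen (fil_vec Bx)"
private abbreviation (input) yg :: "nat \<Rightarrow> ('k, 'k fil) free_alg" where "yg i \<equiv> fa_gen (fil_vec (By i))"

lemma fil_gens_closed: "xg \<in> A" "i \<le> n \<Longrightarrow> yg i \<in> A"
  by (simp_all add: fa_gen_closed fil_vec_in_space)

lemma fil_cong_y_commute:
  assumes "i \<le> n" "j \<le> n"
  shows "yg i * yg j \<doteq> yg j * yg i"
proof -
  have "fil_bracket n (fil_vec (By i)) (fil_vec (By j)) = (0 :: 'k fil)"
    by (rule poly_mapping_eqI)
       (simp add: lookup_fil_bracket fil_vec_def lookup_single split: fil_basis.split)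
  then have "yg i * yg j \<doteq> yg j * yg i + fa_gen 0"
    using fil_cong_relations(3)[of "fil_vec (By i)" "fil_vec (By j)"] assms
    by (simp add: fil_vec_in_space)
  also have "yg j * yg i + fa_gen 0 \<doteq> yg j * yg i + 0"
    by (intro fil_cong_add fil_cong_refl fil_cong_gen_0 free_algebra_closed fil_gens_closed assms)
  finally show ?thesis by simp
qed

lemma fil_cong_x_y:
  assumes "j \<le> n"
  shows "xg * yg j \<doteq> yg j * xg + (if j = 0 then 0 else yg (j - 1))"
proof -
  have br: "fil_bracket n (fil_vec Bx) (fil_vec (By j)) = (if j = 0 then 0 else fil_vec (By (j - 1)))"
    using assms by (intro poly_mapping_eqI)
       (auto simp: lookup_fil_bracket fil_vec_def lookup_single when_def split: fil_basis.split)
  have "xg * yg j \<doteq> yg j * xg + fa_gen (if j = 0 then 0 else fil_vec (By (j - 1)))"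
    using fil_cong_relations(3)[of "fil_vec Bx" "fil_vec (By j)"] assms
    by (simp only: br fil_vec_in_space)
  also have "\<dots> \<doteq> yg j * xg + (if j = 0 then 0 else yg (j - 1))"
  proof (rule fil_cong_add)
    show "yg j * xg \<doteq> yg j * xg"
      by (intro fil_cong_refl free_algebra_closed fil_gens_closed assms)
    show "fa_gen (if j = 0 then 0 else fil_vec (By (j - 1))) \<doteq> (if j = 0 then 0 else yg (j - 1))"
      using assms by (simp add: fil_cong_gen_0 fil_cong_refl fil_gens_closed)
  qed
  finally show ?thesis .
qed

text \<open>The ordered monomials \<open>y\<^sub>0\<^bsup>e 0\<^esup> \<cdots> y\<^sub>n\<^bsup>e n\<^esup> x\<^bsup>e (n + 1)\<^esup>\<close>. Their linear combinations are indexed by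
  polynomials, \<open>yvar (n + 1)\<close> standing for \<open>x\<close>.\<close>

definition ymon :: "(nat \<Rightarrow> nat) \<Rightarrow> ('k, 'k fil) free_alg"
  where "ymon e = prod_list (map (\<lambda>i. yg i ^ e i) [0..<Suc n])"

definition ordered :: "'k ypoly \<Rightarrow> ('k, 'k fil) free_alg"
  where "ordered f = (\<Sum>m\<in>Poly_Mapping.keys f. fa_const (Poly_Mapping.lookup f m) *
    (ymon (Poly_Mapping.lookup m) * xg ^ Poly_Mapping.lookup m (Suc n)))"

lemma ymon_closed: "ymon e \<in> A"
  unfolding ymon_def
  by (rule free_algebra_prod_list_closed) (auto intro!: free_algebra_power_closed fil_gens_closed)

lemma ordered_closed: "ordered f \<in> A"
  unfolding ordered_def
  by (intro free_algebra_sum_closed free_algebra_closed fa_const_closed ymon_closed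
      free_algebra_power_closed fil_gens_closed)

lemma ordered_superset:
  assumes "finite B" "Poly_Mapping.keys f \<subseteq> B"
  shows "ordered f = (\<Sum>m\<in>B. fa_const (Poly_Mapping.lookup f m) *
    (ymon (Poly_Mapping.lookup m) * xg ^ Poly_Mapping.lookup m (Suc n)))"
  unfolding ordered_def
  by (rule sum.mono_neutral_left) (use assms in \<open>auto simp: in_keys_iff fa_const_simps\<close>)

lemma ordered_add: "ordered (f + g) = ordered f + ordered g"
proof -
  let ?B = "Poly_Mapping.keys f \<union> Poly_Mapping.keys g"
  have "Poly_Mapping.keys (f + g) \<subseteq> ?B" by (rule keys_add)
  then show ?thesis
    by (simp add: ordered_superset[of ?B] lookup_add fa_const_simps distrib_right sum.distrib)
qed

lemma ordered_single:
  "ordered (Poly_Mapping.single m c) = fa_const c * (ymon (Poly_Mapping.lookup m) * xg ^ Poly_Mapping.lookup m (Suc n))"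
  by (subst ordered_superset[of "{m}"]) auto

lemma ymon_cong: "(\<And>i. i \<le> n \<Longrightarrow> e i = e' i) \<Longrightarrow> ymon e = ymon e'"
  unfolding ymon_def by (intro arg_cong[where f = prod_list] map_cong) auto

text \<open>An equality already in the free algebra, because x is the last factor of an ordered
  monomial.\<close>

lemma ordered_mult_x: "ordered f * xg = ordered (f * yvar (Suc n))"
proof (induction f rule: poly_mapping_additive_induct)
  case (single m c)
  have "ymon (Poly_Mapping.lookup (m + Poly_Mapping.single (Suc n) 1)) = ymon (Poly_Mapping.lookup m)"
    by (rule ymon_cong) (simp add: lookup_add lookup_single)
  then show ?case
    by (simp add: yvar_def mult_single ordered_single lookup_add mult.assoc power_add power_commutes
        del: One_nat_def)
qed (simp add: distrib_right ordered_add)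

lemma y_list_commute:
  assumes "set is \<subseteq> {..n}" "j \<le> n"
  shows "prod_list (map (\<lambda>i. yg i ^ e i) is) * yg j \<doteq> yg j * prod_list (map (\<lambda>i. yg i ^ e i) is)"
  using assms(1)
proof (induction "is")
  case Nil
  then show ?case using assms(2) by (simp add: fil_cong_refl fil_gens_closed)
next
  case (Cons i "is")
  have closed: "prod_list (map (\<lambda>i. yg i ^ e i) is) \<in> A" "yg i \<in> A" "yg j \<in> A" "yg i ^ k \<in> A" for k
    using Cons.prems assms(2)
    by (auto intro!: free_algebra_prod_list_closed free_algebra_power_closed fil_gens_closed)
  have pow: "yg i ^ k * yg j \<doteq> yg j * yg i ^ k" for k
  proof (induction k)
    case 0
    then show ?case by (simp add: fil_cong_refl closed)
  next
    case (Suc k)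
    have "yg i * (yg i ^ k * yg j) \<doteq> yg i * (yg j * yg i ^ k)"
      by (intro fil_cong_mult_left closed Suc)
    also have "yg i * (yg j * yg i ^ k) = (yg i * yg j) * yg i ^ k" by (simp add: mult.assoc)
    also have "\<dots> \<doteq> (yg j * yg i) * yg i ^ k"
      using Cons.prems assms(2) by (intro fil_cong_mult_right closed fil_cong_y_commute) auto
    finally show ?case by (simp add: mult.assoc)
  qed
  let ?P = "prod_list (map (\<lambda>i. yg i ^ e i) is)"
  have "yg i ^ e i * (?P * yg j) \<doteq> yg i ^ e i * (yg j * ?P)"
    by (intro fil_cong_mult_left closed Cons.IH) (use Cons.prems in auto)
  also have "yg i ^ e i * (yg j * ?P) = (yg i ^ e i * yg j) * ?P" by (simp add: mult.assoc)
  also have "\<dots> \<doteq> (yg j * yg i ^ e i) * ?P"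
    by (intro fil_cong_mult_right closed pow)
  finally show ?case by (simp add: mult.assoc)
qed

lemma ymon_mult_y:
  assumes "j \<le> n"
  shows "ymon e * yg j \<doteq> ymon (e(j := Suc (e j)))"
proof -
  have split: "[0..<Suc n] = [0..<j] @ j # [Suc j..<Suc n]"
    using assms by (metis le_imp_less_Suc upt_add_eq_append upt_conv_Cons less_imp_le_nat le_add_diff_inverse zero_le)
  let ?P = "\<lambda>e is. prod_list (map (\<lambda>i. yg i ^ e i) is)"
  let ?e' = "e(j := Suc (e j))"
  have closed: "?P e [0..<j] \<in> A" "yg j ^ k \<in> A" "?P e [Suc j..<Suc n] \<in> A" for k
    using assms
    by (auto intro!: free_algebra_prod_list_closed free_algebra_power_closed fil_gens_closed simp del: upt_Suc)
  have "ymon e * yg j = (?P e [0..<j] * yg j ^ e j) * (?P e [Suc j..<Suc n] * yg j)"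
    unfolding ymon_def split by (simp add: mult.assoc)
  also have "\<dots> \<doteq> (?P e [0..<j] * yg j ^ e j) * (yg j * ?P e [Suc j..<Suc n])"
    by (intro fil_cong_mult_left free_algebra_closed closed y_list_commute assms) auto
  also have "\<dots> = ?P e [0..<j] * (yg j ^ Suc (e j) * ?P e [Suc j..<Suc n])"
    by (simp only: power_Suc2 mult.assoc)
  also have "?P e [0..<j] = ?P ?e' [0..<j]"
    by (intro arg_cong[where f = prod_list] map_cong) auto
  also have "?P e [Suc j..<Suc n] = ?P ?e' [Suc j..<Suc n]"
    by (intro arg_cong[where f = prod_list] map_cong) auto
  also have "?P ?e' [0..<j] * (yg j ^ Suc (e j) * ?P ?e' [Suc j..<Suc n]) = ymon ?e'"
    unfolding ymon_def split by simp
  finally show ?thesis .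
qed

section \<open>Spanning half of the Poincare-Birkhoff-Witt theorem\<close>

definition normalizable :: "('k, 'k fil) free_alg \<Rightarrow> bool"
  where "normalizable u \<longleftrightarrow> (\<exists>f\<in>yvars (Suc n). u \<doteq> ordered f)"

lemma normalizable_cong: "u \<doteq> v \<Longrightarrow> normalizable v \<Longrightarrow> normalizable u"
  unfolding normalizable_def using fil_cong_trans by blast

lemma normalizable_add: "normalizable u \<Longrightarrow> normalizable v \<Longrightarrow> normalizable (u + v)"
  unfolding normalizable_def using fil_cong_add ordered_add yvars_add by metis

lemma normalizable_0: "normalizable 0"
  unfolding normalizable_def
  by (rule bexI[of _ 0]) (simp_all add: ordered_def fil_cong_refl free_algebra_closed yvars_0)

lemma normalizable_sum: "(\<And>i. i \<in> B \<Longrightarrow> normalizable (u i)) \<Longrightarrow> normalizable (\<Sum>i\<in>B. u i)"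
  by (induction B rule: infinite_finite_induct) (simp_all add: normalizable_0 normalizable_add)

lemma normalizable_monomial: "normalizable (fa_const c * (ymon e * xg ^ k))"
proof -
  let ?m = "(\<Sum>i\<le>n. Poly_Mapping.single i (e i)) + Poly_Mapping.single (Suc n) k"
  have l: "Poly_Mapping.lookup ?m i = (if i \<le> n then e i else if i = Suc n then k else 0)" for i
    by (auto simp: lookup_add lookup_sum lookup_single when_def sum.delta')
  have "ordered (Poly_Mapping.single ?m c) = fa_const c * (ymon e * xg ^ k)"
    unfolding ordered_single l by (simp cong: ymon_cong)
  moreover have "Poly_Mapping.single ?m c \<in> yvars (Suc n)"
    by (auto simp: yvars_def in_keys_iff l split: if_splits)
  ultimately show ?thesis unfolding normalizable_def using fil_cong_refl ordered_closed by metis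
qed

lemma fil_cong_const_mult: "u \<doteq> v \<Longrightarrow> fa_const c * u \<doteq> fa_const c * v"
  by (rule fil_cong_mult_left[OF fa_const_closed])

lemma ordered_const_mult: "fa_const c * ordered f = ordered (yconst c * f)"
proof (induction f rule: poly_mapping_additive_induct)
  case (single m d)
  then show ?case by (simp add: ordered_single yconst_def mult_single fa_const_simps mult.assoc)
qed (simp add: distrib_left ordered_add)

lemma normalizable_const_mult: "normalizable u \<Longrightarrow> normalizable (fa_const c * u)"
  unfolding normalizable_def
  using fil_cong_const_mult ordered_const_mult yvars_mult yvars_yconst by metis

lemma normalizable_mult_x: "normalizable u \<Longrightarrow> normalizable (u * xg)"
  unfolding normalizable_def
  using fil_cong_mult_right[OF _ fil_gens_closed(1)] ordered_mult_x yvars_mult yvars_yvar order_refl by metis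

text \<open>Moving y_j to the left past one x leaves y_j x and a correction y_(j-1). In both terms
  only k factors x remain to be passed; the index is generalized because the correction lowers
  it.\<close>

lemma normalizable_monomial_mult_y:
  "j \<le> n \<Longrightarrow> normalizable (fa_const c * (ymon e * xg ^ k) * yg j)"
proof (induction k arbitrary: j)
  case 0
  then have "fa_const c * (ymon e * xg ^ 0) * yg j \<doteq> fa_const c * (ymon (e(j := Suc (e j))) * xg ^ 0)"
    using fil_cong_const_mult[OF ymon_mult_y[OF 0]] by (simp add: mult.assoc)
  then show ?case using normalizable_cong normalizable_monomial by blast
next
  case (Suc k)
  let ?u = "fa_const c * (ymon e * xg ^ k)"
  let ?y = "if j = 0 then 0 else yg (j - 1)"
  have u: "?u \<in> A"
    by (intro free_algebra_closed fa_const_closed ymon_closed free_algebra_power_closed fil_gens_closed)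
  have "fa_const c * (ymon e * xg ^ Suc k) * yg j = ?u * (xg * yg j)"
    by (simp only: power_Suc2 mult.assoc)
  also have "\<dots> \<doteq> ?u * (yg j * xg + ?y)"
    by (rule fil_cong_mult_left[OF u fil_cong_x_y[OF Suc.prems]])
  finally have "fa_const c * (ymon e * xg ^ Suc k) * yg j \<doteq> ?u * yg j * xg + ?u * ?y"
    by (simp only: distrib_left mult.assoc)
  moreover have "normalizable (?u * yg j * xg)"
    by (rule normalizable_mult_x[OF Suc.IH[OF Suc.prems]])
  moreover have "normalizable (?u * ?y)"
    using Suc.IH[of "j - 1"] Suc.prems by (auto simp: normalizable_0)
  ultimately show ?case by (blast intro: normalizable_cong normalizable_add)
qed

lemma normalizable_mult_y:
  assumes "normalizable u" "j \<le> n"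
  shows "normalizable (u * yg j)"
proof -
  from assms obtain f where f: "u \<doteq> ordered f" unfolding normalizable_def by blast
  have "normalizable (ordered f * yg j)"
    unfolding ordered_def sum_distrib_right
    by (intro normalizable_sum normalizable_monomial_mult_y assms)
  then show ?thesis
    using normalizable_cong fil_cong_mult_right[OF f fil_gens_closed(2)[OF assms(2)]] by blast
qed

lemma fil_space_basis:
  assumes "v \<in> fil_space n"
  shows "v = fil_scale (Poly_Mapping.lookup v Bx) (fil_vec Bx)
    + (\<Sum>i\<le>n. fil_scale (Poly_Mapping.lookup v (By i)) (fil_vec (By i)))"
proof (rule poly_mapping_eqI)
  fix b
  show "Poly_Mapping.lookup v b = Poly_Mapping.lookup (fil_scale (Poly_Mapping.lookup v Bx) (fil_vec Bx)
    + (\<Sum>i\<le>n. fil_scale (Poly_Mapping.lookup v (By i)) (fil_vec (By i)))) b"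
  proof (cases b)
    case Bx
    then show ?thesis by (simp add: lookup_add lookup_sum fil_vec_def lookup_single)
  next
    case (By j)
    have "Poly_Mapping.lookup v (By j) = 0" if "j > n"
      using assms that by (auto simp: fil_space_def in_keys_iff subset_iff)
    then show ?thesis
      using By by (auto simp: lookup_add lookup_sum fil_vec_def lookup_single when_def if_distrib cong: if_cong)
  qed
qed

lemma fil_cong_gen_sum:
  assumes "finite B" "\<And>i. i \<in> B \<Longrightarrow> v i \<in> fil_space n"
  shows "(\<Sum>i\<in>B. v i) \<in> fil_space n \<and> fa_gen (\<Sum>i\<in>B. v i) \<doteq> (\<Sum>i\<in>B. fa_gen (v i))"
  using assms
proof (induction B)
  case empty
  then show ?case by (simp add: fil_cong_gen_0 fil_space_closed)
next
  case (insert b B)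
  then have IH: "sum v B \<in> fil_space n" "fa_gen (sum v B) \<doteq> (\<Sum>i\<in>B. fa_gen (v i))" and b: "v b \<in> fil_space n"
    by auto
  have "fa_gen (v b + sum v B) \<doteq> fa_gen (v b) + fa_gen (sum v B)"
    by (rule fil_cong_relations[OF b IH(1)])
  also have "\<dots> \<doteq> fa_gen (v b) + (\<Sum>i\<in>B. fa_gen (v i))"
    by (intro fil_cong_add fil_cong_refl IH fa_gen_closed b)
  finally have "fa_gen (v b + sum v B) \<doteq> fa_gen (v b) + (\<Sum>i\<in>B. fa_gen (v i))" .
  moreover have "v b + sum v B \<in> fil_space n"
    by (rule fil_space_closed(1)[OF b IH(1)])
  ultimately show ?case using insert.hyps by simp
qed

lemma fil_cong_sum:
  "(\<And>i. i \<in> B \<Longrightarrow> u i \<doteq> v i) \<Longrightarrow> (\<Sum>i\<in>B. u i) \<doteq> (\<Sum>i\<in>B. v i)"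
  by (induction B rule: infinite_finite_induct)
     (simp_all add: fil_cong_refl free_algebra_closed fil_cong_add)

text \<open>Every vector of g is a free generator of its own, so even linearity holds only modulo
  the ideal. This reduces an arbitrary letter to x and the y_i.\<close>

lemma fil_cong_gen_basis:
  assumes "v \<in> fil_space n"
  shows "fa_gen v \<doteq> fa_const (Poly_Mapping.lookup v Bx) * xg
    + (\<Sum>i\<le>n. fa_const (Poly_Mapping.lookup v (By i)) * yg i)"
proof -
  let ?s = "\<lambda>i. fil_scale (Poly_Mapping.lookup v (By i)) (fil_vec (By i))"
  let ?x = "fil_scale (Poly_Mapping.lookup v Bx) (fil_vec Bx)"
  have s: "(\<Sum>i\<le>n. ?s i) \<in> fil_space n \<and> fa_gen (\<Sum>i\<le>n. ?s i) \<doteq> (\<Sum>i\<le>n. fa_gen (?s i))"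
    by (rule fil_cong_gen_sum) (auto intro!: fil_space_closed fil_vec_in_space)
  have "fa_gen v = fa_gen (?x + (\<Sum>i\<le>n. ?s i))"
    using fil_space_basis[OF assms] by simp
  also have "\<dots> \<doteq> fa_gen ?x + fa_gen (\<Sum>i\<le>n. ?s i)"
    using s by (intro fil_cong_relations(1)) (auto intro!: fil_space_closed fil_vec_in_space)
  also have "\<dots> \<doteq> fa_const (Poly_Mapping.lookup v Bx) * xg + (\<Sum>i\<le>n. fa_gen (?s i))"
    using s by (intro fil_cong_add fil_cong_relations(2)) (auto intro!: fil_vec_in_space)
  also have "\<dots> \<doteq> fa_const (Poly_Mapping.lookup v Bx) * xg
      + (\<Sum>i\<le>n. fa_const (Poly_Mapping.lookup v (By i)) * yg i)"
    by (intro fil_cong_add fil_cong_refl fil_cong_sum fil_cong_relations(2) free_algebra_closed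
        fa_const_closed fil_gens_closed) (auto intro!: fil_vec_in_space)
  finally show ?thesis .
qed

lemma normalizable_mult_gen:
  assumes "u \<in> A" "normalizable u" "v \<in> fil_space n"
  shows "normalizable (u * fa_gen v)"
proof -
  have const: "u * (fa_const c * w) = fa_const c * (u * w)" for c and w :: "('k, 'k fil) free_alg"
    by (metis fa_const_commute mult.assoc)
  have "normalizable (u * (fa_const (Poly_Mapping.lookup v Bx) * xg
      + (\<Sum>i\<le>n. fa_const (Poly_Mapping.lookup v (By i)) * yg i)))"
    unfolding distrib_left sum_distrib_left const
    by (intro normalizable_add normalizable_sum normalizable_const_mult normalizable_mult_x
        normalizable_mult_y assms) auto
  then show ?thesis
    using normalizable_cong fil_cong_mult_left[OF assms(1) fil_cong_gen_basis[OF assms(3)]] by blast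
qed

lemma normalizable_carrier:
  assumes "u \<in> A"
  shows "normalizable u"
proof -
  have word: "normalizable (Poly_Mapping.single (Word vs) (1 :: 'k)) \<and> Poly_Mapping.single (Word vs) (1 :: 'k) \<in> A"
    if "set vs \<subseteq> fil_space n" for vs
    using that
  proof (induction vs rule: rev_induct)
    case Nil
    have "ymon (\<lambda>_. 0) = 1" unfolding ymon_def by (simp add: map_replicate_const)
    then show ?case
      using normalizable_monomial[of 1 "\<lambda>_. 0" 0]
      by (simp add: fa_const_simps free_algebra_closed flip: zero_free_word_def)
  next
    case (snoc v vs)
    have "Poly_Mapping.single (Word (vs @ [v])) (1 :: 'k) = Poly_Mapping.single (Word vs) (1 :: 'k) * fa_gen v"
      by (simp add: fa_gen_def mult_single plus_free_word_def)
    with snoc show ?case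
      by (auto intro!: normalizable_mult_gen free_algebra_closed fa_gen_closed)
  qed
  have "u = (\<Sum>w\<in>Poly_Mapping.keys u. fa_const (Poly_Mapping.lookup u w) * Poly_Mapping.single w (1 :: 'k))"
    by (subst poly_mapping_sum_singles[of u, symmetric], rule sum.cong)
       (simp_all add: fa_const_def mult_single)
  moreover have "normalizable (\<Sum>w\<in>Poly_Mapping.keys u. fa_const (Poly_Mapping.lookup u w) * Poly_Mapping.single w (1 :: 'k))"
  proof (intro normalizable_sum normalizable_const_mult)
    fix w assume "w \<in> Poly_Mapping.keys u"
    with assms have "set (letters w) \<subseteq> fil_space n" by (simp add: free_algebra_def)
    then show "normalizable (Poly_Mapping.single w (1 :: 'k))" using word[of "letters w"] by simp
  qed
  ultimately show ?thesis by simp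
qed

section \<open>The action on polynomials is faithful\<close>

lemma fa_act_x: "fa_act n xg g = xop n g"
  by (simp add: fa_act_gen fil_act_x)

lemma fa_act_y: "i \<le> n \<Longrightarrow> fa_act n (yg i) g = yvar i * g"
  by (simp add: fa_act_gen fil_act_y)

lemma fa_act_y_power: "i \<le> n \<Longrightarrow> fa_act n (yg i ^ k) g = yvar i ^ k * g"
  by (induction k) (simp_all add: fa_act_1 fa_act_mult fa_act_y mult.assoc)

lemma fa_act_x_power: "fa_act n (xg ^ k) g = (xop n ^^ k) g"
  by (induction k) (simp_all add: fa_act_1 fa_act_mult fa_act_x)

lemma fa_act_ymon: "fa_act n (ymon e) g = (\<Prod>i\<le>n. yvar i ^ e i) * (g :: 'k ypoly)"
proof -
  have list: "fa_act n (prod_list (map (\<lambda>i. yg i ^ e i) is)) g = prod_list (map (\<lambda>i. yvar i ^ e i) is) * g"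
    if "set is \<subseteq> {..n}" for "is"
    using that by (induction "is") (simp_all add: fa_act_1 fa_act_mult fa_act_y_power mult.assoc)
  have "fa_act n (ymon e) g = prod_list (map (\<lambda>i. yvar i ^ e i) [0..<Suc n]) * g"
    unfolding ymon_def by (rule list) auto
  also have "prod_list (map (\<lambda>i. yvar i ^ e i :: 'k ypoly) [0..<Suc n]) = (\<Prod>i\<le>n. yvar i ^ e i)"
    by (subst prod.distinct_set_conv_list[symmetric])
       (auto simp: atLeast0LessThan lessThan_Suc_atMost simp del: upt_Suc)
  finally show ?thesis .
qed

lemma fa_act_ordered:
  "fa_act n (ordered f) g = (\<Sum>m\<in>Poly_Mapping.keys f. yconst (Poly_Mapping.lookup f m) *
    ((\<Prod>i\<le>n. yvar i ^ Poly_Mapping.lookup m i) * (xop n ^^ Poly_Mapping.lookup m (Suc n)) (g :: 'k ypoly)))"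
  unfolding ordered_def
  by (simp add: fa_act_sum_left fa_act_mult fa_act_const fa_act_ymon fa_act_x_power)

text \<open>On 1 the factor x^k produces t^k and the y_i then multiply, so evaluation at 1 reads off
  the coefficients of a normal form. This is the independence half of the Poincare-Birkhoff-Witt
  theorem.\<close>

lemma fa_act_ordered_1:
  assumes "f \<in> yvars (Suc n)"
  shows "fa_act n (ordered f) 1 = (f :: 'k ypoly)"
  by (subst (2) ypoly_eq_sum_prod[OF assms]) (simp add: fa_act_ordered xop_funpow_1)

lemma fil_cong_ordered:
  assumes "u \<in> A"
  shows "fa_act n u 1 \<in> yvars (Suc n)" "u \<doteq> ordered (fa_act n u 1)"
proof -
  from normalizable_carrier[OF assms] obtain f where f: "f \<in> yvars (Suc n)" "u \<doteq> ordered f"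
    unfolding normalizable_def by blast
  have "fa_act n u 1 = f"
    using fa_act_cong[OF f(2)] fa_act_ordered_1[OF f(1)] by simp
  with f show "fa_act n u 1 \<in> yvars (Suc n)" "u \<doteq> ordered (fa_act n u 1)" by simp_all
qed

text \<open>Stronger than faithfulness: the value at 1 determines the normal form and with it the
  class.\<close>

lemma fil_cong_iff:
  assumes "u \<in> A" "v \<in> A"
  shows "u \<doteq> v \<longleftrightarrow> fa_act n u 1 = fa_act n v 1"
proof
  show "u \<doteq> v \<Longrightarrow> fa_act n u 1 = fa_act n v 1" by (rule fa_act_cong)
  assume "fa_act n u 1 = fa_act n v 1"
  then show "u \<doteq> v"
    using fil_cong_ordered(2)[OF assms(1)] fil_cong_ordered(2)[OF assms(2)]
    by (metis fil_cong_sym fil_cong_trans)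
qed

lemma fa_act_ordered_yvar_1:
  assumes "f \<in> yvars (Suc n)" "1 \<le> n"
  shows "fa_act n (ordered f) (yvar 1) = yvar 1 * f + yvar 0 * ypderiv (Suc n) (f :: 'k ypoly)"
proof -
  have d: "derivation (ypderiv (Suc n) :: 'k ypoly \<Rightarrow> 'k ypoly)" by (rule derivation_ypderiv)
  let ?P = "\<lambda>m. \<Prod>i\<le>n. yvar i ^ Poly_Mapping.lookup m i :: 'k ypoly"
  let ?t = "yvar (Suc n) :: 'k ypoly" and ?k = "\<lambda>m. Poly_Mapping.lookup m (Suc n)"
  have P: "ypderiv (Suc n) (?P m) = 0" for m
    by (rule derivation_prod_eq_0[OF d]) (simp add: derivation_power[OF d])
  have f: "f = (\<Sum>m\<in>Poly_Mapping.keys f. yconst (Poly_Mapping.lookup f m) * (?P m * ?t ^ ?k m))"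
    by (subst ypoly_eq_sum_prod[OF assms(1)]) simp
  have "ypderiv (Suc n) f = ypderiv (Suc n) (\<Sum>m\<in>Poly_Mapping.keys f. yconst (Poly_Mapping.lookup f m) * (?P m * ?t ^ ?k m))"
    by (rule arg_cong[OF f])
  also have "\<dots> = (\<Sum>m\<in>Poly_Mapping.keys f. yconst (Poly_Mapping.lookup f m)
      * (?P m * (of_nat (?k m) * ?t ^ (?k m - 1))))"
    by (simp add: derivation_sum[OF d] derivation_mult[OF d] P derivation_power[OF d])
  finally have df: "ypderiv (Suc n) f = \<dots>" .
  have "yvar 1 * f = (\<Sum>m\<in>Poly_Mapping.keys f. yvar 1 * (yconst (Poly_Mapping.lookup f m) * (?P m * ?t ^ ?k m)))"
    by (subst f) (rule sum_distrib_left)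
  then show ?thesis
    unfolding fa_act_ordered xop_funpow_yvar_1[OF assms(2)] df
    by (simp add: sum_distrib_left sum.distrib[symmetric] algebra_simps)
qed

section \<open>The center\<close>

context
  fixes p :: nat
  assumes p: "Factorial_Ring.prime p" "CHAR('k) = p" "n + 1 \<le> p"
begin

text \<open>A vanishing t-derivative leaves x only in exponents divisible by p, and x^p acts as
  multiplication by t^p.\<close>

lemma fa_act_ordered_kernel:
  assumes "c \<in> fil_kernel n"
  shows "fa_act n (ordered c) g = c * (g :: 'k ypoly)"
proof -
  have c: "c \<in> yvars (Suc n)" "ypderiv (Suc n) c = 0" using assms by (simp_all add: fil_kernel_def)
  have "(xop n ^^ Poly_Mapping.lookup m (Suc n)) g = yvar (Suc n) ^ Poly_Mapping.lookup m (Suc n) * g"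
    if "m \<in> Poly_Mapping.keys c" for m
    using CHAR_dvd_exponent[OF c(2) that] xop_funpow_CHAR[OF p] p(2) by (metis dvdE)
  then have "fa_act n (ordered c) g = (\<Sum>m\<in>Poly_Mapping.keys c. yconst (Poly_Mapping.lookup c m) *
    (\<Prod>i\<le>Suc n. yvar i ^ Poly_Mapping.lookup m i)) * g"
    unfolding fa_act_ordered sum_distrib_right by (simp add: mult.assoc)
  also have "\<dots> = c * g"
    using ypoly_eq_sum_prod[OF c(1)] by simp
  finally show ?thesis .
qed

lemma central_iff_kernel:
  assumes u: "u \<in> A" and n: "1 \<le> n"
  shows "(\<forall>v\<in>A. u * v \<doteq> v * u) \<longleftrightarrow> fa_act n u 1 \<in> fil_kernel n"
proof
  let ?c = "fa_act n u 1"
  note c = fil_cong_ordered[OF u]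
  {
    assume comm: "\<forall>v\<in>A. u * v \<doteq> v * u"
    \<comment> \<open>Multiplying by x on the right appends a factor t to the normal form, on the
      left it applies D + t. Equating the two leaves D c = 0.\<close>
    have "fa_act n (u * xg) 1 = fa_act n (ordered ?c * xg) 1"
      by (rule fa_act_cong[OF fil_cong_mult_right[OF c(2) fil_gens_closed(1)]])
    also have "\<dots> = ?c * yvar (Suc n)"
      unfolding ordered_mult_x by (rule fa_act_ordered_1) (intro yvars_mult c yvars_yvar order_refl)
    finally have "?c * yvar (Suc n) = fa_act n (xg * u) 1"
      using comm fil_gens_closed(1) fa_act_cong by metis
    also have "\<dots> = fil_der n ?c + yvar (Suc n) * ?c"
      by (simp add: fa_act_mult fa_act_x xop_def)
    finally have 1: "fil_der n ?c = 0" by (simp add: mult.commute)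
    \<comment> \<open>Multiplying by y_1 on the left gives y_1 c, on the right y_1 c plus y_0 times
      the t-derivative of c; y_0 is not a zero divisor.\<close>
    have "yvar 1 * ?c = fa_act n (yg 1 * u) 1"
      using n by (simp add: fa_act_mult fa_act_y)
    also have "\<dots> = fa_act n (u * yg 1) 1"
      using comm fil_gens_closed(2)[OF n] fa_act_cong by metis
    also have "\<dots> = fa_act n u (yvar 1)"
      using n by (simp add: fa_act_mult fa_act_y)
    also have "\<dots> = yvar 1 * ?c + yvar 0 * ypderiv (Suc n) ?c"
      unfolding fa_act_cong[OF c(2), of "yvar 1"] by (rule fa_act_ordered_yvar_1[OF c(1) n])
    finally have "yvar 0 * ypderiv (Suc n) ?c = 0" by (simp only: add_cancel_right_right)
    then show "?c \<in> fil_kernel n" using 1 c(1) by (simp add: fil_kernel_def)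
  }
  assume ker: "?c \<in> fil_kernel n"
  show "\<forall>v\<in>A. u * v \<doteq> v * u"
  proof
    fix v assume v: "v \<in> A"
    \<comment> \<open>At 1 both products give c times the value of v: u acts as multiplication by c,
      and the action of v is linear over constants.\<close>
    have "fil_der n ?c = 0" using ker by (simp add: fil_kernel_def)
    then have vu: "fa_act n v ?c = ?c * fa_act n v 1"
      using fa_act_mult_kernel[of n ?c v 1] by (simp only: mult_1_right)
    have uv: "fa_act n u g = ?c * g" for g
      using fa_act_cong[OF c(2), of g] fa_act_ordered_kernel[OF ker, of g] by (rule trans)
    have "fa_act n (u * v) 1 = fa_act n (v * u) 1"
      unfolding fa_act_mult vu by (rule uv)
    then show "u * v \<doteq> v * u"
      using u v by (subst fil_cong_iff) (simp_all add: free_algebra_closed)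
  qed
qed

end

end

section \<open>Inverting \<open>y\<^sub>0\<close>\<close>

lemma fil_der_sum_yvar_1:
  assumes "1 \<le> n" "\<And>j. fil_der n (a j) = 0"
  shows "fil_der n (\<Sum>j<Suc q. a j * yvar 1 ^ j)
    = yvar 0 * (\<Sum>j<q. (of_nat (Suc j) * a (Suc j)) * yvar 1 ^ j)"
proof -
  have "fil_der n (\<Sum>j<Suc q. a j * yvar 1 ^ j) = (\<Sum>j<Suc q. a j * (of_nat j * yvar 1 ^ (j - 1) * yvar 0))"
    using assms by (simp add: derivation_sum[OF derivation_fil_der] derivation_mult[OF derivation_fil_der]
        derivation_power[OF derivation_fil_der] derivation_add[OF derivation_fil_der] fil_der_yvar)
  also have "\<dots> = (\<Sum>j<q. a (Suc j) * (of_nat (Suc j) * yvar 1 ^ j * yvar 0))"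
    by (subst sum.lessThan_Suc_shift) simp
  finally show ?thesis by (simp add: sum_distrib_left mult_ac)
qed

lemma of_nat_ypoly_eq_0_iff:
  "of_nat k = (0 :: 'r::comm_ring_1 ypoly) \<longleftrightarrow> CHAR('r) dvd k"
  by (simp add: of_nat_eq_0_iff_char_dvd CHAR_ypoly)

text \<open>Below degree \<open>p\<close>, the powers of \<open>y\<^sub>1\<close> are linearly independent over the kernel of the derivation,
  because \<open>y\<^sub>1\<close> is mapped to \<open>y\<^sub>0 \<noteq> 0\<close>.\<close>

lemma yvar_1_powers_independent:
  fixes a :: "nat \<Rightarrow> 'k::field ypoly"
  assumes "1 \<le> n" "\<And>j. fil_der n (a j) = 0" "q \<le> CHAR('k)" "(\<Sum>j<q. a j * yvar 1 ^ j) = 0" "j < q"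
  shows "a j = 0"
  using assms(2-)
proof (induction q arbitrary: a j)
  case (Suc q)
  \<comment> \<open>Differentiation lowers the degree, so the induction hypothesis applies to the
    coefficients (j + 1) a (j + 1); here j + 1 is below the characteristic and can be
    cancelled.\<close>
  have "yvar 0 * (\<Sum>j<q. (of_nat (Suc j) * a (Suc j)) * yvar 1 ^ j) = 0"
    using fil_der_sum_yvar_1[OF assms(1), of a q] Suc.prems(1,3) by (simp add: derivation_0[OF derivation_fil_der])
  then have 0: "(\<Sum>j<q. (of_nat (Suc j) * a (Suc j)) * yvar 1 ^ j) = 0" by simp
  have "fil_der n (of_nat (Suc j) * a (Suc j)) = 0" for j
    unfolding derivation_mult[OF derivation_fil_der] derivation_of_nat[OF derivation_fil_der]
    by (simp add: Suc.prems(1))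
  then have "of_nat (Suc j) * a (Suc j) = 0" if "j < q" for j
    using Suc.IH[of "\<lambda>j. of_nat (Suc j) * a (Suc j)", OF _ _ 0 that] Suc.prems(2) by simp
  moreover have "of_nat (Suc j) \<noteq> (0 :: 'k ypoly)" if "j < q" for j
    using that Suc.prems(2) unfolding of_nat_ypoly_eq_0_iff by (auto dest: dvd_imp_le)
  ultimately have S: "a (Suc j) = 0" if "j < q" for j
    using that by (metis mult_eq_0_iff)
  then have "(\<Sum>j<Suc q. a j * yvar 1 ^ j) = a 0"
    by (subst sum.lessThan_Suc_shift) simp
  with Suc.prems(3) have "a 0 = 0" by simp
  with S Suc.prems(4) show ?case by (cases j) auto
qed simp

text \<open>\<open>T\<close> will be the set of polynomials representing Z_p(g)[z_2, ..., z_n].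
  Listing its closure properties keeps the localization argument inside the polynomial ring.\<close>

context
  fixes n p :: nat and T :: "'k::field ypoly set"
  assumes n: "1 \<le> n" and p: "Factorial_Ring.prime p" "CHAR('k) = p" "n + 1 \<le> p"
    and T_add: "\<And>f g. f \<in> T \<Longrightarrow> g \<in> T \<Longrightarrow> f + g \<in> T"
    and T_mult: "\<And>f g. f \<in> T \<Longrightarrow> g \<in> T \<Longrightarrow> f * g \<in> T"
    and T_yconst: "\<And>c. yconst c \<in> T"
    and T_y0: "yvar 0 \<in> T" and T_y1: "yvar 1 ^ p \<in> T" and T_t: "yvar (Suc n) ^ p \<in> T"
    and T_z: "\<And>i. 2 \<le> i \<Longrightarrow> i \<le> n \<Longrightarrow> z_int i \<in> T"
    and T_der: "\<And>f. f \<in> T \<Longrightarrow> fil_der n f = 0"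
begin

text \<open>The ring T[y_1]: degrees below p suffice because y_1^p lies in \<open>T\<close>.\<close>

private definition W :: "'k ypoly set"
  where "W = {\<Sum>j<p. a j * yvar 1 ^ j | a. \<forall>j. a j \<in> T}"

text \<open>The polynomials in T[y_1, 1/y_0], described by clearing denominators instead of forming
  fractions.\<close>

private definition W_loc :: "'k ypoly set"
  where "W_loc = {f. \<exists>k. yvar 0 ^ k * f \<in> W}"

private lemma T_0: "0 \<in> T" and T_1: "1 \<in> T"
  using T_yconst[of 0] T_yconst[of 1] by simp_all

private lemma T_power: "f \<in> T \<Longrightarrow> f ^ k \<in> T"
  by (induction k) (simp_all add: T_1 T_mult)

private lemma T_sub_W: "f \<in> T \<Longrightarrow> f \<in> W"
proof -
  assume f: "f \<in> T"
  have "(\<Sum>j<p. (if j = 0 then f else 0) * yvar 1 ^ j) = (\<Sum>j<p. if j = 0 then f else 0)"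
    by (rule sum.cong) auto
  also have "\<dots> = f" using p by simp
  finally have "f = (\<Sum>j<p. (if j = 0 then f else 0) * yvar 1 ^ j)" by simp
  then show "f \<in> W" unfolding W_def using f T_0 by (auto intro!: exI[of _ "\<lambda>j. if j = 0 then f else 0"])
qed

private lemma W_add:
  assumes "f \<in> W" "g \<in> W"
  shows "f + g \<in> W"
proof -
  from assms obtain a b where "f = (\<Sum>j<p. a j * yvar 1 ^ j)" "\<forall>j. a j \<in> T"
    "g = (\<Sum>j<p. b j * yvar 1 ^ j)" "\<forall>j. b j \<in> T"
    unfolding W_def by blast
  then have "f + g = (\<Sum>j<p. (a j + b j) * yvar 1 ^ j)" "\<forall>j. a j + b j \<in> T"
    by (simp_all add: distrib_right sum.distrib T_add)
  then show ?thesis unfolding W_def by (auto intro!: exI[of _ "\<lambda>j. a j + b j"])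
qed

private lemma W_mult_T:
  assumes "c \<in> T" "f \<in> W"
  shows "c * f \<in> W"
proof -
  from assms obtain a where "f = (\<Sum>j<p. a j * yvar 1 ^ j)" "\<forall>j. a j \<in> T"
    unfolding W_def by blast
  with assms have "c * f = (\<Sum>j<p. (c * a j) * yvar 1 ^ j)" "\<forall>j. c * a j \<in> T"
    by (simp_all add: sum_distrib_left mult.assoc T_mult)
  then show ?thesis unfolding W_def by (auto intro!: exI[of _ "\<lambda>j. c * a j"])
qed

private lemma W_mult_y1:
  assumes "f \<in> W"
  shows "yvar 1 * f \<in> W"
proof -
  from assms obtain a where a: "f = (\<Sum>j<p. a j * yvar 1 ^ j)" "\<And>j. a j \<in> T"
    unfolding W_def by blast
  from p obtain q where q: "p = Suc q" by (cases p) auto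
  \<comment> \<open>Multiplication by y_1 shifts the coefficients up by one, and the top term wraps
    round to the constant coefficient through y_1^p.\<close>
  define b where "b j = (case j of 0 \<Rightarrow> a q * yvar 1 ^ p | Suc j \<Rightarrow> a j)" for j
  have "yvar 1 * f = (\<Sum>j<q. a j * yvar 1 ^ Suc j) + a q * yvar 1 ^ p"
    unfolding a q by (simp add: sum_distrib_left mult_ac distrib_left)
  also have "\<dots> = (\<Sum>j<p. b j * yvar 1 ^ j)"
    unfolding q by (subst sum.lessThan_Suc_shift) (simp add: b_def q)
  finally show ?thesis
    unfolding W_def using a(2) T_mult T_y1 by (auto intro!: exI[of _ b] simp: b_def split: nat.split)
qed

private lemma W_mult:
  assumes "f \<in> W" "g \<in> W"
  shows "f * g \<in> W"
proof -
  from assms obtain a where a: "f = (\<Sum>j<p. a j * yvar 1 ^ j)" "\<And>j. a j \<in> T"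
    unfolding W_def by blast
  have pow: "yvar 1 ^ j * g \<in> W" for j
    by (induction j) (use assms(2) W_mult_y1 in \<open>auto simp: mult.assoc\<close>)
  have "(\<Sum>j<q. a j * (yvar 1 ^ j * g)) \<in> W" for q
    by (induction q) (use pow in \<open>simp_all add: W_add W_mult_T a T_sub_W T_0\<close>)
  then show ?thesis by (simp add: a(1) sum_distrib_right mult.assoc)
qed

private lemma W_sub_loc: "f \<in> W \<Longrightarrow> f \<in> W_loc"
  unfolding W_loc_def by (auto intro!: exI[of _ 0])

private lemma W_loc_mult:
  assumes "f \<in> W_loc" "g \<in> W_loc"
  shows "f * g \<in> W_loc"
proof -
  from assms obtain k l where kl: "yvar 0 ^ k * f \<in> W" "yvar 0 ^ l * g \<in> W"
    unfolding W_loc_def by blast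
  have "yvar 0 ^ (k + l) * (f * g) = (yvar 0 ^ k * f) * (yvar 0 ^ l * g)"
    by (simp add: power_add mult_ac)
  with W_mult[OF kl] show ?thesis unfolding W_loc_def by (metis (mono_tags) mem_Collect_eq)
qed

private lemma W_loc_add:
  assumes "f \<in> W_loc" "g \<in> W_loc"
  shows "f + g \<in> W_loc"
proof -
  from assms obtain k l where kl: "yvar 0 ^ k * f \<in> W" "yvar 0 ^ l * g \<in> W"
    unfolding W_loc_def by blast
  have "yvar 0 ^ (k + l) * (f + g) = yvar 0 ^ l * (yvar 0 ^ k * f) + yvar 0 ^ k * (yvar 0 ^ l * g)"
    by (simp add: power_add algebra_simps)
  moreover have "\<dots> \<in> W" by (intro W_add W_mult_T T_power T_y0 kl)
  ultimately show ?thesis unfolding W_loc_def by (metis (mono_tags) mem_Collect_eq)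
qed

private lemma W_loc_cancel_y0:
  assumes "yvar 0 ^ e * f \<in> W_loc"
  shows "f \<in> W_loc"
proof -
  from assms obtain k where "yvar 0 ^ k * (yvar 0 ^ e * f) \<in> W" unfolding W_loc_def by blast
  then have "yvar 0 ^ (k + e) * f \<in> W" by (simp add: power_add mult.assoc)
  then show ?thesis unfolding W_loc_def by blast
qed

text \<open>Strong induction: z_i = c y_0^e y_i + r with r in lower variables is solved for y_i by
  inverting the number c and cancelling y_0^e.\<close>

private lemma yvar_in_W_loc: "i \<le> n \<Longrightarrow> yvar i \<in> W_loc"
proof (induction i rule: less_induct)
  case (less i)
  consider "i = 0" | "i = 1" | "2 \<le> i" by linarith
  then show ?case
  proof cases
    case 1
    then show ?thesis by (simp add: W_sub_loc T_sub_W T_y0)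
  next
    case 2
    then show ?thesis using W_mult_y1[OF T_sub_W[OF T_1]] by (simp add: W_sub_loc)
  next
    case 3
    from z_int_leading[OF 3, where 'r = 'k] obtain c e where ce: "c \<in> {2, i}"
      and r: "z_int i - of_nat c * yvar 0 ^ e * yvar i \<in> (yvars (i - 1) :: 'k ypoly set)" by blast
    define r where "r = z_int i - of_nat c * yvar 0 ^ e * (yvar i :: 'k ypoly)"
    have rW: "f \<in> W_loc" if "f \<in> yvars (i - 1)" for f :: "'k ypoly"
      using that
    proof (induction rule: yvars_induct)
      case (yvar j)
      then show ?case using less 3 by auto
    qed (auto intro: W_loc_add W_loc_mult W_sub_loc T_sub_W T_yconst)
    have "0 < c" "c < p" using ce 3 less.prems p(3) by auto
    then have "\<not> CHAR('k) dvd c" using p(2) by (auto dest: dvd_imp_le)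
    then have "of_nat c \<noteq> (0 :: 'k)" by (simp add: of_nat_eq_0_iff_char_dvd)
    then have inv: "yconst (inverse (of_nat c)) * of_nat c = (1 :: 'k ypoly)"
      unfolding yconst_of_nat[symmetric] yconst_mult[symmetric] by simp
    have "yvar 0 ^ e * (yvar i :: 'k ypoly) = (yconst (inverse (of_nat c)) * of_nat c) * (yvar 0 ^ e * yvar i)"
      by (simp add: inv)
    also have "\<dots> = yconst (inverse (of_nat c)) * (z_int i + (- r))"
      unfolding r_def by (simp add: mult_ac)
    finally have "yvar 0 ^ e * (yvar i :: 'k ypoly) = \<dots>" .
    moreover have "\<dots> \<in> W_loc"
      by (intro W_loc_mult W_loc_add rW[OF yvars_uminus[OF r[folded r_def]]] W_sub_loc T_sub_W T_yconst
          T_z[OF 3 less.prems])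
    ultimately show ?thesis using W_loc_cancel_y0 by metis
  qed
qed

lemma fil_kernel_localization:
  assumes c: "c \<in> fil_kernel n"
  shows "\<exists>k. yvar 0 ^ k * c \<in> T"
proof -
  have cs: "c \<in> yvars (Suc n)" "fil_der n c = 0" "ypderiv (Suc n) c = 0"
    using c by (simp_all add: fil_kernel_def)
  have pow: "f ^ k \<in> W_loc" if "f \<in> W_loc" for f k
    by (induction k) (use that W_loc_mult in \<open>auto intro: W_sub_loc T_sub_W T_1\<close>)
  have prod: "(\<Prod>i\<in>B. yvar i ^ e i) \<in> W_loc" if "B \<subseteq> {..n}" for B and e :: "nat \<Rightarrow> nat"
    using that by (induction B rule: infinite_finite_induct)
      (auto intro!: W_loc_mult pow yvar_in_W_loc intro: W_sub_loc T_sub_W T_1)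
  have "(\<Sum>m\<in>B. yconst (Poly_Mapping.lookup c m)
      * ((\<Prod>i\<le>n. yvar i ^ Poly_Mapping.lookup m i) * yvar (Suc n) ^ Poly_Mapping.lookup m (Suc n))) \<in> W_loc"
    if "B \<subseteq> Poly_Mapping.keys c" for B
    using that
  proof (induction B rule: infinite_finite_induct)
    case (insert m B)
    from CHAR_dvd_exponent[OF cs(3), of m] insert.prems obtain j where j: "Poly_Mapping.lookup m (Suc n) = p * j"
      unfolding p(2) by (auto elim: dvdE)
    have "yvar (Suc n) ^ Poly_Mapping.lookup m (Suc n) \<in> W_loc"
      unfolding j power_mult by (intro W_sub_loc T_sub_W T_power T_t)
    with insert show ?case
      by (auto intro!: W_loc_add W_loc_mult prod intro: W_sub_loc T_sub_W T_yconst)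
  qed (auto intro: W_sub_loc T_sub_W T_0)
  from this[OF order_refl] have "c \<in> W_loc"
    using ypoly_eq_sum_prod[OF cs(1)] by simp
  then obtain k where "yvar 0 ^ k * c \<in> W" unfolding W_loc_def by blast
  then obtain a where a: "yvar 0 ^ k * c = (\<Sum>j<p. a j * yvar 1 ^ j)" "\<And>j. a j \<in> T"
    unfolding W_def by blast
  from p obtain q where q: "p = Suc q" by (cases p) auto
  have "fil_der n (yvar 0 ^ k * c) = 0"
    by (simp add: derivation_mult[OF derivation_fil_der] derivation_power[OF derivation_fil_der]
        fil_der_yvar cs)
  \<comment> \<open>Differentiating a constant gives a relation among powers of y_1 without a 0, so
    every higher coefficient of the expansion must vanish.\<close>
  then have "yvar 0 * (\<Sum>j<q. (of_nat (Suc j) * a (Suc j)) * yvar 1 ^ j) = 0"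
    unfolding a(1) q fil_der_sum_yvar_1[OF n T_der[OF a(2)]] .
  then have 0: "(\<Sum>j<q. (of_nat (Suc j) * a (Suc j)) * yvar 1 ^ j) = 0" by simp
  have "of_nat (Suc j) * a (Suc j) = 0" if "j < q" for j
  proof (rule yvar_1_powers_independent[OF n _ _ 0 that])
    show "q \<le> CHAR('k)" using p(2) q by simp
    show "fil_der n (of_nat (Suc j) * a (Suc j)) = 0" for j
      unfolding derivation_mult[OF derivation_fil_der] derivation_of_nat[OF derivation_fil_der]
      by (simp add: T_der[OF a(2)])
  qed
  moreover have "of_nat (Suc j) \<noteq> (0 :: 'k ypoly)" if "j < q" for j
    using that p(2) q unfolding of_nat_ypoly_eq_0_iff by (auto dest: dvd_imp_le)
  ultimately have "a (Suc j) = 0" if "j < q" for j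
    using that by (metis mult_eq_0_iff)
  then have "yvar 0 ^ k * c = a 0"
    unfolding a(1) q by (subst sum.lessThan_Suc_shift) simp
  then show ?thesis using a(2) by metis
qed

end

section \<open>The center as a ring of polynomials\<close>

text \<open>The isomorphism from \<^const>\<open>fil_kernel\<close> onto the center.\<close>

definition fil_poly :: "nat \<Rightarrow> 'k::field ypoly \<Rightarrow> ('k, 'k fil) free_alg set"
  where "fil_poly n c = fil_class n (ordered n c)"

lemma fil_uea_eq: "fil_uea n = fil_free n Quot fil_ideal n"
  by (simp add: fil_uea_def uea_def)

lemma fil_uea_ring: "ring (fil_uea n)"
  unfolding fil_uea_eq by (rule ideal.quotient_is_ring[OF fil_ideal_ideal])

lemma fil_class_eq_iff:
  assumes "u \<in> carrier (fil_free n)" "v \<in> carrier (fil_free n)"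
  shows "fil_class n u = fil_class n v \<longleftrightarrow> fa_act n u 1 = fa_act n v 1"
proof -
  interpret ring "fil_free n :: ('a, 'a fil) free_alg ring" by (rule free_algebra_ring)
  have "u \<ominus>\<^bsub>fil_free n\<^esub> v = u - v"
    using free_algebra_a_inv[OF assms(2)] by (simp add: a_minus_def)
  then have "fil_class n u = fil_class n v \<longleftrightarrow> fil_cong n u v"
    using quotient_eq_iff_same_a_r_cos[OF fil_ideal_ideal assms] assms
    by (simp add: fil_class_def fil_cong_def)
  then show ?thesis using fil_cong_iff[OF assms] by simp
qed

lemma carrier_fil_uea: "carrier (fil_uea n) = fil_class n ` carrier (fil_free n)"
  by (auto simp: fil_uea_eq FactRing_def A_RCOSETS_def' fil_class_def)

lemma fil_class_hom:
  "u \<in> carrier (fil_free n) \<Longrightarrow> v \<in> carrier (fil_free n) \<Longrightarrow>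
    fil_class n u \<otimes>\<^bsub>fil_uea n\<^esub> fil_class n v = fil_class n (u * v)"
  "u \<in> carrier (fil_free n) \<Longrightarrow> v \<in> carrier (fil_free n) \<Longrightarrow>
    fil_class n u \<oplus>\<^bsub>fil_uea n\<^esub> fil_class n v = fil_class n (u + v)"
  "\<one>\<^bsub>fil_uea n\<^esub> = fil_class n 1" "\<zero>\<^bsub>fil_uea n\<^esub> = fil_class n 0"
proof -
  note hom = ideal.rcos_ring_hom[OF fil_ideal_ideal, of n]
  show "u \<in> carrier (fil_free n) \<Longrightarrow> v \<in> carrier (fil_free n) \<Longrightarrow>
    fil_class n u \<otimes>\<^bsub>fil_uea n\<^esub> fil_class n v = fil_class n (u * v)"
    using ring_hom_mult[OF hom, of u v] by (simp add: fil_class_def fil_uea_eq)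
  show "u \<in> carrier (fil_free n) \<Longrightarrow> v \<in> carrier (fil_free n) \<Longrightarrow>
    fil_class n u \<oplus>\<^bsub>fil_uea n\<^esub> fil_class n v = fil_class n (u + v)"
    using ring_hom_add[OF hom, of u v] by (simp add: fil_class_def fil_uea_eq)
  show "\<one>\<^bsub>fil_uea n\<^esub> = fil_class n 1"
    using ring_hom_one[OF hom, symmetric] by (simp add: fil_class_def fil_uea_eq)
  show "\<zero>\<^bsub>fil_uea n\<^esub> = fil_class n 0"
    using ring_hom_zero[OF hom free_algebra_ring fil_uea_ring[unfolded fil_uea_eq], symmetric]
    by (simp add: fil_class_def fil_uea_eq)
qed

lemma fil_class_power:
  assumes "u \<in> carrier (fil_free n)"
  shows "fil_class n u [^]\<^bsub>fil_uea n\<^esub> (k::nat) = fil_class n (u ^ k)"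
proof -
  interpret ring "fil_uea n :: ('a, 'a fil) free_alg set ring" by (rule fil_uea_ring)
  show ?thesis
    by (induction k)
       (simp_all add: fil_class_hom assms free_algebra_power_closed power_commutes[symmetric])
qed

lemma fil_class_eq_fil_poly:
  "u \<in> carrier (fil_free n) \<Longrightarrow> fil_class n u = fil_poly n (fa_act n u 1)"
  unfolding fil_poly_def
  by (subst fil_class_eq_iff) (simp_all add: ordered_closed fa_act_ordered_1 fil_cong_ordered)

lemma fil_poly_in_carrier: "fil_poly n c \<in> carrier (fil_uea n)"
  by (simp add: carrier_fil_uea fil_poly_def ordered_closed)

lemma inj_on_fil_poly: "inj_on (fil_poly n) (yvars (Suc n))"
  unfolding fil_poly_def
  by (rule inj_onI) (simp add: fil_class_eq_iff ordered_closed fa_act_ordered_1)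

lemma fil_poly_add: "fil_poly n (c + d) = fil_poly n c \<oplus>\<^bsub>fil_uea n\<^esub> fil_poly n d"
  by (simp add: fil_poly_def fil_class_hom ordered_closed ordered_add)

lemma fil_poly_1: "fil_poly n 1 = \<one>\<^bsub>fil_uea n\<^esub>"
  and fil_poly_0: "fil_poly n 0 = \<zero>\<^bsub>fil_uea n\<^esub>"
  using fil_class_eq_fil_poly[of 1 n, symmetric] fil_class_eq_fil_poly[of 0 n, symmetric]
  by (simp_all add: fil_class_hom free_algebra_closed fa_act_1 fa_act_0_left)

lemma fil_poly_gens:
  "fil_const n c = fil_poly n (yconst c)"
  "fil_x n [^]\<^bsub>fil_uea n\<^esub> k = fil_poly n (yvar (Suc n) ^ k)"
  "i \<le> n \<Longrightarrow> fil_y n i = fil_poly n (yvar i)"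
  "i \<le> n \<Longrightarrow> fil_y n i [^]\<^bsub>fil_uea n\<^esub> k = fil_poly n (yvar i ^ k)"
proof -
  note closed = fil_gens_closed fa_const_closed free_algebra_power_closed
  show "fil_const n c = fil_poly n (yconst c)"
    unfolding fil_const_def by (subst fil_class_eq_fil_poly) (simp_all add: closed fa_act_const)
  show "fil_x n [^]\<^bsub>fil_uea n\<^esub> k = fil_poly n (yvar (Suc n) ^ k)"
    unfolding fil_x_def
    by (subst fil_class_power; (subst fil_class_eq_fil_poly)?)
       (simp_all add: closed fa_act_x_power xop_funpow_1)
  show "i \<le> n \<Longrightarrow> fil_y n i = fil_poly n (yvar i)"
    unfolding fil_y_def by (subst fil_class_eq_fil_poly) (simp_all add: closed fa_act_y)
  show "i \<le> n \<Longrightarrow> fil_y n i [^]\<^bsub>fil_uea n\<^esub> k = fil_poly n (yvar i ^ k)"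
    unfolding fil_y_def
    by (subst fil_class_power; (subst fil_class_eq_fil_poly)?)
       (simp_all add: closed fa_act_y_power)
qed

lemma fil_of_ypoly_eq:
  assumes "f \<in> yvars n"
  shows "fil_of_ypoly n f = fil_poly n f"
  unfolding fil_of_ypoly_def fil_poly_def ordered_def
proof (rule arg_cong[where f = "fil_class n"], rule sum.cong[OF refl])
  fix m assume "m \<in> Poly_Mapping.keys f"
  with assms have "Poly_Mapping.lookup m (Suc n) = 0"
    by (fastforce simp: yvars_def in_keys_iff)
  then show "fa_const (Poly_Mapping.lookup f m) *
      prod_list (map (\<lambda>i. fa_gen (fil_vec (By i)) ^ Poly_Mapping.lookup m i) [0..<Suc n])
    = fa_const (Poly_Mapping.lookup f m) *
      (ymon n (Poly_Mapping.lookup m) * fa_gen (fil_vec Bx) ^ Poly_Mapping.lookup m (Suc n))"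
    by (simp add: ymon_def)
qed

lemma fil_kernel_closed:
  "c \<in> fil_kernel n \<Longrightarrow> d \<in> fil_kernel n \<Longrightarrow> c + d \<in> fil_kernel n"
  "c \<in> fil_kernel n \<Longrightarrow> d \<in> fil_kernel n \<Longrightarrow> c * d \<in> fil_kernel n"
  "c \<in> fil_kernel n \<Longrightarrow> - c \<in> fil_kernel n"
  "yconst a \<in> fil_kernel n" "0 \<in> fil_kernel n" "1 \<in> fil_kernel n" "yvar 0 \<in> fil_kernel n"
  by (simp_all add: fil_kernel_def yvars_add yvars_mult yvars_uminus yvars_yconst yvars_0 yvars_1
      yvars_yvar fil_der_yconst fil_der_yvar derivation_add[OF derivation_fil_der]
      derivation_mult[OF derivation_fil_der] derivation_minus[OF derivation_fil_der]
      derivation_0[OF derivation_fil_der] derivation_1[OF derivation_fil_der]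
      derivation_add[OF derivation_ypderiv] derivation_mult[OF derivation_ypderiv]
      derivation_minus[OF derivation_ypderiv] derivation_0[OF derivation_ypderiv]
      derivation_1[OF derivation_ypderiv])

lemma ypderiv_yvars: "f \<in> yvars n \<Longrightarrow> ypderiv (Suc n) f = 0"
  by (induction rule: yvars_induct)
     (simp_all add: derivation_add[OF derivation_ypderiv] derivation_mult[OF derivation_ypderiv])

lemma z_int_in_fil_kernel:
  assumes "i \<le> n" "(2 :: 'k::field) \<noteq> 0"
  shows "(z_int i :: 'k ypoly) \<in> fil_kernel n"
proof -
  have "(z_int i :: 'k ypoly) \<in> yvars n" by (rule yvars_mono[OF z_int_in_yvars assms(1)])
  then show ?thesis
    using fil_der_z_int[OF assms] yvars_mono[of "z_int i :: 'k ypoly" n "Suc n"]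
    by (simp add: fil_kernel_def ypderiv_yvars)
qed

lemma fil_z_eq:
  assumes "2 \<le> i" "i \<le> n"
  shows "fil_z n i = fil_poly n (z_int i)"
  unfolding fil_z_def z_poly_eq[OF assms]
  by (rule fil_of_ypoly_eq[OF yvars_mono[OF z_int_in_yvars assms(2)]])

section \<open>Evaluation of coefficient lists and generated subrings\<close>

lemma (in ring) eval_replicate_zero:
  assumes "x \<in> carrier R" "a \<in> carrier R"
  shows "eval (replicate m \<zero> @ [a]) x = a"
  using assms by (induction m) simp_all

text \<open>Meant for the lower part \<open>cs\<close> of an integral equation for \<open>q\<close>:
  it carries membership of s q^k in \<open>J\<close> from smaller exponents to the next one.\<close>

lemma (in cring) mult_eval_in_subring:
  assumes "subring J R" "set cs \<subseteq> J" "q \<in> carrier R" "s \<in> carrier R"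
    and "\<And>i. i < length cs \<Longrightarrow> s \<otimes> q [^] (i + e) \<in> J"
  shows "s \<otimes> eval cs q \<otimes> q [^] e \<in> J"
  using assms(2,5)
proof (induction cs)
  case Nil
  then show ?case using assms subringE(2)[OF assms(1)] by simp
next
  case (Cons c cs)
  note J = subringE(1)[OF assms(1)]
  have c: "c \<in> J" "c \<in> carrier R" and cs: "set cs \<subseteq> carrier R" using Cons.prems J by auto
  have ev: "eval cs q \<in> carrier R" using cs assms(3) by (rule eval_in_carrier)
  have "s \<otimes> eval (c # cs) q \<otimes> q [^] e = c \<otimes> (s \<otimes> q [^] (length cs + e)) \<oplus> s \<otimes> eval cs q \<otimes> q [^] e"
    using c ev assms(3,4) by (simp add: l_distr r_distr nat_pow_mult[symmetric] m_ac)
  moreover have "c \<otimes> (s \<otimes> q [^] (length cs + e)) \<in> J"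
    using Cons.prems(2)[of "length cs"] by (intro subringE(6)[OF assms(1) c(1)]) simp
  moreover have "s \<otimes> eval cs q \<otimes> q [^] e \<in> J"
    using Cons.prems by (intro Cons.IH) auto
  ultimately show ?case using subringE(7)[OF assms(1)] by simp
qed

lemma (in ring) generate_ring_least:
  assumes "\<one> \<in> E" "H \<subseteq> E" "\<And>a. a \<in> E \<Longrightarrow> \<ominus> a \<in> E"
    "\<And>a b. a \<in> E \<Longrightarrow> b \<in> E \<Longrightarrow> a \<oplus> b \<in> E" "\<And>a b. a \<in> E \<Longrightarrow> b \<in> E \<Longrightarrow> a \<otimes> b \<in> E"
  shows "generate_ring R H \<subseteq> E"
proof
  fix h assume "h \<in> generate_ring R H"
  then show "h \<in> E" by induction (use assms in auto)
qed

section \<open>The fraction field of the center\<close>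

context
  fixes n p :: nat and ty :: "'k::field itself"
  assumes n: "1 \<le> n" and p: "Factorial_Ring.prime p" "CHAR('k) = p" "n + 1 \<le> p"
begin

private abbreviation (input) K :: "'k ypoly set" where "K \<equiv> fil_kernel n"
private abbreviation (input) P :: "'k ypoly \<Rightarrow> ('k, 'k fil) free_alg set" where "P \<equiv> fil_poly n"
private abbreviation (input) U :: "('k, 'k fil) free_alg set ring" where "U \<equiv> fil_uea n"
private abbreviation (input) Z :: "('k, 'k fil) free_alg set ring" where "Z \<equiv> fil_center_ring n"
private abbreviation (input) Q :: "'k fil_frac ring" where "Q \<equiv> fil_Q n"

interpretation U: ring U by (rule fil_uea_ring)

text \<open>Multiplicativity is special to constants, whose normal forms act by multiplication; for
  x and y_1 it fails.\<close>

lemma fil_poly_mult: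
  assumes "c \<in> K" "d \<in> K"
  shows "P (c * d) = P c \<otimes>\<^bsub>U\<^esub> P d"
proof -
  have "fa_act n (ordered n c * ordered n d) 1 = c * d"
    using assms fa_act_ordered_kernel[OF p assms(1)]
    by (simp add: fa_act_mult fa_act_ordered_1 fil_kernel_def)
  then show ?thesis
    using fil_class_eq_fil_poly[of "ordered n c * ordered n d" n]
    by (simp add: fil_poly_def[of n c] fil_poly_def[of n d] fil_class_hom ordered_closed free_algebra_closed)
qed

lemma fil_poly_uminus:
  assumes "c \<in> K"
  shows "\<ominus>\<^bsub>U\<^esub> P c = P (- c)"
proof (rule U.minus_equality)
  show "P (- c) \<oplus>\<^bsub>U\<^esub> P c = \<zero>\<^bsub>U\<^esub>"
    by (simp add: fil_poly_add[symmetric] fil_poly_0)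
qed (simp_all add: fil_poly_in_carrier)

lemma fil_center_eq: "fil_center n = P ` K"
proof
  show "fil_center n \<subseteq> P ` K"
  proof
    fix z :: "('k, 'k fil) free_alg set" assume z: "z \<in> fil_center n"
    then obtain u where u: "u \<in> carrier (fil_free n)" "z = fil_class n u"
      by (auto simp: fil_center_def ring_center_def carrier_fil_uea)
    have "fil_cong n (u * v) (v * u)" if v: "v \<in> carrier (fil_free n)" for v
    proof -
      have "fil_class n v \<in> carrier U" using v by (simp add: carrier_fil_uea)
      with z have "fil_class n u \<otimes>\<^bsub>U\<^esub> fil_class n v = fil_class n v \<otimes>\<^bsub>U\<^esub> fil_class n u"
        unfolding u(2) fil_center_def ring_center_def by blast
      then have "fil_class n (u * v) = fil_class n (v * u)"
        using u(1) v by (simp add: fil_class_hom)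
      then show ?thesis
        using u(1) v by (simp add: fil_class_eq_iff fil_cong_iff free_algebra_closed)
    qed
    then have "fa_act n u 1 \<in> K" using central_iff_kernel[OF p u(1) n] by blast
    then show "z \<in> P ` K" using u fil_class_eq_fil_poly by blast
  qed
  show "P ` K \<subseteq> fil_center n"
  proof
    fix z assume "z \<in> P ` K"
    then obtain c where c: "c \<in> K" "z = fil_class n (ordered n c)" by (auto simp: fil_poly_def)
    have "fa_act n (ordered n c) 1 \<in> K"
      using c(1) fa_act_ordered_1[of c n] by (simp add: fil_kernel_def)
    then have "\<forall>v\<in>carrier (fil_free n). fil_cong n (ordered n c * v) (v * ordered n c)"
      using central_iff_kernel[OF p ordered_closed n] by blast
    then show "z \<in> fil_center n"
      unfolding fil_center_def ring_center_def c(2)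
      by (auto simp: carrier_fil_uea fil_class_hom ordered_closed fil_class_eq_iff fil_cong_iff free_algebra_closed)
  qed
qed

lemma fil_center_ring_simps:
  "carrier Z = P ` K" "\<one>\<^bsub>Z\<^esub> = P 1" "\<zero>\<^bsub>Z\<^esub> = P 0"
  "a \<otimes>\<^bsub>Z\<^esub> b = a \<otimes>\<^bsub>U\<^esub> b" "a \<oplus>\<^bsub>Z\<^esub> b = a \<oplus>\<^bsub>U\<^esub> b"
  by (simp_all add: fil_center_ring_def fil_center_eq fil_poly_1 fil_poly_0)

lemma inj_on_fil_poly_kernel: "inj_on P K"
  by (rule inj_on_subset[OF inj_on_fil_poly]) (auto simp: fil_kernel_def)

text \<open>The constants form a subring of a polynomial ring over a field, and the domain property
  is transported along the isomorphism.\<close>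

lemma fil_center_ring_domain: "domain Z"
proof -
  let ?C = "\<lparr>carrier = K, mult = (*), one = 1, ring.zero = 0, add = (+)\<rparr>"
  have "cring ?C"
  proof (rule cringI)
    show "abelian_group ?C"
    proof (rule abelian_groupI, goal_cases)
      case (6 f)
      then show ?case using fil_kernel_closed(3)[of f n] by (intro bexI[of _ "- f"]) simp_all
    qed (simp_all add: fil_kernel_closed add.assoc add.commute)
    show "comm_monoid ?C"
      by (rule comm_monoidI) (simp_all add: fil_kernel_closed mult.assoc mult.commute)
  qed (simp add: distrib_right)
  then have "domain ?C"
    by (rule domainI) simp_all
  moreover have "P \<in> ring_iso ?C Z"
    unfolding ring_iso_def
    by (auto simp: fil_center_ring_simps fil_poly_add fil_poly_mult bij_betw_def inj_on_fil_poly_kernel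
        intro!: ring_hom_memI)
  ultimately have "domain (Z\<lparr>zero := P \<zero>\<^bsub>?C\<^esub>\<rparr>)" by (rule domain.ring_iso_imp_img_domain)
  moreover have "Z\<lparr>zero := P \<zero>\<^bsub>?C\<^esub>\<rparr> = Z"
    by (simp add: fil_center_ring_def fil_poly_0)
  ultimately show ?thesis by simp
qed

interpretation Z: domain Z by (rule fil_center_ring_domain)
interpretation Q: field Q unfolding fil_Q_def by (rule Z.frac_field_field)

private definition j :: "'k ypoly \<Rightarrow> 'k fil_frac" where "j c = fil_emb n (P c)"

private lemma j_eq: "j c = frac_of Z (P c) \<one>\<^bsub>Z\<^esub>"
  by (simp add: j_def fil_emb_def frac_emb_def)

private lemma P_carrier: "c \<in> K \<Longrightarrow> P c \<in> carrier Z"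
  by (simp add: fil_center_ring_simps)

private lemma P_eq_0_iff: "c \<in> K \<Longrightarrow> P c = \<zero>\<^bsub>Z\<^esub> \<longleftrightarrow> c = 0"
  using inj_on_eq_iff[OF inj_on_fil_poly_kernel, of c 0]
  by (simp add: fil_center_ring_simps fil_kernel_closed)

private lemma j_closed: "c \<in> K \<Longrightarrow> j c \<in> carrier Q"
  unfolding fil_Q_def j_eq by (rule Z.frac_in_carrier) (simp_all add: P_carrier)

private lemma j_add: "c \<in> K \<Longrightarrow> d \<in> K \<Longrightarrow> j (c + d) = j c \<oplus>\<^bsub>Q\<^esub> j d"
  unfolding fil_Q_def j_eq
  by (subst Z.frac_add) (simp_all add: P_carrier, simp add: fil_center_ring_simps fil_poly_add)

private lemma j_mult: "c \<in> K \<Longrightarrow> d \<in> K \<Longrightarrow> j (c * d) = j c \<otimes>\<^bsub>Q\<^esub> j d"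
  unfolding fil_Q_def j_eq
  by (subst Z.frac_mult) (simp_all add: P_carrier, simp add: fil_center_ring_simps fil_poly_mult)

private lemma j_1: "j 1 = \<one>\<^bsub>Q\<^esub>"
  unfolding fil_Q_def j_eq by (simp add: Z.frac_one fil_center_ring_simps)

private lemma j_0: "j 0 = \<zero>\<^bsub>Q\<^esub>"
  unfolding fil_Q_def j_eq by (simp add: Z.frac_zero fil_center_ring_simps)

private lemma j_eq_iff: "c \<in> K \<Longrightarrow> d \<in> K \<Longrightarrow> j c = j d \<longleftrightarrow> c = d"
  unfolding j_eq
  by (subst Z.frac_eq_iff) (simp_all add: P_carrier inj_on_eq_iff[OF inj_on_fil_poly_kernel])

private lemma j_uminus: "c \<in> K \<Longrightarrow> \<ominus>\<^bsub>Q\<^esub> j c = j (- c)"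
  by (rule Q.minus_equality) (simp_all add: j_closed fil_kernel_closed j_0 flip: j_add)

private lemma kernel_power: "c \<in> K \<Longrightarrow> c ^ k \<in> K"
  by (induction k) (simp_all add: fil_kernel_closed)

private lemma j_power: "c \<in> K \<Longrightarrow> j (c ^ k) = j c [^]\<^bsub>Q\<^esub> k"
  by (induction k) (simp_all add: j_1 j_mult kernel_power Q.m_comm j_closed)

private lemma fil_Q_fraction:
  assumes "q \<in> carrier Q"
  shows "\<exists>a\<in>K. \<exists>b\<in>K. b \<noteq> 0 \<and> q \<otimes>\<^bsub>Q\<^esub> j b = j a"
proof -
  from assms obtain A B where AB: "q = frac_of Z A B" "A \<in> carrier Z" "B \<in> carrier Z" "B \<noteq> \<zero>\<^bsub>Z\<^esub>"
    unfolding fil_Q_def by (rule Z.frac_field_cases)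
  then obtain a b where ab: "a \<in> K" "b \<in> K" "A = P a" "B = P b"
    by (auto simp: fil_center_ring_simps)
  have "q \<otimes>\<^bsub>Q\<^esub> j b = frac_of Z (A \<otimes>\<^bsub>Z\<^esub> B) B"
    unfolding fil_Q_def j_eq AB(1) ab(4)[symmetric] by (subst Z.frac_mult) (use AB in simp_all)
  also have "\<dots> = j a"
    unfolding j_eq ab(3)[symmetric] by (subst Z.frac_eq_iff) (use AB in simp_all)
  finally show ?thesis using ab AB(4) P_eq_0_iff by blast
qed

private lemma subring_j: "subring (j ` K) Q"
proof (rule Q.subringI)
  show "j ` K \<subseteq> carrier Q" using j_closed by blast
  show "\<one>\<^bsub>Q\<^esub> \<in> j ` K" using j_1 fil_kernel_closed(6) by (metis image_eqI)
qed (auto simp: j_uminus fil_kernel_closed simp flip: j_add j_mult)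

text \<open>If D kills b and b c, the Leibniz rule leaves b D c = 0; this applies to both
  derivations.\<close>

private lemma fil_kernel_divide:
  assumes "a \<in> K" "b \<in> K" "b \<noteq> 0" "c \<in> yvars (Suc n)" "a = b * c"
  shows "c \<in> K"
proof -
  have "b * D c = 0" if D: "derivation D" and "D a = 0" "D b = 0" for D :: "'k ypoly \<Rightarrow> 'k ypoly"
    using derivation_mult[OF D, of b c] that assms(5) by simp
  from this[OF derivation_fil_der[of n]] this[OF derivation_ypderiv[of "Suc n"]]
  show ?thesis using assms by (simp add: fil_kernel_def)
qed

text \<open>For q = a/b with a monic equation of degree d, b^d is a common denominator of all powers
  of q. Hence b^k divides b^d a^k for every k, so a/b is a polynomial, and as a quotient of
  constants it is a constant.\<close>

lemma fil_center_integrally_closed: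
  assumes q: "q \<in> carrier Q" and f: "set f \<subseteq> j ` K" "f \<noteq> []" "lead_coeff f = \<one>\<^bsub>Q\<^esub>"
    and root: "Q.eval f q = \<zero>\<^bsub>Q\<^esub>"
  shows "q \<in> j ` K"
proof -
  from f obtain cs where cs: "f = \<one>\<^bsub>Q\<^esub> # cs" "set cs \<subseteq> j ` K" by (cases f) auto
  obtain a b where ab: "a \<in> K" "b \<in> K" "b \<noteq> 0" "q \<otimes>\<^bsub>Q\<^esub> j b = j a"
    using fil_Q_fraction[OF q] by blast
  let ?d = "length cs"
  let ?s = "j b [^]\<^bsub>Q\<^esub> ?d"
  note jb = j_closed[OF ab(2)]
  have s: "?s \<in> carrier Q" using jb by simp
  have cs_carrier: "set cs \<subseteq> carrier Q" using cs(2) j_closed by blast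
  have qd: "q [^]\<^bsub>Q\<^esub> ?d = \<ominus>\<^bsub>Q\<^esub> Q.eval cs q"
    using root q Q.eval_in_carrier[OF cs_carrier q] by (simp add: cs(1) Q.minus_equality)
  have qb: "q [^]\<^bsub>Q\<^esub> k \<otimes>\<^bsub>Q\<^esub> j b [^]\<^bsub>Q\<^esub> k = j (a ^ k)" for k :: nat
    using q jb by (simp add: Q.nat_pow_distrib[symmetric] ab(4) j_power[OF ab(1)])
  \<comment> \<open>Below the degree d this is b^(d-k) a^k; from d on, the equation expresses q^k
    through the d preceding powers.\<close>
  have sq: "?s \<otimes>\<^bsub>Q\<^esub> q [^]\<^bsub>Q\<^esub> k \<in> j ` K" for k :: nat
  proof (induction k rule: less_induct)
    case (less k)
    show ?case
    proof (cases "k < ?d")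
      case True
      then have "?s = j b [^]\<^bsub>Q\<^esub> (?d - k) \<otimes>\<^bsub>Q\<^esub> j b [^]\<^bsub>Q\<^esub> k"
        using jb by (simp add: Q.nat_pow_mult)
      then have "?s \<otimes>\<^bsub>Q\<^esub> q [^]\<^bsub>Q\<^esub> k = j (b ^ (?d - k)) \<otimes>\<^bsub>Q\<^esub> (q [^]\<^bsub>Q\<^esub> k \<otimes>\<^bsub>Q\<^esub> j b [^]\<^bsub>Q\<^esub> k)"
        using jb q by (simp add: j_power[OF ab(2)] Q.m_ac)
      also have "\<dots> = j (b ^ (?d - k) * a ^ k)"
        unfolding qb by (rule j_mult[symmetric]) (simp_all add: kernel_power ab)
      finally show ?thesis using ab by (simp add: kernel_power fil_kernel_closed)
    next
      case False
      define e where "e = k - ?d"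
      with False have k: "k = ?d + e" by simp
      have "?s \<otimes>\<^bsub>Q\<^esub> q [^]\<^bsub>Q\<^esub> k = \<ominus>\<^bsub>Q\<^esub> (?s \<otimes>\<^bsub>Q\<^esub> Q.eval cs q \<otimes>\<^bsub>Q\<^esub> q [^]\<^bsub>Q\<^esub> e)"
        using q s Q.eval_in_carrier[OF cs_carrier q]
        by (simp add: k Q.nat_pow_mult[symmetric] qd Q.l_minus Q.r_minus Q.m_assoc)
      moreover have "?s \<otimes>\<^bsub>Q\<^esub> Q.eval cs q \<otimes>\<^bsub>Q\<^esub> q [^]\<^bsub>Q\<^esub> e \<in> j ` K"
        using less k by (intro Q.mult_eval_in_subring[OF subring_j cs(2) q s]) auto
      ultimately show ?thesis using subringE(5)[OF subring_j] by simp
    qed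
  qed
  have "b ^ k dvd b ^ ?d * a ^ k" for k
  proof -
    from sq[of k] obtain c where c: "c \<in> K" "?s \<otimes>\<^bsub>Q\<^esub> q [^]\<^bsub>Q\<^esub> k = j c" by blast
    have "j (b ^ ?d * a ^ k) = ?s \<otimes>\<^bsub>Q\<^esub> (q [^]\<^bsub>Q\<^esub> k \<otimes>\<^bsub>Q\<^esub> j b [^]\<^bsub>Q\<^esub> k)"
      unfolding qb by (simp add: j_mult kernel_power ab j_power)
    also have "\<dots> = j c \<otimes>\<^bsub>Q\<^esub> j (b ^ k)"
      using s q jb by (simp add: c(2)[symmetric] j_power[OF ab(2)] Q.m_assoc)
    also have "\<dots> = j (c * b ^ k)" by (simp add: j_mult c kernel_power ab)
    finally have "b ^ ?d * a ^ k = c * b ^ k"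
      using ab c by (subst (asm) j_eq_iff) (simp_all add: kernel_power fil_kernel_closed)
    then show ?thesis by simp
  qed
  moreover have "a \<in> yvars (Suc n)" "b \<in> yvars (Suc n)" using ab by (simp_all add: fil_kernel_def)
  ultimately obtain c where c: "c \<in> yvars (Suc n)" "a = b * c"
    using ypoly_completely_integrally_closed[of a "Suc n" b "b ^ ?d"] ab(3) by auto
  have cK: "c \<in> K" by (rule fil_kernel_divide[OF ab(1-3) c])
  have "q \<otimes>\<^bsub>Q\<^esub> j b = j c \<otimes>\<^bsub>Q\<^esub> j b"
    using ab cK j_closed by (simp add: c(2) j_mult Q.m_comm)
  moreover have "j b \<noteq> \<zero>\<^bsub>Q\<^esub>" using ab(2,3) j_eq_iff[of b 0] by (simp add: j_0 fil_kernel_closed)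
  ultimately have "q = j c" using q jb j_closed[OF cK] by (simp add: Q.m_rcancel)
  then show ?thesis using cK by blast
qed

section \<open>The p-center and the ring generated over it by the z_i\<close>

private lemma two_neq_0: "2 \<le> i \<Longrightarrow> i \<le> n \<Longrightarrow> (2 :: 'k) \<noteq> 0"
proof -
  assume "2 \<le> i" "i \<le> n"
  then have "\<not> p dvd 2" using p(3) by (auto dest: dvd_imp_le)
  then have "of_nat 2 \<noteq> (0 :: 'k)" by (simp only: of_nat_eq_0_iff_char_dvd p(2) not_False_eq_True)
  then show ?thesis by simp
qed

private lemma power_p_in_kernel:
  assumes "f \<in> yvars (Suc n)"
  shows "f ^ p \<in> K"
proof -
  have "of_nat p = (0 :: 'k ypoly)" using p(2) of_nat_CHAR[where 'a = "'k ypoly"] by (simp add: CHAR_ypoly)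
  then show ?thesis
    using assms by (simp add: fil_kernel_def yvars_power derivation_power[OF derivation_fil_der]
        derivation_power[OF derivation_ypderiv])
qed

private lemma p_center_gens:
  "P (yconst c) \<in> fil_p_center p n" "P (yvar (Suc n) ^ p) \<in> fil_p_center p n"
  "P (yvar 0) \<in> fil_p_center p n" "1 \<le> i \<Longrightarrow> i \<le> n \<Longrightarrow> P (yvar i ^ p) \<in> fil_p_center p n"
  unfolding fil_p_center_def
  by (intro generate_ring.incl; auto simp: fil_poly_gens[symmetric])+

private lemma p_center_sub: "fil_p_center p n \<subseteq> P ` K"
  unfolding fil_p_center_def
proof (rule U.generate_ring_least)
  show "\<one>\<^bsub>U\<^esub> \<in> P ` K" using fil_poly_1 fil_kernel_closed(6) by (metis image_eqI)
  show "range (fil_const n) \<union> {fil_x n [^]\<^bsub>U\<^esub> p, fil_y n 0}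
      \<union> {fil_y n i [^]\<^bsub>U\<^esub> p | i. 1 \<le> i \<and> i \<le> n} \<subseteq> P ` K"
    by (auto simp: fil_poly_gens(1,2,4) fil_poly_gens(3)[of 0] fil_kernel_closed
        intro!: imageI power_p_in_kernel yvars_yvar)
qed (auto simp: fil_poly_uminus fil_kernel_closed simp flip: fil_poly_add fil_poly_mult)

text \<open>The p-th power map respects sums and products in characteristic p, so it suffices to
  look at scalars and variables.\<close>

private lemma power_p_in_p_center:
  assumes "f \<in> yvars (Suc n)"
  shows "P (f ^ p) \<in> fil_p_center p n"
proof -
  \<comment> \<open>Membership in \<open>K\<close> is carried through the induction because
    \<open>fil_poly\<close> is multiplicative only there.\<close>
  have "f ^ p \<in> K \<and> P (f ^ p) \<in> fil_p_center p n"
    using assms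
  proof (induction rule: yvars_induct)
    case (yconst c)
    have "yconst c ^ k = yconst (c ^ k)" for k by (induction k) (simp_all add: yconst_mult)
    then show ?case using p_center_gens(1) fil_kernel_closed(4) by simp
  next
    case (yvar i)
    have "yvar i ^ p \<in> K" using yvar by (intro power_p_in_kernel yvars_yvar)
    moreover have "P (yvar 0 ^ k) \<in> fil_p_center p n" for k
      using p_center_gens(1)[of 1] p_center_gens(3)
      by (induction k) (auto simp: fil_poly_mult kernel_power fil_kernel_closed fil_p_center_def
          intro!: generate_ring.eng_mult)
    ultimately show ?case
      using yvar p_center_gens by (cases "i = 0"; cases "i = Suc n") auto
  next
    case (add f g)
    have "(f + g) ^ p = f ^ p + g ^ p"
      by (rule freshmans_dream) (simp_all add: CHAR_ypoly p)
    with add show ?case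
      by (auto simp: fil_poly_add fil_kernel_closed fil_p_center_def intro!: generate_ring.eng_add)
  next
    case (mult f g)
    then show ?case
      by (auto simp: power_mult_distrib fil_poly_mult fil_kernel_closed fil_p_center_def
          intro!: generate_ring.eng_mult)
  qed
  then show ?thesis by simp
qed

private abbreviation (input) Zpz :: "'k fil_frac set" where "Zpz \<equiv> fil_Zpz p n"
private abbreviation (input) Zpz_loc :: "'k fil_frac set" where "Zpz_loc \<equiv> fil_Zpz_loc p n"

private lemma Zpz_gens_sub: "fil_p_center p n \<union> {fil_z n i | i. 2 \<le> i \<and> i \<le> n} \<subseteq> P ` K"
proof -
  have "fil_z n i \<in> P ` K" if "2 \<le> i" "i \<le> n" for i
    unfolding fil_z_eq[OF that] by (intro imageI z_int_in_fil_kernel two_neq_0[OF that] that)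
  then show ?thesis using p_center_sub by blast
qed

private lemma j_in_Zpz:
  "P c \<in> fil_p_center p n \<Longrightarrow> j c \<in> Zpz" "2 \<le> i \<Longrightarrow> i \<le> n \<Longrightarrow> j (z_int i) \<in> Zpz"
proof -
  show "P c \<in> fil_p_center p n \<Longrightarrow> j c \<in> Zpz"
    unfolding fil_Zpz_def j_def by (intro generate_ring.incl imageI UnI1)
  show "j (z_int i) \<in> Zpz" if "2 \<le> i" "i \<le> n"
    unfolding fil_Zpz_def j_def fil_z_eq[OF that, symmetric]
    by (intro generate_ring.incl imageI UnI2) (use that in blast)
qed

private lemma Zpz_sub: "Zpz \<subseteq> j ` K"
  unfolding fil_Zpz_def
proof (rule Q.generate_ring_min_subring1[OF _ subring_j])
  show *: "fil_emb n ` (fil_p_center p n \<union> {fil_z n i | i. 2 \<le> i \<and> i \<le> n}) \<subseteq> j ` K"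
    using image_mono[OF Zpz_gens_sub, of "fil_emb n"] by (simp only: image_image j_def[abs_def])
  then show "fil_emb n ` (fil_p_center p n \<union> {fil_z n i | i. 2 \<le> i \<and> i \<le> n}) \<subseteq> carrier Q"
    using subringE(1)[OF subring_j] by blast
qed

private lemma Zpz_carrier: "Zpz \<subseteq> carrier Q"
  using Zpz_sub subringE(1)[OF subring_j] by blast

private lemma Zpz_closed:
  "a \<in> Zpz \<Longrightarrow> b \<in> Zpz \<Longrightarrow> a \<oplus>\<^bsub>Q\<^esub> b \<in> Zpz" "a \<in> Zpz \<Longrightarrow> b \<in> Zpz \<Longrightarrow> a \<otimes>\<^bsub>Q\<^esub> b \<in> Zpz"
  "a \<in> Zpz \<Longrightarrow> \<ominus>\<^bsub>Q\<^esub> a \<in> Zpz" "\<one>\<^bsub>Q\<^esub> \<in> Zpz" "\<zero>\<^bsub>Q\<^esub> \<in> Zpz"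
proof -
  show 1: "\<one>\<^bsub>Q\<^esub> \<in> Zpz" unfolding fil_Zpz_def by (rule generate_ring.one)
  show "\<zero>\<^bsub>Q\<^esub> \<in> Zpz" unfolding fil_Zpz_def by (rule ring.zero_in_generate[OF Q.ring_axioms])
qed (unfold fil_Zpz_def, (erule (1) generate_ring.eng_add | erule (1) generate_ring.eng_mult
    | erule generate_ring.a_inv)+)

private lemma y0_in: "j (yvar 0) \<in> Zpz" "j (yvar 0) \<noteq> \<zero>\<^bsub>Q\<^esub>"
  using j_in_Zpz(1)[OF p_center_gens(3)] j_eq_iff[of "yvar 0" 0]
  by (simp_all add: j_0 fil_kernel_closed)

private lemma Zpz_sub_loc: "Zpz \<subseteq> Zpz_loc"
  unfolding fil_Zpz_def fil_Zpz_loc_def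
proof
  fix h assume "h \<in> generate_ring Q (fil_emb n ` (fil_p_center p n \<union> {fil_z n i | i. 2 \<le> i \<and> i \<le> n}))"
  then show "h \<in> generate_ring Q (fil_emb n ` (fil_p_center p n \<union> {fil_z n i | i. 2 \<le> i \<and> i \<le> n})
      \<union> {inv\<^bsub>Q\<^esub> (fil_emb n (fil_y n 0))})"
    by induction (rule generate_ring.one, rule generate_ring.incl, erule UnI1, erule generate_ring.a_inv,
        erule (1) generate_ring.eng_add, erule (1) generate_ring.eng_mult)
qed

private lemma j_in_loc:
  assumes "c \<in> K"
  shows "j c \<in> Zpz_loc"
proof -
  let ?T = "{c \<in> K. j c \<in> Zpz}"
  have "\<exists>k. yvar 0 ^ k * c \<in> ?T"
  proof (rule fil_kernel_localization[OF n p _ _ _ _ _ _ _ _ assms])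
    show "yconst a \<in> ?T" for a using j_in_Zpz(1)[OF p_center_gens(1)] by (simp add: fil_kernel_closed)
    show "yvar 0 \<in> ?T" using y0_in by (simp add: fil_kernel_closed)
    show "yvar 1 ^ p \<in> ?T" "yvar (Suc n) ^ p \<in> ?T"
      using n by (auto intro!: power_p_in_kernel yvars_yvar j_in_Zpz power_p_in_p_center)
    show "z_int i \<in> ?T" if "2 \<le> i" "i \<le> n" for i
      using that j_in_Zpz(2) z_int_in_fil_kernel two_neq_0 by blast
    show "fil_der n f = 0" if "f \<in> ?T" for f using that by (simp add: fil_kernel_def)
  qed (auto simp: fil_kernel_closed j_add j_mult Zpz_closed)
  then obtain k where k: "yvar 0 ^ k * c \<in> K" "j (yvar 0 ^ k * c) \<in> Zpz" by blast
  have inv: "inv\<^bsub>Q\<^esub> j (yvar 0) \<in> Zpz_loc"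
    unfolding fil_Zpz_loc_def j_def by (rule generate_ring.incl) (simp add: fil_poly_gens)
  have y0: "yvar 0 \<in> K" by (rule fil_kernel_closed)
  have "j (yvar 0 ^ k * c) \<in> Zpz_loc" using k(2) Zpz_sub_loc by blast
  then show ?thesis
  \<comment> \<open>Each step removes one factor y_0 by multiplying with its inverse, which is a
    generator of the localization.\<close>
  proof (induction k)
    case (Suc k)
    let ?y = "j (yvar 0)" and ?w = "j (yvar 0 ^ k * c)"
    have w: "?w \<in> carrier Q" using assms by (intro j_closed fil_kernel_closed kernel_power y0)
    have y: "?y \<in> carrier Q" "?y \<in> Units Q" using y0_in(2) j_closed[OF y0] by (simp_all add: Q.field_Units)
    have "j (yvar 0 ^ Suc k * c) = ?y \<otimes>\<^bsub>Q\<^esub> ?w"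
      using j_mult[OF y0, of "yvar 0 ^ k * c"] assms by (simp add: fil_kernel_closed kernel_power y0 mult.assoc)
    then have "inv\<^bsub>Q\<^esub> ?y \<otimes>\<^bsub>Q\<^esub> j (yvar 0 ^ Suc k * c) = ?w"
      using w y by (simp add: Q.m_assoc[symmetric] Q.Units_l_inv Q.Units_inv_closed)
    moreover have "inv\<^bsub>Q\<^esub> ?y \<otimes>\<^bsub>Q\<^esub> j (yvar 0 ^ Suc k * c) \<in> Zpz_loc"
      using inv Suc.prems unfolding fil_Zpz_loc_def by (rule generate_ring.eng_mult)
    ultimately show ?case using Suc.IH by simp
  qed simp
qed

text \<open>y_0 is a nonzero element of Z_p(g), so its inverse already lies in the field of
  fractions.\<close>

private lemma loc_sub_field: "Zpz_loc \<subseteq> generate_field Q Zpz"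
proof
  fix h assume "h \<in> Zpz_loc"
  then show "h \<in> generate_field Q Zpz"
    unfolding fil_Zpz_loc_def
  proof induction
    case (incl h)
    then consider "h \<in> Zpz" | "h = inv\<^bsub>Q\<^esub> (j (yvar 0))"
      by (auto simp: fil_Zpz_def j_def fil_poly_gens intro: generate_ring.incl)
    then show ?case
      using y0_in by cases (auto intro: generate_field.incl generate_field.m_inv)
  qed (rule generate_field.one | erule generate_field.a_inv
      | erule (1) generate_field.eng_add | erule (1) generate_field.eng_mult)+
qed

private lemma j_integral:
  assumes "c \<in> K"
  shows "\<exists>f. polynomial\<^bsub>Q\<^esub> Zpz f \<and> f \<noteq> [] \<and> lead_coeff f = \<one>\<^bsub>Q\<^esub> \<and> Q.eval f (j c) = \<zero>\<^bsub>Q\<^esub>"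
proof -
  have "c \<in> yvars (Suc n)" using assms by (simp add: fil_kernel_def)
  then have cp: "j (c ^ p) \<in> Zpz" by (intro j_in_Zpz power_p_in_p_center)
  obtain q where q: "p = Suc q" using p by (cases p) auto
  \<comment> \<open>The coefficient list of X^p - c^p: leading 1, p - 1 zeros, constant
    term.\<close>
  let ?f = "\<one>\<^bsub>Q\<^esub> # replicate q \<zero>\<^bsub>Q\<^esub> @ [\<ominus>\<^bsub>Q\<^esub> j (c ^ p)]"
  have "polynomial\<^bsub>Q\<^esub> Zpz ?f"
    using Zpz_closed cp by (auto simp: polynomial_def set_replicate_conv_if)
  moreover have "Q.eval ?f (j c) = j c [^]\<^bsub>Q\<^esub> p \<oplus>\<^bsub>Q\<^esub> (\<ominus>\<^bsub>Q\<^esub> j (c ^ p))"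
  proof -
    have "Q.eval (replicate q \<zero>\<^bsub>Q\<^esub> @ [\<ominus>\<^bsub>Q\<^esub> j (c ^ p)]) (j c) = \<ominus>\<^bsub>Q\<^esub> j (c ^ p)"
      by (rule Q.eval_replicate_zero) (simp_all add: j_closed kernel_power assms)
    then show ?thesis using j_closed[OF assms] by (simp add: q del: power_Suc)
  qed
  moreover have "\<dots> = \<zero>\<^bsub>Q\<^esub>"
    using j_closed[OF assms] by (simp add: j_power[OF assms] Q.r_neg)
  ultimately show ?thesis by (intro exI[of _ ?f]) simp
qed

text \<open>The center is integral over Z_p(g)[z_2, ..., z_n] and integrally closed in its fraction
  field, so every ring \<open>B\<close> between the center and that field gives the same integral
  closure. Both equalities of the theorem are instances.\<close>

private lemma integral_closure_Zpz:
  assumes "j ` K \<subseteq> B" "B \<subseteq> carrier Q"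
  shows "integral_closure Q Zpz B = j ` K"
proof
  show "j ` K \<subseteq> integral_closure Q Zpz B"
  proof
    fix q assume "q \<in> j ` K"
    then obtain c where c: "q = j c" "c \<in> K" by (rule imageE)
    then have "q \<in> B" using assms(1) by blast
    with j_integral[OF c(2)] show "q \<in> integral_closure Q Zpz B"
      by (simp only: integral_closure_def mem_Collect_eq c(1))
  qed
  show "integral_closure Q Zpz B \<subseteq> j ` K"
  proof
    fix q assume "q \<in> integral_closure Q Zpz B"
    then obtain f where f: "q \<in> B" "polynomial\<^bsub>Q\<^esub> Zpz f" "f \<noteq> []" "lead_coeff f = \<one>\<^bsub>Q\<^esub>"
      "Q.eval f q = \<zero>\<^bsub>Q\<^esub>"
      unfolding integral_closure_def by blast
    then have "set f \<subseteq> j ` K" using Zpz_sub by (auto simp: polynomial_def)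
    then show "q \<in> j ` K"
      by (rule fil_center_integrally_closed[OF subsetD[OF assms(2) f(1)] _ f(3-5)])
  qed
qed

lemma fil_center_integral_closures:
  "fil_emb n ` (fil_center n :: ('k, 'k fil) free_alg set set)
     = integral_closure Q Zpz (generate_field Q Zpz)
   \<and> fil_emb n ` (fil_center n :: ('k, 'k fil) free_alg set set) = integral_closure Q Zpz Zpz_loc
   \<and> fil_emb n ` (fil_center n :: ('k, 'k fil) free_alg set set) \<subseteq> Zpz_loc"
proof -
  have emb: "fil_emb n ` fil_center n = j ` K"
    by (auto simp: fil_center_eq j_def)
  have loc: "j ` K \<subseteq> Zpz_loc" using j_in_loc by blast
  have field: "generate_field Q Zpz \<subseteq> carrier Q" by (rule Q.generate_field_incl[OF Zpz_carrier])
  show ?thesis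
    unfolding emb
    using integral_closure_Zpz[OF loc subset_trans[OF loc_sub_field field]]
      integral_closure_Zpz[OF subset_trans[OF loc loc_sub_field] field] loc by simp
qed

end

theorem theorem1p4:
  fixes n p :: nat
  assumes "n \<ge> 1"
    and "Factorial_Ring.prime p"
    and "CHAR('k::field) = p"
    and "p \<ge> n + 1"
  shows "fil_emb n ` (fil_center n :: ('k, 'k fil) free_alg set set)
       = integral_closure (fil_Q n) (fil_Zpz p n) (generate_field (fil_Q n) (fil_Zpz p n))
     \<and> fil_emb n ` (fil_center n :: ('k, 'k fil) free_alg set set)
       = integral_closure (fil_Q n) (fil_Zpz p n) (fil_Zpz_loc p n)
     \<and> fil_emb n ` (fil_center n :: ('k, 'k fil) free_alg set set) \<subseteq> fil_Zpz_loc p n"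
  by (rule fil_center_integral_closures[OF assms])

end
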